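(* Let $M\subset\mathbb{S}^{n+1}$ be a compact rotational constant mean curvature hypersurface generated by data $(n,H,c,r,\theta,l,m)$ as described in the context. If $m$ and $l$ are the relatively prime integers with $\theta(T)=2\pi\frac{l}{m}$, then the number of negative eigenvalues of the Jacobi operator $J$ of $M$, counted with multiplicity, is at least $(2l-1)n+(2m-1)$.
   Context: Rotational CMC hypersurfaces of the unit sphere $\mathbb{S}^{n+1}\subset\mathbb{R}^{n+2}$, $n\ge 2$. Fix $H\in\mathbb{R}$ and $c>0$. Let $r:\mathbb{R}\to(0,1)$ be a smooth non-constant periodic function with least period $T>0$ satisfying $$(r')^2+r^2(1+\lambda^2)=1,\qquad \lambda(t)=H+c^{-n/2}r(t)^{-n}.$$ Put $$\theta(t)=\int_0^t\frac{r(\tau)\lambda(\tau)}{1-r(\tau)^2}\,d\tau,$$ and assume that $c$ is such that $\theta(T)=2\pi\frac{l}{m}$ with $l,m$ relatively prime integers, $m\geq 1$. The immersion is $$\phi:\mathbb{S}^{n-1}\times\mathbb{R}\to\mathbb{S}^{n+1},\qquad \phi(y,t)=\left(r(t)\,y,\ \sqrt{1-r(t)^2}\cos\theta(t),\ \sqrt{1-r(t)^2}\sin\theta(t)\right).$$ It satisfies $\phi(y,t+mT)=\phi(y,t)$. The compact rotational hypersurface $M$ is the compact manifold $\mathbb{S}^{n-1}\times(\mathbb{R}/mT\mathbb{Z})$ immersed by $\phi$, with the induced metric; it has constant mean curvature $H$. Its principal curvatures are $\lambda$ with multiplicity $n-1$ and $\mu=H-(n-1)c^{-n/2}r^{-n}$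 with multiplicity one. The Jacobi (stability) operator is $J(f)=-\Delta f-nf-|A|^2f$, where $\Delta=\mathrm{div}\,\nabla$ is the Laplacian of $M$ and $|A|^2$ is the square of the norm of the second fundamental form of $M$. Its eigenvalues are the numbers $\lambda$ with $J(f)=\lambda f$ for some smooth $f\not\equiv0$ on $M$. *)

theory Defs
  imports "HOL-Analysis.Analysis"
begin

section \<open>Smooth functions\<close>

text \<open>Being \<open>k\<close> times continuously differentiable on an open set: all iterated directional
  derivatives of order at most \<open>k\<close> exist (as Frechet derivatives) and are continuous.\<close>

primrec Ck_on :: "nat \<Rightarrow> ('a::real_normed_vector \<Rightarrow> 'b::real_normed_vector) \<Rightarrow> 'a set \<Rightarrow> bool" where
  "Ck_on 0 f S \<longleftrightarrow> continuous_on S f"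
| "Ck_on (Suc k) f S \<longleftrightarrow> (\<forall>x\<in>S. f differentiable (at x)) \<and>
     (\<forall>v. Ck_on k (\<lambda>x. frechet_derivative f (at x) v) S)"

definition smooth_on_open :: "('a::real_normed_vector \<Rightarrow> 'b::real_normed_vector) \<Rightarrow> 'a set \<Rightarrow> bool" where
  "smooth_on_open f S \<longleftrightarrow> open S \<and> (\<forall>k. Ck_on k f S)"

section \<open>Calculus on the cylinder over the unit sphere\<close>

text \<open>The closed manifold \<open>S\<^sup>n\<^sup>-\<^sup>1 \<times> (\<real> / P \<int>)\<close> is handled through its cover
  \<open>S\<^sup>n\<^sup>-\<^sup>1 \<times> \<real>\<close>, a submanifold of \<open>\<real>\<^sup>n \<times> \<real>\<close> with \<open>n = CARD('n)\<close>: functions on the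
  quotient are functions on the cover that have period \<open>P\<close> in the second variable.
  Values of functions off the cylinder are irrelevant everywhere below.\<close>

abbreviation cylinder :: "((real^'n) \<times> real) set" where
  "cylinder \<equiv> sphere 0 1 \<times> UNIV"

definition tangent_space :: "(real^'n) \<times> real \<Rightarrow> ((real^'n) \<times> real) set" where
  "tangent_space p = {v. fst v \<bullet> fst p = 0}"

text \<open>Functions on the cylinder are extended to the open set
  \<open>(\<real>\<^sup>n - {0}) \<times> \<real>\<close>, constantly along rays, in order to be differentiated.\<close>

definition radial_ext :: "((real^'n) \<times> real \<Rightarrow> 'b) \<Rightarrow> (real^'n) \<times> real \<Rightarrow> 'b" where
  "radial_ext f = (\<lambda>(z, t). f (z /\<^sub>R norm z, t))"

definition smooth_on_cylinder :: "((real^'n) \<times> real \<Rightarrow> 'b::real_normed_vector) \<Rightarrow> bool" where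
  "smooth_on_cylinder f \<longleftrightarrow> smooth_on_open (radial_ext f) ((- {0}) \<times> UNIV)"

text \<open>The differential at a point \<open>p\<close> of the cylinder in the direction of a tangent vector.
  Because of the radial extension, for an arbitrary vector \<open>v\<close> of \<open>\<real>\<^sup>n \<times> \<real>\<close> the value is the
  derivative in the direction of the orthogonal projection of \<open>v\<close> to the tangent space.\<close>

definition mderiv ::
  "((real^'n) \<times> real \<Rightarrow> 'b::real_normed_vector) \<Rightarrow> (real^'n) \<times> real \<Rightarrow> (real^'n) \<times> real \<Rightarrow> 'b" where
  "mderiv f p v = frechet_derivative (radial_ext f) (at p) v"

section \<open>Geometry of an immersion of the cylinder\<close>

definition induced_metric ::
  "((real^'n) \<times> real \<Rightarrow> 'b::euclidean_space) \<Rightarrow> (real^'n) \<times> real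
    \<Rightarrow> (real^'n) \<times> real \<Rightarrow> (real^'n) \<times> real \<Rightarrow> real" where
  "induced_metric \<phi> p u v = mderiv \<phi> p u \<bullet> mderiv \<phi> p v"

text \<open>Some orthonormal basis of the tangent space for the induced metric; it is only used to
  form traces, which do not depend on the choice.\<close>

definition orthonormal_frame ::
  "((real^'n) \<times> real \<Rightarrow> 'b::euclidean_space) \<Rightarrow> (real^'n) \<times> real \<Rightarrow> ((real^'n) \<times> real) set" where
  "orthonormal_frame \<phi> p = (SOME B. finite B \<and> span B = tangent_space p \<and>
     (\<forall>a\<in>B. \<forall>b\<in>B. induced_metric \<phi> p a b = (if a = b then 1 else 0)))"

definition gradient ::
  "((real^'n) \<times> real \<Rightarrow> 'b::euclidean_space) \<Rightarrow> ((real^'n) \<times> real \<Rightarrow> real)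
    \<Rightarrow> (real^'n) \<times> real \<Rightarrow> (real^'n) \<times> real" where
  "gradient \<phi> f p = (THE u. u \<in> tangent_space p \<and>
     (\<forall>v\<in>tangent_space p. induced_metric \<phi> p u v = mderiv f p v))"

text \<open>The divergence of a tangent field \<open>U\<close> is the trace of \<open>v \<mapsto> \<nabla>\<^sub>v U\<close>. The Levi-Civita
  connection of the induced metric is the tangential part of the flat derivative of the ambient
  space: \<open>d\<phi>(\<nabla>\<^sub>v U)\<close> is the orthogonal projection of \<open>D\<^sub>v (d\<phi>(U))\<close> onto the image of \<open>d\<phi>\<close>.
  Taking the inner product with \<open>d\<phi>(e)\<close> makes the projection superfluous.\<close>

definition divergence ::
  "((real^'n) \<times> real \<Rightarrow> 'b::euclidean_space) \<Rightarrow> ((real^'n) \<times> real \<Rightarrow> (real^'n) \<times> real)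
    \<Rightarrow> (real^'n) \<times> real \<Rightarrow> real" where
  "divergence \<phi> U p =
     (\<Sum>e\<in>orthonormal_frame \<phi> p. mderiv (\<lambda>q. mderiv \<phi> q (U q)) p e \<bullet> mderiv \<phi> p e)"

definition laplacian ::
  "((real^'n) \<times> real \<Rightarrow> 'b::euclidean_space) \<Rightarrow> ((real^'n) \<times> real \<Rightarrow> real)
    \<Rightarrow> (real^'n) \<times> real \<Rightarrow> real" where
  "laplacian \<phi> f = divergence \<phi> (gradient \<phi> f)"

text \<open>For a hypersurface of the unit sphere: a unit vector tangent to the sphere at \<open>\<phi> p\<close> (that
  is, orthogonal to \<open>\<phi> p\<close>) and normal to the immersion. It is unique up to sign.\<close>

definition unit_normal ::
  "((real^'n) \<times> real \<Rightarrow> 'b::euclidean_space) \<Rightarrow> (real^'n) \<times> real \<Rightarrow> 'b" where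
  "unit_normal \<phi> p = (SOME \<nu>. norm \<nu> = 1 \<and> \<nu> \<bullet> \<phi> p = 0 \<and>
     (\<forall>v\<in>tangent_space p. \<nu> \<bullet> mderiv \<phi> p v = 0))"

text \<open>\<open>A(u, v)\<close> is the component along the unit normal of \<open>D\<^sub>u (d\<phi>(V))\<close> for a tangent field \<open>V\<close>
  with value \<open>v\<close> at \<open>p\<close>. Here \<open>V\<close> is the tangential projection of the constant field \<open>v\<close>, in
  accordance with the remark on \<open>mderiv\<close>.\<close>

definition second_fundamental_form ::
  "((real^'n) \<times> real \<Rightarrow> 'b::euclidean_space) \<Rightarrow> (real^'n) \<times> real
    \<Rightarrow> (real^'n) \<times> real \<Rightarrow> (real^'n) \<times> real \<Rightarrow> real" where
  "second_fundamental_form \<phi> p u v = mderiv (\<lambda>q. mderiv \<phi> q v) p u \<bullet> unit_normal \<phi> p"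

definition sq_norm_second_fundamental_form ::
  "((real^'n) \<times> real \<Rightarrow> 'b::euclidean_space) \<Rightarrow> (real^'n) \<times> real \<Rightarrow> real" where
  "sq_norm_second_fundamental_form \<phi> p =
     (\<Sum>a\<in>orthonormal_frame \<phi> p. \<Sum>b\<in>orthonormal_frame \<phi> p.
        (second_fundamental_form \<phi> p a b)\<^sup>2)"

section \<open>The Jacobi operator and its negative spectrum\<close>

definition jacobi_operator ::
  "((real^'n) \<times> real \<Rightarrow> 'b::euclidean_space) \<Rightarrow> ((real^'n) \<times> real \<Rightarrow> real)
    \<Rightarrow> (real^'n) \<times> real \<Rightarrow> real" where
  "jacobi_operator \<phi> f p =
     - laplacian \<phi> f p - real CARD('n) * f p - sq_norm_second_fundamental_form \<phi> p * f p"

text \<open>In the following \<open>P\<close> is the period, so that the manifold is \<open>S\<^sup>n\<^sup>-\<^sup>1 \<times> (\<real> / P \<int>)\<close>.\<close>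

definition smooth_functions :: "real \<Rightarrow> ((real^'n) \<times> real \<Rightarrow> real) set" where
  "smooth_functions P = {f. smooth_on_cylinder f \<and>
     (\<forall>y\<in>sphere 0 1. \<forall>t. f (y, t + P) = f (y, t))}"

definition jacobi_eigenspace ::
  "((real^'n) \<times> real \<Rightarrow> 'b::euclidean_space) \<Rightarrow> real \<Rightarrow> real \<Rightarrow> ((real^'n) \<times> real \<Rightarrow> real) set" where
  "jacobi_eigenspace \<phi> P \<kappa> =
     {f \<in> smooth_functions P. \<forall>p\<in>cylinder. jacobi_operator \<phi> f p = \<kappa> * f p}"

definition jacobi_eigenvalue ::
  "((real^'n) \<times> real \<Rightarrow> 'b::euclidean_space) \<Rightarrow> real \<Rightarrow> real \<Rightarrow> bool" where
  "jacobi_eigenvalue \<phi> P \<kappa> \<longleftrightarrow> (\<exists>f\<in>jacobi_eigenspace \<phi> P \<kappa>. \<exists>p\<in>cylinder. f p \<noteq> 0)"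

definition lin_indep_on_cylinder :: "nat \<Rightarrow> (nat \<Rightarrow> (real^'n) \<times> real \<Rightarrow> real) \<Rightarrow> bool" where
  "lin_indep_on_cylinder k F \<longleftrightarrow>
     (\<forall>c. (\<forall>p\<in>cylinder. (\<Sum>i<k. c i * F i p) = 0) \<longrightarrow> (\<forall>i<k. c i = 0))"

text \<open>The dimension of the eigenspace, as a space of functions on the cylinder.\<close>

definition jacobi_multiplicity ::
  "((real^'n) \<times> real \<Rightarrow> 'b::euclidean_space) \<Rightarrow> real \<Rightarrow> real \<Rightarrow> enat" where
  "jacobi_multiplicity \<phi> P \<kappa> =
     (SUP k \<in> {k. \<exists>F. (\<forall>i<k. F i \<in> jacobi_eigenspace \<phi> P \<kappa>) \<and> lin_indep_on_cylinder k F}. enat k)"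

text \<open>The sum of the multiplicities of all negative eigenvalues, as the supremum of its finite
  partial sums.\<close>

definition num_negative_eigenvalues ::
  "((real^'n) \<times> real \<Rightarrow> 'b::euclidean_space) \<Rightarrow> real \<Rightarrow> enat" where
  "num_negative_eigenvalues \<phi> P =
     (SUP K \<in> {K. finite K \<and> K \<subseteq> {\<kappa>. \<kappa> < 0 \<and> jacobi_eigenvalue \<phi> P \<kappa>}}.
        \<Sum>\<kappa>\<in>K. jacobi_multiplicity \<phi> P \<kappa>)"

section \<open>Rotational hypersurfaces\<close>

definition rot_lambda :: "nat \<Rightarrow> real \<Rightarrow> real \<Rightarrow> (real \<Rightarrow> real) \<Rightarrow> real \<Rightarrow> real" where
  "rot_lambda n H c r t = H + c powr (- real n / 2) * r t powr (- real n)"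

definition rot_theta :: "nat \<Rightarrow> real \<Rightarrow> real \<Rightarrow> (real \<Rightarrow> real) \<Rightarrow> real \<Rightarrow> real" where
  "rot_theta n H c r t = (LBINT \<tau>=0..ereal t. r \<tau> * rot_lambda n H c r \<tau> / (1 - (r \<tau>)\<^sup>2))"

text \<open>The sphere \<open>S\<^sup>n\<^sup>+\<^sup>1\<close> is the unit sphere of \<open>\<real>\<^sup>n \<times> \<real> \<times> \<real>\<close>.\<close>

definition rot_immersion ::
  "real \<Rightarrow> real \<Rightarrow> (real \<Rightarrow> real) \<Rightarrow> (real^'n) \<times> real \<Rightarrow> (real^'n) \<times> real \<times> real" where
  "rot_immersion H c r = (\<lambda>(y, t).
     (r t *\<^sub>R y,
      sqrt (1 - (r t)\<^sup>2) * cos (rot_theta CARD('n) H c r t),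
      sqrt (1 - (r t)\<^sup>2) * sin (rot_theta CARD('n) H c r t)))"

end

theory Submission
  imports Defs
begin

text \<open>The profile curve has unit speed, so the induced metric is \<open>dt\<^sup>2 + r\<^sup>2 g\<close> with \<open>g\<close> the metric of
the unit sphere, and the Jacobi operator separates variables. On a function \<open>u(t)\<close> and on a
function \<open>u(t) y\<^sub>i\<close> it acts on \<open>u\<close> as
\<open>u \<mapsto> - u'' - (n-1) (r'/r) u' + V\<^sub>e u\<close> with \<open>V\<^sub>e = e (n-1)/r\<^sup>2 - n - |A|\<^sup>2\<close>, where \<open>e = 0\<close> or \<open>e = 1\<close>
(\<open>jacobi_operator_separated\<close>). An eigenfunction \<open>u\<close> of period \<open>m T\<close> contributes one dimension to the
eigenspace of \<open>J\<close> if \<open>e = 0\<close> and \<open>n\<close> dimensions if \<open>e = 1\<close>, and all of them are independent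
(\<open>multiplicity_ge\<close>). So it is enough to find \<open>2m - 1\<close> negative eigenvalues of the first ordinary
differential operator and, if \<open>l > 0\<close>, \<open>2l - 1\<close> of the second, with multiplicity; for \<open>l \<le> 0\<close> the
term \<open>(2l - 1) n\<close> of the bound is negative.

Zero is an eigenvalue of both, because a rotation of the ambient space induces a Jacobi field. The
rotation of the last two coordinates induces \<open>r'\<close>. A rotation that mixes \<open>y\<^sub>i\<close> with the next to last
coordinate induces \<open>w y\<^sub>i\<close>, where \<open>w\<close> is the real part of
\<open>- r (1-r\<^sup>2)\<^sup>-\<^sup>1\<^sup>/\<^sup>2 (\<lambda> + i r') exp(i \<theta>)\<close>. By Sturm's oscillation theorem, the number of zeros of
a periodic null solution bounds the number of negative eigenvalues from below: \<open>2N\<close> zeros in a period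
force \<open>2N - 1\<close> negative eigenvalues. The function \<open>r'\<close> changes sign in each period \<open>T\<close>, so it has at
least \<open>2m\<close> zeros in a period \<open>m T\<close>. For \<open>w\<close>, the zeros are counted by the argument of the complex
number above: \<open>\<theta>\<close> contributes \<open>2 pi l\<close>, and \<open>\<lambda> + i r'\<close> can cross the imaginary axis only
counterclockwise, so that its argument does not decrease in a period
(\<open>polar_angle_of_curvature\<close>).

The oscillation theorem is proved with the Pruefer phase. A solution is written as
\<open>(u, p u') = R (sin \<alpha>, cos \<alpha>)\<close> with \<open>p = r\<^sup>n\<^sup>-\<^sup>1\<close>; the phase \<open>\<alpha>\<close> satisfies a first-order
equation of its own. Let \<open>F \<kappa>\<close> map the initial phase to the phase after one period. It commutes with
the shift by \<open>pi\<close> and is increasing, so the displacement \<open>F \<kappa> \<alpha> - \<alpha>\<close> oscillates by less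
than \<open>pi\<close>. If the maximum or the minimum of the displacement over \<open>\<alpha>\<close> equals \<open>2 pi j\<close>, then the
solution with the extremal initial phase is periodic, because the period map preserves area
(\<open>extremal_angle_periodic_solution\<close>). For \<open>\<kappa>\<close> very negative the displacement stays below \<open>pi\<close> and is somewhere negative, and at
\<open>\<kappa> = 0\<close> it exceeds \<open>2 pi j\<close> for all \<open>j < N\<close>. Hence the minimum takes the value \<open>2 pi j\<close> for some negative
\<open>\<kappa>\<close> for each \<open>j < N\<close>, and so does the maximum if \<open>j > 0\<close>. If both happen at the same \<open>\<kappa>\<close>,
all solutions are periodic. Different \<open>j\<close> give different \<open>\<kappa>\<close>. This makes \<open>2N - 1\<close> eigenvalues
(\<open>negative_eigenvalues_from_turning\<close>).\<close>

section \<open>Antiderivatives, Gronwall's inequality and polar angles\<close>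

lemma differentiable_imp_continuous_on:
  fixes f :: "real \<Rightarrow> real"
  assumes "\<And>t. (f has_real_derivative f' t) (at t)"
  shows "continuous_on A f"
  using assms DERIV_isCont by (intro continuous_at_imp_continuous_on ballI) blast

lemma antiderivative_exists:
  fixes f :: "real \<Rightarrow> real"
  assumes "continuous_on UNIV f"
  obtains F where "F 0 = 0" "\<And>t. (F has_real_derivative f t) (at t)"
proof -
  have "isCont f x" for x
    using assms by (simp add: continuous_on_eq_continuous_at)
  then obtain G where G: "\<And>x::real. (G has_vector_derivative f x) (at x)"
    using einterval_antiderivative[of "-\<infinity>" \<infinity> f] by auto
  show thesis
  proof
    show "((\<lambda>t. G t - G 0) has_real_derivative f t) (at t)" for t
      using G[of t] by (auto simp: has_real_derivative_iff_has_vector_derivative intro!: derivative_eq_intros)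
  qed simp
qed

lemma derivative_exp_bound:
  fixes F :: "real \<Rightarrow> real"
  assumes F: "F 0 = 0" "\<And>t. (F has_real_derivative f t) (at t)"
    and bound: "\<And>t. \<bar>f t\<bar> \<le> K * exp (M * \<bar>t\<bar>)" and "M > 0" "K \<ge> 0"
  shows "\<bar>F t\<bar> \<le> K / M * exp (M * \<bar>t\<bar>)"
proof -
  have *: "G u \<le> K / M * exp (M * u)" if G: "G 0 = 0" "\<And>t. (G has_real_derivative g t) (at t)"
    and b: "\<And>t. \<bar>g t\<bar> \<le> K * exp (M * \<bar>t\<bar>)" and "u \<ge> 0" for G g and u :: real
  proof -
    have "K / M * exp (M * 0) - G 0 \<le> K / M * exp (M * u) - G u"
    proof (rule DERIV_nonneg_imp_nondecreasing[OF \<open>u \<ge> 0\<close>])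
      fix x :: real assume "0 \<le> x"
      show "\<exists>y. ((\<lambda>u. K / M * exp (M * u) - G u) has_real_derivative y) (at x) \<and> 0 \<le> y"
        using b[of x] \<open>0 \<le> x\<close> \<open>M > 0\<close>
        by (intro exI[of _ "K * exp (M * x) - g x"]) (auto intro!: derivative_eq_intros G)
    qed
    then show ?thesis using G(1) divide_nonneg_pos[OF \<open>K \<ge> 0\<close> \<open>M > 0\<close>] by simp
  qed
  have rev: "((\<lambda>t. F (-t)) has_real_derivative - f (-t)) (at t)" for t
    using DERIV_mirror[of F "f (-t)" t] F(2)[of "-t"] by simp
  have neg: "((\<lambda>t. - F t) has_real_derivative - f t) (at t)" for t
    by (rule DERIV_minus[OF F(2)])
  have negrev: "((\<lambda>t. - F (-t)) has_real_derivative f (-t)) (at t)" for t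
    using DERIV_minus[OF rev[of t]] by simp
  have b': "\<bar>f (- t)\<bar> \<le> K * exp (M * \<bar>t\<bar>)" for t using bound[of "-t"] by simp
  show ?thesis
  proof (cases "t \<ge> 0")
    case True
    have "F t \<le> K / M * exp (M * t)" by (rule *[OF F(1,2) bound True])
    moreover have "- F t \<le> K / M * exp (M * t)" by (rule *[OF _ neg _ True]) (use F(1) bound in auto)
    ultimately show ?thesis using True by simp
  next
    case False
    then have t: "- t \<ge> 0" by simp
    have "F (- (-t)) \<le> K / M * exp (M * - t)" by (rule *[OF _ rev _ t]) (use F(1) b' in auto)
    moreover have "- F (- (-t)) \<le> K / M * exp (M * - t)" by (rule *[OF _ negrev _ t]) (use F(1) b' in auto)
    ultimately show ?thesis using False by simp
  qed
qed

text \<open>Picard iteration on the whole line at once: in the norm \<open>sup |h| exp(- M |t|)\<close> with \<open>M\<close> twice the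
Lipschitz constant, the integral operator contracts by the factor \<open>1/2\<close>. The unknown of the fixed
point equation is the bounded function \<open>h = exp(- M |t|) (\<theta> - \<alpha>)\<close>.\<close>

lemma lipschitz_ode_global_solution:
  fixes f :: "real \<Rightarrow> real \<Rightarrow> real"
  assumes cont: "continuous_on UNIV (\<lambda>(t, x). f t x)"
    and bounded: "\<And>t x. \<bar>f t x\<bar> \<le> C"
    and lip: "\<And>t x y. \<bar>f t x - f t y\<bar> \<le> L * \<bar>x - y\<bar>" and "L > 0"
  obtains \<theta> where "\<theta> 0 = \<alpha>" "\<And>t. (\<theta> has_real_derivative f t (\<theta> t)) (at t)"
proof -
  have C: "C \<ge> 0" using bounded[of 0 0] by linarith
  define M where "M = 2 * L"
  have M: "M > 0" using \<open>L > 0\<close> by (simp add: M_def)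
  define rhs where "rhs h = (\<lambda>s. f s (\<alpha> + exp (M * \<bar>s\<bar>) * apply_bcontfun h s))" for h
  have contr: "continuous_on UNIV (rhs h)" for h
  proof -
    have "continuous_on UNIV ((\<lambda>(t, x). f t x) \<circ> (\<lambda>s. (s, \<alpha> + exp (M * \<bar>s\<bar>) * apply_bcontfun h s)))"
      by (intro continuous_on_compose continuous_intros continuous_on_subset[OF cont]) auto
    then show ?thesis by (simp add: rhs_def o_def)
  qed
  define I where "I h = (SOME F. F 0 = 0 \<and> (\<forall>t. (F has_real_derivative rhs h t) (at t)))" for h
  have I: "I h 0 = 0" "(I h has_real_derivative rhs h t) (at t)" for h t
  proof -
    have "\<exists>F. F 0 = 0 \<and> (\<forall>t. (F has_real_derivative rhs h t) (at t))"
      using antiderivative_exists[OF contr[of h]] by metis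
    from someI_ex[OF this] show "I h 0 = 0" "(I h has_real_derivative rhs h t) (at t)" by (auto simp: I_def)
  qed
  have exp1: "1 \<le> exp (M * \<bar>t\<bar>)" for t using M by simp
  have Ib: "\<bar>I h t\<bar> \<le> C / M * exp (M * \<bar>t\<bar>)" for h t
  proof (rule derivative_exp_bound[of "I h" "rhs h"])
    show "\<bar>rhs h t\<bar> \<le> C * exp (M * \<bar>t\<bar>)" for t
      using order_trans[OF bounded[of t] mult_left_mono[OF exp1[of t] C, simplified]] unfolding rhs_def by simp
  qed (use I M C in auto)
  define \<Phi> where "\<Phi> h = Bcontfun (\<lambda>t. exp (- M * \<bar>t\<bar>) * I h t)" for h
  have Icont: "continuous_on UNIV (I h)" for h
    by (rule differentiable_imp_continuous_on[OF I(2)])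
  have ap: "apply_bcontfun (\<Phi> h) t = exp (- M * \<bar>t\<bar>) * I h t" for h t
  proof -
    have "(\<lambda>t. exp (- M * \<bar>t\<bar>) * I h t) \<in> bcontfun"
    proof (rule bcontfun_normI)
      show "continuous_on UNIV (\<lambda>t. exp (- M * \<bar>t\<bar>) * I h t)"
        by (intro continuous_intros Icont)
      show "norm (exp (- M * \<bar>t\<bar>) * I h t) \<le> C / M" for t
        using Ib[of h t] M by (simp add: abs_mult exp_minus field_simps)
    qed
    then show ?thesis by (simp add: \<Phi>_def Bcontfun_inverse)
  qed
  have contraction: "dist (\<Phi> h) (\<Phi> g) \<le> 1/2 * dist h g" for h g
  proof (rule dist_bound)
    fix t
    let ?K = "L * dist h g"
    have "\<bar>I h t - I g t\<bar> \<le> ?K / M * exp (M * \<bar>t\<bar>)"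
    proof (rule derivative_exp_bound[of "\<lambda>t. I h t - I g t" "\<lambda>t. rhs h t - rhs g t"])
      fix s
      have "\<bar>rhs h s - rhs g s\<bar> \<le> L * (exp (M * \<bar>s\<bar>) * dist (apply_bcontfun h s) (apply_bcontfun g s))"
        unfolding rhs_def by (rule order_trans[OF lip])
          (simp add: dist_real_def abs_mult flip: right_diff_distrib)
      also have "\<dots> \<le> L * (exp (M * \<bar>s\<bar>) * dist h g)"
        using \<open>L > 0\<close> by (intro mult_left_mono dist_bounded) auto
      finally show "\<bar>rhs h s - rhs g s\<bar> \<le> ?K * exp (M * \<bar>s\<bar>)" by (simp add: mult_ac)
    qed (use I M \<open>L > 0\<close> in \<open>auto intro!: derivative_eq_intros\<close>)
    also have "?K / M = 1/2 * dist h g" using \<open>L > 0\<close> by (simp add: M_def)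
    finally have b: "\<bar>I h t - I g t\<bar> \<le> 1/2 * dist h g * exp (M * \<bar>t\<bar>)" .
    have "dist (apply_bcontfun (\<Phi> h) t) (apply_bcontfun (\<Phi> g) t) = exp (- M * \<bar>t\<bar>) * \<bar>I h t - I g t\<bar>"
      by (simp add: ap dist_real_def abs_mult flip: right_diff_distrib)
    also have "\<dots> \<le> exp (- M * \<bar>t\<bar>) * (1/2 * dist h g * exp (M * \<bar>t\<bar>))"
      by (intro mult_left_mono b) auto
    also have "\<dots> = 1/2 * dist h g" by (simp add: exp_minus)
    finally show "dist (apply_bcontfun (\<Phi> h) t) (apply_bcontfun (\<Phi> g) t) \<le> 1/2 * dist h g" .
  qed
  have "\<exists>!h. \<Phi> h = h" by (rule banach_fix_type[of "1/2"]) (use contraction in auto)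
  then obtain h where h: "\<Phi> h = h" by blast
  have e: "exp (M * \<bar>t\<bar>) * apply_bcontfun h t = I h t" for t
    using ap[of h t] unfolding h by (simp add: exp_minus field_simps)
  show thesis
  proof
    show "\<alpha> + I h 0 = \<alpha>" by (simp add: I)
    show "((\<lambda>t. \<alpha> + I h t) has_real_derivative f t (\<alpha> + I h t)) (at t)" for t
      using I(2)[of h t] by (auto intro!: derivative_eq_intros simp: rhs_def e)
  qed
qed

text \<open>The bound on both sides makes \<open>E exp(- C t)\<close> decrease and \<open>E exp(C t)\<close> increase, which controls \<open>E\<close>
in both time directions. It is used for uniqueness, where \<open>E\<close> vanishes at one point, as well as for
continuous dependence.\<close>

lemma gronwall_two_sided:
  fixes E :: "real \<Rightarrow> real"
  assumes E: "\<And>t. (E has_real_derivative E' t) (at t)" and b: "\<And>t. \<bar>E' t\<bar> \<le> C * E t"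
  shows "E t \<le> E s * exp (C * \<bar>t - s\<bar>)"
proof (cases "s \<le> t")
  case True
  have "E t * exp (- C * t) \<le> E s * exp (- C * s)"
  proof (rule DERIV_nonpos_imp_nonincreasing[OF True])
    fix x
    show "\<exists>y. ((\<lambda>t. E t * exp (- C * t)) has_real_derivative y) (at x) \<and> y \<le> 0"
      using b[of x] by (intro exI[of _ "(E' x - C * E x) * exp (- C * x)"])
        (auto intro!: derivative_eq_intros E simp: algebra_simps mult_le_0_iff)
  qed
  then show ?thesis using True by (simp add: exp_minus exp_diff field_simps right_diff_distrib)
next
  case False
  then have "t \<le> s" by simp
  have "E t * exp (C * t) \<le> E s * exp (C * s)"
  proof (rule DERIV_nonneg_imp_nondecreasing[OF \<open>t \<le> s\<close>])
    fix x
    show "\<exists>y. ((\<lambda>t. E t * exp (C * t)) has_real_derivative y) (at x) \<and> 0 \<le> y"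
    proof (intro exI[of _ "(E' x + C * E x) * exp (C * x)"] conjI)
      show "0 \<le> (E' x + C * E x) * exp (C * x)" using b[of x] by (intro mult_nonneg_nonneg) auto
    qed (auto intro!: derivative_eq_intros E simp: algebra_simps)
  qed
  then show ?thesis using False by (simp add: exp_minus exp_diff field_simps right_diff_distrib)
qed

text \<open>At the first return to the level \<open>c\<close> from above the derivative could not be positive.\<close>

lemma upcrossing_is_permanent:
  fixes \<theta> :: "real \<Rightarrow> real"
  assumes d: "\<And>t. (\<theta> has_real_derivative \<theta>' t) (at t)" and up: "\<And>t. \<theta> t = c \<Longrightarrow> \<theta>' t > 0"
    and "\<theta> s = c" "s < t"
  shows "\<theta> t > c"
proof (rule ccontr)
  assume "\<not> \<theta> t > c"
  then have tc: "\<theta> t \<le> c" by simp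
  have cont: "continuous_on A \<theta>" for A
    by (rule differentiable_imp_continuous_on[OF d])
  obtain e where e: "e > 0" "\<And>h. 0 < h \<Longrightarrow> h < e \<Longrightarrow> \<theta> s < \<theta> (s + h)"
    using DERIV_pos_inc_right[OF d up[OF \<open>\<theta> s = c\<close>]] by auto
  define h where "h = min (e/2) ((t - s) / 2)"
  have h: "0 < h" "h < e" "h < t - s" using e(1) \<open>s < t\<close> by (auto simp: h_def min_less_iff_disj)
  define u where "u = s + h"
  have u: "s < u" "u < t" "\<theta> u > c"
    using e(2)[OF h(1,2)] h \<open>\<theta> s = c\<close> by (auto simp: u_def)
  define S where "S = {w \<in> {u..t}. \<theta> w \<le> c}"
  have "compact S"
    unfolding S_def Collect_conj_eq Collect_mem_eq by (intro compact_Int_closed closed_Collect_le cont) auto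
  moreover have "t \<in> S" using u tc by (simp add: S_def)
  ultimately obtain w where w: "w \<in> S" "\<And>v. v \<in> S \<Longrightarrow> w \<le> v"
    using compact_attains_inf[of S] by blast
  have uw: "u < w" using w(1) u(3) by (cases "u = w") (auto simp: S_def)
  have "\<theta> w = c"
  proof (rule ccontr)
    assume "\<theta> w \<noteq> c"
    then have "\<theta> w < c" using w by (simp add: S_def)
    then obtain v where "u \<le> v" "v \<le> w" "\<theta> v = c"
      using IVT2'[of \<theta> w c u] uw u(3) cont by auto
    then have "v \<in> S" using w(1) by (simp add: S_def)
    then show False using w(2)[of v] \<open>v \<le> w\<close> \<open>\<theta> v = c\<close> \<open>\<theta> w < c\<close> by auto
  qed
  obtain e where e: "e > 0" "\<And>h. 0 < h \<Longrightarrow> h < e \<Longrightarrow> \<theta> (w - h) < \<theta> w"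
    using DERIV_pos_inc_left[OF d up[OF \<open>\<theta> w = c\<close>]] by auto
  define h where "h = min (e/2) ((w - u) / 2)"
  have "\<theta> (w - h) < \<theta> w" "w - h < w" "u \<le> w - h"
    using e(1) e(2)[of h] uw by (auto simp: h_def min_def field_simps)
  then have "w - h \<in> S" using \<open>\<theta> w = c\<close> w(1) by (simp add: S_def)
  then show False using w(2) \<open>w - h < w\<close> by fastforce
qed

text \<open>The angle is defined as the integral of the angular velocity that it must have. It is the right one
because the inner product of the normalized vector with \<open>(sin \<theta>, cos \<theta>)\<close> is then constant.\<close>

lemma differentiable_angle_exists:
  fixes x y x' y' :: "real \<Rightarrow> real"
  assumes dx: "\<And>t. (x has_real_derivative x' t) (at t)" and dy: "\<And>t. (y has_real_derivative y' t) (at t)"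
    and cx: "continuous_on UNIV x'" and cy: "continuous_on UNIV y'"
    and nz: "\<And>t. x t \<noteq> 0 \<or> y t \<noteq> 0"
  obtains \<theta> where
    "\<And>t. (\<theta> has_real_derivative (x' t * y t - y' t * x t) / ((x t)\<^sup>2 + (y t)\<^sup>2)) (at t)"
    "\<And>t. x t = sqrt ((x t)\<^sup>2 + (y t)\<^sup>2) * sin (\<theta> t)" "\<And>t. y t = sqrt ((x t)\<^sup>2 + (y t)\<^sup>2) * cos (\<theta> t)"
proof -
  define q where "q t = (x t)\<^sup>2 + (y t)\<^sup>2" for t
  have q: "q t > 0" for t using nz[of t] by (auto simp: q_def sum_power2_gt_zero_iff)
  have cxy: "continuous_on UNIV x" "continuous_on UNIV y"
    by (rule differentiable_imp_continuous_on[OF dx] differentiable_imp_continuous_on[OF dy])+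
  have "continuous_on UNIV (\<lambda>t. (x' t * y t - y' t * x t) / q t)"
    using q unfolding q_def by (intro continuous_intros cx cy cxy) (metis less_irrefl)
  then obtain \<theta>0 where \<theta>0: "\<theta>0 0 = 0" "\<And>t. (\<theta>0 has_real_derivative (x' t * y t - y' t * x t) / q t) (at t)"
    using antiderivative_exists by blast
  have "(y 0 / sqrt (q 0))\<^sup>2 + (x 0 / sqrt (q 0))\<^sup>2 = 1"
    using q[of 0] by (simp add: power_divide flip: add_divide_distrib) (simp add: q_def)
  then obtain \<alpha> where \<alpha>: "y 0 / sqrt (q 0) = cos \<alpha>" "x 0 / sqrt (q 0) = sin \<alpha>"
    using sincos_total_2pi by metis
  define \<theta> where "\<theta> t = \<alpha> + \<theta>0 t" for t
  have d\<theta>: "(\<theta> has_real_derivative (x' t * y t - y' t * x t) / q t) (at t)" for t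
    unfolding \<theta>_def using \<theta>0(2)[of t] by (auto intro!: derivative_eq_intros)
  have dq: "(q has_real_derivative 2 * (x t * x' t + y t * y' t)) (at t)" for t
    unfolding q_def by (auto intro!: derivative_eq_intros dx dy simp: algebra_simps)
  define C where "C t = (x t * sin (\<theta> t) + y t * cos (\<theta> t)) / sqrt (q t)" for t
  have dC: "(C has_real_derivative 0) (at t)" for t
  proof -
    define Q where "Q = q t"
    define \<omega> where "\<omega> = (x' t * y t - y' t * x t) / Q"
    define R where "R = sqrt Q"
    have Qp: "Q > 0" using q by (simp add: Q_def)
    have RR: "R * R = Q" "R > 0" using Qp by (auto simp: R_def)
    have dR: "((\<lambda>t. sqrt (q t)) has_real_derivative (x t * x' t + y t * y' t) / R) (at t)"
      using q[of t] unfolding R_def Q_def by (auto intro!: derivative_eq_intros dq simp: field_simps)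
    have e: "\<omega> * Q = x' t * y t - y' t * x t" using Qp by (simp add: \<omega>_def)
    have Qd: "Q = x t * x t + y t * y t" by (simp add: Q_def q_def power2_eq_square)
    let ?N = "x' t * sin (\<theta> t) + x t * (cos (\<theta> t) * \<omega>) + (y' t * cos (\<theta> t) - y t * (sin (\<theta> t) * \<omega>))"
    have "?N * Q - (x t * sin (\<theta> t) + y t * cos (\<theta> t)) * (x t * x' t + y t * y' t)
       = Q * (x' t * sin (\<theta> t) + y' t * cos (\<theta> t)) + (\<omega> * Q) * (x t * cos (\<theta> t) - y t * sin (\<theta> t))
          - (x t * sin (\<theta> t) + y t * cos (\<theta> t)) * (x t * x' t + y t * y' t)"
      by (simp add: algebra_simps)
    also have "\<dots> = 0" by (simp only: e) (simp add: Qd algebra_simps)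
    finally have N: "?N * Q = (x t * sin (\<theta> t) + y t * cos (\<theta> t)) * (x t * x' t + y t * y' t)" by simp
    have "(C has_real_derivative (?N * R - (x t * sin (\<theta> t) + y t * cos (\<theta> t)) * ((x t * x' t + y t * y' t) / R)) / (R * R)) (at t)"
    proof -
      have \<omega>: "(\<theta> has_real_derivative \<omega>) (at t)" using d\<theta>[of t] by (simp add: \<omega>_def Q_def)
      have "((\<lambda>t. x t * sin (\<theta> t) + y t * cos (\<theta> t)) has_real_derivative ?N) (at t)"
        by (rule derivative_eq_intros dx dy \<omega> refl)+ (simp add: algebra_simps)
      from DERIV_divide[OF this dR] show ?thesis using RR(2) by (simp add: C_def[abs_def] R_def Q_def)
    qed
    moreover have "?N * R - (x t * sin (\<theta> t) + y t * cos (\<theta> t)) * ((x t * x' t + y t * y' t) / R) = 0"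
      using N unfolding RR(1)[symmetric] using RR(2) by (simp add: field_simps)
    ultimately show ?thesis by simp
  qed
  have C1: "C t = 1" for t
  proof -
    have "C t = C 0" using dC by (intro DERIV_isconst_all) auto
    also have "C 0 = (x 0 / sqrt (q 0)) * sin \<alpha> + (y 0 / sqrt (q 0)) * cos \<alpha>"
      by (simp add: C_def \<theta>_def \<theta>0 add_divide_distrib)
    also have "\<dots> = 1" unfolding \<alpha> by (simp flip: power2_eq_square)
    finally show ?thesis .
  qed
  have C: "x t * sin (\<theta> t) + y t * cos (\<theta> t) = sqrt (q t)" for t
    using C1[of t] q[of t] by (simp add: C_def field_simps)
  have S: "x t * cos (\<theta> t) - y t * sin (\<theta> t) = 0" for t
  proof -
    have "(X * c - Y * s)\<^sup>2 + (X * s + Y * c)\<^sup>2 = (X\<^sup>2 + Y\<^sup>2) * (s\<^sup>2 + c\<^sup>2)" for X Y s c :: real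
      by algebra
    from this[of "x t" "cos (\<theta> t)" "y t" "sin (\<theta> t)"]
    have "(x t * cos (\<theta> t) - y t * sin (\<theta> t))\<^sup>2 + (x t * sin (\<theta> t) + y t * cos (\<theta> t))\<^sup>2 = q t"
      by (simp add: q_def)
    then show ?thesis unfolding C using q[of t] by simp
  qed
  have rot: "X = (X * s + Y * c) * s + (X * c - Y * s) * c" "Y = (X * s + Y * c) * c - (X * c - Y * s) * s"
    if "s\<^sup>2 + c\<^sup>2 = 1" for X Y s c :: real
    using that by algebra+
  show thesis
  proof
    show "(\<theta> has_real_derivative (x' t * y t - y' t * x t) / ((x t)\<^sup>2 + (y t)\<^sup>2)) (at t)" for t
      using d\<theta>[of t] by (simp add: q_def)
    show "x t = sqrt ((x t)\<^sup>2 + (y t)\<^sup>2) * sin (\<theta> t)" for t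
      using rot(1)[OF sin_cos_squared_add, of "x t" "\<theta> t" "y t"] unfolding S C q_def[symmetric] by simp
    show "y t = sqrt ((x t)\<^sup>2 + (y t)\<^sup>2) * cos (\<theta> t)" for t
      using rot(2)[OF sin_cos_squared_add, of "y t" "x t" "\<theta> t"] unfolding S C q_def[symmetric] by simp
  qed
qed

section \<open>Periodic Sturm-Liouville systems and their phase\<close>

lemma periodic_int_shift:
  fixes f :: "real \<Rightarrow> 'a"
  assumes "\<And>t. f (t + P) = f t"
  shows "f (t + of_int k * P) = f t"
proof -
  have nat: "f (t + of_nat i * P) = f t" for i :: nat and t
  proof (induction i)
    case (Suc i)
    then show ?case using assms[of "t + of_nat i * P"] by (simp add: algebra_simps)
  qed simp
  show ?thesis
  proof (cases "k \<ge> 0")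
    case True
    then show ?thesis using nat[of t "nat k"] by simp
  next
    case False
    then show ?thesis using nat[of "t + of_int k * P" "nat (- k)"] by (simp add: algebra_simps)
  qed
qed

lemma reduce_mod_period:
  fixes t P :: real
  assumes "P > 0"
  obtains k :: int where "t + of_int k * P \<in> {0..P}"
proof
  show "t + of_int (- \<lfloor>t / P\<rfloor>) * P \<in> {0..P}"
    using floor_divide_lower[OF assms, of t] floor_divide_upper[OF assms, of t] by (simp add: algebra_simps)
qed

lemma continuous_periodic_bounded:
  fixes f :: "real \<Rightarrow> real"
  assumes "continuous_on UNIV f" "\<And>t. f (t + P) = f t" "P > 0"
  obtains B where "B > 0" "\<And>t. \<bar>f t\<bar> \<le> B"
proof -
  have "bounded (f ` {0..P})"
    by (intro compact_imp_bounded compact_continuous_image continuous_on_subset[OF assms(1)]) auto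
  then obtain B where B: "B > 0" "\<And>t. t \<in> {0..P} \<Longrightarrow> \<bar>f t\<bar> \<le> B"
    by (auto simp: bounded_pos)
  have "\<bar>f t\<bar> \<le> B" for t
  proof -
    obtain k :: int where "t + of_int k * P \<in> {0..P}" using reduce_mod_period[OF assms(3)] .
    from B(2)[OF this] show ?thesis using periodic_int_shift[of f, OF assms(2)] by simp
  qed
  with B(1) show thesis using that by blast
qed

lemma abs_sin_squared_diff_le:
  fixes x y :: real
  shows "\<bar>(sin x)\<^sup>2 - (sin y)\<^sup>2\<bar> \<le> \<bar>x - y\<bar>"
proof -
  have "(sin x)\<^sup>2 - (sin y)\<^sup>2 = (sin x * cos y + cos x * sin y) * (sin x * cos y - cos x * sin y)"
  proof -
    have "a\<^sup>2 - b\<^sup>2 = (a * d + c * b) * (a * d - c * b)" if "a\<^sup>2 + c\<^sup>2 = 1" "b\<^sup>2 + d\<^sup>2 = 1" for a b c d :: real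
      using that by algebra
    then show ?thesis by simp
  qed
  then have "\<bar>(sin x)\<^sup>2 - (sin y)\<^sup>2\<bar> = \<bar>sin (x + y)\<bar> * \<bar>sin (x - y)\<bar>"
    by (simp add: sin_add sin_diff abs_mult)
  also have "\<dots> \<le> 1 * \<bar>x - y\<bar>"
    by (intro mult_mono abs_sin_x_le_abs_x abs_sin_le_one) auto
  finally show ?thesis by simp
qed

text \<open>The equation \<open>- (p u')' + V p u = \<kappa> p u\<close> with periodic coefficients, as the system
\<open>x' = y/p\<close>, \<open>y' = - (\<kappa> - V) p x\<close> for \<open>x = u\<close> and \<open>y = p u'\<close>.\<close>

locale sturm_liouville =
  fixes p V :: "real \<Rightarrow> real" and P :: real
  assumes p_cont: "continuous_on UNIV p" and V_cont: "continuous_on UNIV V"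
    and p_pos: "p t > 0" and P_pos: "P > 0"
    and p_periodic: "p (t + P) = p t" and V_periodic: "V (t + P) = V t"
begin

definition sol :: "real \<Rightarrow> (real \<Rightarrow> real) \<Rightarrow> (real \<Rightarrow> real) \<Rightarrow> bool" where
  "sol \<kappa> x y \<longleftrightarrow> (\<forall>t. (x has_real_derivative y t / p t) (at t) \<and>
     (y has_real_derivative - ((\<kappa> - V t) * p t) * x t) (at t))"

text \<open>The equation satisfied by \<open>\<theta>\<close> when \<open>(x, y) = R (sin \<theta>, cos \<theta>)\<close> solves the system; the
amplitude \<open>R\<close> has dropped out.\<close>

definition phase :: "real \<Rightarrow> (real \<Rightarrow> real) \<Rightarrow> bool" where
  "phase \<kappa> \<theta> \<longleftrightarrow> (\<forall>t. (\<theta> has_real_derivative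
     (cos (\<theta> t))\<^sup>2 / p t + (\<kappa> - V t) * p t * (sin (\<theta> t))\<^sup>2) (at t))"

lemma coefficients_bounded:
  obtains B where "B > 0" "\<And>t. p t \<le> B" "\<And>t. 1 / p t \<le> B" "\<And>t. \<bar>V t\<bar> \<le> B"
proof -
  obtain B1 where B1: "B1 > 0" "\<And>t. \<bar>p t\<bar> \<le> B1" using continuous_periodic_bounded[OF p_cont p_periodic P_pos] by blast
  obtain B2 where B2: "B2 > 0" "\<And>t. \<bar>1 / p t\<bar> \<le> B2"
    using continuous_periodic_bounded[of "\<lambda>t. 1 / p t" P] p_periodic P_pos p_pos
      continuous_on_divide[OF continuous_on_const p_cont, of 1] by (metis less_irrefl)
  obtain B3 where B3: "B3 > 0" "\<And>t. \<bar>V t\<bar> \<le> B3" using continuous_periodic_bounded[OF V_cont V_periodic P_pos] by blast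
  show thesis
  proof (rule that[of "B1 + B2 + B3"])
    fix t
    show "p t \<le> B1 + B2 + B3" "1 / p t \<le> B1 + B2 + B3" "\<bar>V t\<bar> \<le> B1 + B2 + B3"
      using B1(1) B2(1) B3(1) B1(2)[of t] B2(2)[of t] B3(2)[of t] by linarith+
  qed (use B1 B2 B3 in auto)
qed

lemma coefficient_difference_bounded:
  obtains M where "M > 0" "\<And>\<kappa> t. \<bar>\<kappa>\<bar> \<le> K \<Longrightarrow> \<bar>(\<kappa> - V t) * p t - 1 / p t\<bar> \<le> M" "\<And>t. p t \<le> M"
    "\<And>\<kappa> t. \<bar>\<kappa>\<bar> \<le> K \<Longrightarrow> \<bar>(\<kappa> - V t) * p t\<bar> \<le> M" "\<And>t. \<bar>1 / p t\<bar> \<le> M"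
proof -
  obtain B where B: "B > 0" "\<And>t. p t \<le> B" "\<And>t. 1 / p t \<le> B" "\<And>t. \<bar>V t\<bar> \<le> B"
    using coefficients_bounded by blast
  have 1: "\<bar>(\<kappa> - V t) * p t\<bar> \<le> (\<bar>K\<bar> + B) * B" if "\<bar>\<kappa>\<bar> \<le> K" for \<kappa> t
    unfolding abs_mult using B(2)[of t] B(4)[of t] that p_pos[of t] B(1)
    by (intro mult_mono) auto
  have 2: "\<bar>1 / p t\<bar> \<le> B" for t using B(3)[of t] p_pos[of t] by simp
  have 3: "0 \<le> (\<bar>K\<bar> + B) * B" using B(1) by simp
  show thesis
  proof (rule that[of "(\<bar>K\<bar> + B) * B + B"])
    fix \<kappa> t assume k: "\<bar>\<kappa>\<bar> \<le> K"
    show "\<bar>(\<kappa> - V t) * p t - 1 / p t\<bar> \<le> (\<bar>K\<bar> + B) * B + B" "\<bar>(\<kappa> - V t) * p t\<bar> \<le> (\<bar>K\<bar> + B) * B + B"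
      using 1[OF k, of t] 2[of t] B(1) by linarith+
  next
    fix t show "p t \<le> (\<bar>K\<bar> + B) * B + B" "\<bar>1 / p t\<bar> \<le> (\<bar>K\<bar> + B) * B + B"
      using B(2)[of t] 2[of t] 3 by linarith+
  qed (use B(1) 3 in linarith)
qed

lemma phase_exists:
  obtains \<theta> where "phase \<kappa> \<theta>" "\<theta> 0 = \<alpha>"
proof -
  obtain M where M: "M > 0" "\<And>t. \<bar>(\<kappa> - V t) * p t - 1 / p t\<bar> \<le> M"
     "\<And>t. \<bar>(\<kappa> - V t) * p t\<bar> \<le> M" "\<And>t. \<bar>1 / p t\<bar> \<le> M"
    using coefficient_difference_bounded[of "\<bar>\<kappa>\<bar>"] by (metis order_refl)
  define f where "f t x = (cos x)\<^sup>2 / p t + (\<kappa> - V t) * p t * (sin x)\<^sup>2" for t x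
  have "continuous_on UNIV (\<lambda>(t, x). f t x)"
  proof -
    have [continuous_intros]: "continuous_on UNIV (\<lambda>z::real \<times> real. p (fst z))" "continuous_on UNIV (\<lambda>z::real \<times> real. V (fst z))"
      by (auto intro!: continuous_on_compose2[OF p_cont] continuous_on_compose2[OF V_cont] continuous_intros)
    show ?thesis unfolding f_def case_prod_beta
      using p_pos by (intro continuous_intros) (auto simp: less_imp_neq[symmetric])
  qed
  moreover have "\<bar>f t x\<bar> \<le> M + M" for t x
  proof -
    have "\<bar>(cos x)\<^sup>2 / p t\<bar> = \<bar>1 / p t\<bar> * (cos x)\<^sup>2" by (simp add: abs_mult)
    also have "\<dots> \<le> M * 1" using M(1,4) abs_cos_le_one[of x] by (intro mult_mono) (auto simp: abs_square_le_1)
    finally have 1: "\<bar>(cos x)\<^sup>2 / p t\<bar> \<le> M" by simp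
    have "\<bar>(\<kappa> - V t) * p t * (sin x)\<^sup>2\<bar> = \<bar>(\<kappa> - V t) * p t\<bar> * (sin x)\<^sup>2" by (simp add: abs_mult)
    also have "\<dots> \<le> M * 1" using M(1,3) abs_sin_le_one[of x] by (intro mult_mono) (auto simp: abs_square_le_1)
    finally show ?thesis using 1 unfolding f_def by linarith
  qed
  moreover have "\<bar>f t x - f t y\<bar> \<le> M * \<bar>x - y\<bar>" for t x y
  proof -
    have "f t x - f t y = ((\<kappa> - V t) * p t - 1 / p t) * ((sin x)\<^sup>2 - (sin y)\<^sup>2)"
      unfolding f_def cos_squared_eq by (simp add: algebra_simps diff_divide_distrib)
    then show ?thesis
      using M(1,2) by (auto simp: abs_mult intro!: mult_mono abs_sin_squared_diff_le)
  qed
  ultimately obtain \<theta> where "\<theta> 0 = \<alpha>" "\<And>t. (\<theta> has_real_derivative f t (\<theta> t)) (at t)"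
    using lipschitz_ode_global_solution[of f] M(1) by metis
  then show thesis using that[of \<theta>] by (simp add: phase_def f_def)
qed

text \<open>Gronwall's inequality for \<open>E = (\<theta> - \<theta>')\<^sup>2 + (\<kappa> - \<kappa>')\<^sup>2\<close>: the constant term absorbs
the effect of the different parameters, so that one estimate gives uniqueness and joint continuity in
the initial value and the parameter.\<close>

lemma phase_dependence:
  obtains C where "\<And>\<kappa> \<kappa>' \<theta> \<theta>' s t. \<bar>\<kappa>\<bar> \<le> K \<Longrightarrow> phase \<kappa> \<theta> \<Longrightarrow> phase \<kappa>' \<theta>' \<Longrightarrow>
    (\<theta> t - \<theta>' t)\<^sup>2 + (\<kappa> - \<kappa>')\<^sup>2 \<le> ((\<theta> s - \<theta>' s)\<^sup>2 + (\<kappa> - \<kappa>')\<^sup>2) * exp (C * \<bar>t - s\<bar>)"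
proof -
  obtain M where M: "M > 0" "\<And>\<kappa> t. \<bar>\<kappa>\<bar> \<le> K \<Longrightarrow> \<bar>(\<kappa> - V t) * p t - 1 / p t\<bar> \<le> M" "\<And>t. p t \<le> M"
    using coefficient_difference_bounded[of K] by metis
  show thesis
  proof (rule that[of "3 * M"])
    fix \<kappa> \<kappa>' \<theta> \<theta>' s t assume k: "\<bar>\<kappa>\<bar> \<le> K" and th: "phase \<kappa> \<theta>" "phase \<kappa>' \<theta>'"
    let ?\<delta> = "\<kappa> - \<kappa>'"
    let ?D = "\<lambda>t. \<theta> t - \<theta>' t"
    let ?D' = "\<lambda>t. ((\<kappa> - V t) * p t - 1 / p t) * ((sin (\<theta> t))\<^sup>2 - (sin (\<theta>' t))\<^sup>2) + ?\<delta> * p t * (sin (\<theta>' t))\<^sup>2"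
    show "(?D t)\<^sup>2 + ?\<delta>\<^sup>2 \<le> ((?D s)\<^sup>2 + ?\<delta>\<^sup>2) * exp (3 * M * \<bar>t - s\<bar>)"
    proof (rule gronwall_two_sided)
      fix t
      have "(?D has_real_derivative ?D' t) (at t)"
        by (rule DERIV_cong[OF DERIV_diff[OF th[unfolded phase_def, rule_format]]])
          (simp add: cos_squared_eq algebra_simps diff_divide_distrib)
      then show "((\<lambda>t. (?D t)\<^sup>2 + ?\<delta>\<^sup>2) has_real_derivative 2 * ?D t * ?D' t) (at t)"
        by (intro DERIV_cong[OF DERIV_add[OF DERIV_power[where n = 2] DERIV_const]]) auto
      have "\<bar>((\<kappa> - V t) * p t - 1 / p t) * ((sin (\<theta> t))\<^sup>2 - (sin (\<theta>' t))\<^sup>2)\<bar> \<le> M * \<bar>?D t\<bar>"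
        using M(1) M(2)[OF k, of t] unfolding abs_mult by (intro mult_mono abs_sin_squared_diff_le) auto
      moreover have "\<bar>?\<delta> * p t * (sin (\<theta>' t))\<^sup>2\<bar> \<le> M * \<bar>?\<delta>\<bar>"
      proof -
        have "\<bar>?\<delta> * p t * (sin (\<theta>' t))\<^sup>2\<bar> = \<bar>?\<delta>\<bar> * (p t * (sin (\<theta>' t))\<^sup>2)"
          using p_pos[of t] by (simp add: abs_mult)
        also have "\<dots> \<le> \<bar>?\<delta>\<bar> * (M * 1)"
          using p_pos[of t] M(1) M(3)[of t] abs_sin_le_one[of "\<theta>' t"]
          by (intro mult_left_mono mult_mono) (auto simp: abs_square_le_1)
        finally show ?thesis by (simp add: mult.commute)
      qed
      ultimately have "\<bar>?D' t\<bar> \<le> M * \<bar>?D t\<bar> + M * \<bar>?\<delta>\<bar>" by linarith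
      then have "\<bar>2 * ?D t * ?D' t\<bar> \<le> 2 * \<bar>?D t\<bar> * (M * \<bar>?D t\<bar> + M * \<bar>?\<delta>\<bar>)"
        unfolding abs_mult by (intro mult_mono) auto
      also have "\<dots> = M * (2 * \<bar>?D t\<bar>\<^sup>2 + 2 * \<bar>?D t\<bar> * \<bar>?\<delta>\<bar>)"
        by (simp add: algebra_simps power2_eq_square)
      also have "\<dots> \<le> M * (3 * (\<bar>?D t\<bar>\<^sup>2 + \<bar>?\<delta>\<bar>\<^sup>2))"
      proof (rule mult_left_mono)
        have "2 * a\<^sup>2 + 2 * a * b \<le> 3 * (a\<^sup>2 + b\<^sup>2)" for a b :: real
          using sum_squares_bound[of a b] zero_le_power2[of b] by (simp only: distrib_left)
        then show "2 * \<bar>?D t\<bar>\<^sup>2 + 2 * \<bar>?D t\<bar> * \<bar>?\<delta>\<bar> \<le> 3 * (\<bar>?D t\<bar>\<^sup>2 + \<bar>?\<delta>\<bar>\<^sup>2)" .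
      qed (use M in simp)
      also have "\<dots> = 3 * M * ((?D t)\<^sup>2 + ?\<delta>\<^sup>2)" by (simp only: power2_abs mult.assoc mult.left_commute)
      finally show "\<bar>2 * ?D t * ?D' t\<bar> \<le> 3 * M * ((?D t)\<^sup>2 + ?\<delta>\<^sup>2)" .
    qed
  qed
qed

lemma phase_unique:
  assumes "phase \<kappa> \<theta>" "phase \<kappa> \<theta>'" "\<theta> s = \<theta>' s"
  shows "\<theta> t = \<theta>' t"
proof -
  obtain C where "\<And>\<kappa>' \<theta> \<theta>' s t. phase \<kappa> \<theta> \<Longrightarrow> phase \<kappa>' \<theta>' \<Longrightarrow>
    (\<theta> t - \<theta>' t)\<^sup>2 + (\<kappa> - \<kappa>')\<^sup>2 \<le> ((\<theta> s - \<theta>' s)\<^sup>2 + (\<kappa> - \<kappa>')\<^sup>2) * exp (C * \<bar>t - s\<bar>)"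
    using phase_dependence[of "\<bar>\<kappa>\<bar>"] by (metis order_refl)
  from this[OF assms(1,2), of t s] show ?thesis using assms(3) by simp
qed

lemma phase_pi_shift: "phase \<kappa> \<theta> \<Longrightarrow> phase \<kappa> (\<lambda>t. \<theta> t + of_int k * pi)"
proof -
  have "(cos (x + of_int k * pi))\<^sup>2 = (cos x)\<^sup>2" "(sin (x + of_int k * pi))\<^sup>2 = (sin x)\<^sup>2" for x
    using periodic_int_shift[of "\<lambda>x::real. (cos x)\<^sup>2" pi x k] periodic_int_shift[of "\<lambda>x::real. (sin x)\<^sup>2" pi x k] by auto
  then show "phase \<kappa> \<theta> \<Longrightarrow> phase \<kappa> (\<lambda>t. \<theta> t + of_int k * pi)"
    unfolding phase_def by (auto intro!: derivative_eq_intros)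
qed

lemma phase_period_shift: "phase \<kappa> \<theta> \<Longrightarrow> phase \<kappa> (\<lambda>t. \<theta> (t + P))"
  unfolding phase_def
proof (rule allI)
  fix t assume th: "\<forall>t. (\<theta> has_real_derivative (cos (\<theta> t))\<^sup>2 / p t + (\<kappa> - V t) * p t * (sin (\<theta> t))\<^sup>2) (at t)"
  show "((\<lambda>t. \<theta> (t + P)) has_real_derivative (cos (\<theta> (t + P)))\<^sup>2 / p t + (\<kappa> - V t) * p t * (sin (\<theta> (t + P)))\<^sup>2) (at t)"
    using th[rule_format, of "t + P"] unfolding p_periodic V_periodic by (simp add: DERIV_shift)
qed

text \<open>Where the sine vanishes, the phase equation reduces to \<open>\<theta>' = 1/p > 0\<close>. So the multiples of \<open>pi\<close>
are crossed only upwards.\<close>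

lemma phase_gains:
  assumes "phase \<kappa> \<theta>" "sin (\<theta> s) = 0" "s < t"
  shows "\<theta> t > \<theta> s"
proof (rule upcrossing_is_permanent[OF assms(1)[unfolded phase_def, rule_format] _ refl assms(3)])
  fix u assume "\<theta> u = \<theta> s"
  then have s: "sin (\<theta> u) = 0" using assms(2) by simp
  then have "(cos (\<theta> u))\<^sup>2 = 1" by (simp add: cos_squared_eq)
  with s show "0 < (cos (\<theta> u))\<^sup>2 / p u + (\<kappa> - V u) * p u * (sin (\<theta> u))\<^sup>2" using p_pos[of u] by simp
qed

definition angle :: "real \<Rightarrow> real \<Rightarrow> real \<Rightarrow> real" where
  "angle \<kappa> \<alpha> = (SOME \<theta>. phase \<kappa> \<theta> \<and> \<theta> 0 = \<alpha>)"

lemma angle: "phase \<kappa> (angle \<kappa> \<alpha>)" "angle \<kappa> \<alpha> 0 = \<alpha>"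
proof -
  have "\<exists>\<theta>. phase \<kappa> \<theta> \<and> \<theta> 0 = \<alpha>" using phase_exists by metis
  from someI_ex[OF this] show "phase \<kappa> (angle \<kappa> \<alpha>)" "angle \<kappa> \<alpha> 0 = \<alpha>" by (auto simp: angle_def)
qed

lemma angle_eqI: "phase \<kappa> \<theta> \<Longrightarrow> \<theta> t = angle \<kappa> (\<theta> 0) t"
  using phase_unique[of \<kappa> \<theta> "angle \<kappa> (\<theta> 0)" 0 t] angle by simp

text \<open>The period map on phases. Periodic solutions correspond to phases that \<open>F \<kappa>\<close> moves by a multiple of
\<open>2 pi\<close> and whose amplitude returns to its initial value.\<close>

definition F :: "real \<Rightarrow> real \<Rightarrow> real" where "F \<kappa> \<alpha> = angle \<kappa> \<alpha> P"

lemma F_pi: "F \<kappa> (\<alpha> + of_int k * pi) = F \<kappa> \<alpha> + of_int k * pi"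
  using angle_eqI[OF phase_pi_shift[OF angle(1)[of \<kappa> \<alpha>], of k], of P] by (simp add: F_def angle)

lemma F_strict_mono: "\<alpha> < \<beta> \<Longrightarrow> F \<kappa> \<alpha> < F \<kappa> \<beta>"
proof (rule ccontr)
  assume ab: "\<alpha> < \<beta>" and "\<not> F \<kappa> \<alpha> < F \<kappa> \<beta>"
  then have le: "angle \<kappa> \<beta> P - angle \<kappa> \<alpha> P \<le> 0" by (simp add: F_def)
  have c: "continuous_on A (angle \<kappa> x)" for A x
    by (rule differentiable_imp_continuous_on[OF angle(1)[unfolded phase_def, rule_format]])
  have "\<exists>s\<ge>0. s \<le> P \<and> angle \<kappa> \<beta> s - angle \<kappa> \<alpha> s = 0"
    using le ab P_pos by (intro IVT2') (auto simp: angle intro!: continuous_intros c)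
  then obtain s where "angle \<kappa> \<beta> s = angle \<kappa> \<alpha> s" by auto
  from phase_unique[OF angle(1) angle(1) this, of 0] ab show False by (simp add: angle)
qed

text \<open>Since \<open>F \<kappa>\<close> commutes with the shift by \<open>pi\<close>, one may assume \<open>\<alpha> \<le> \<beta> \<le> \<alpha> + pi\<close>;
then monotonicity gives \<open>F \<kappa> \<beta> \<le> F \<kappa> \<alpha> + pi\<close>, and one of the inequalities is strict.\<close>

lemma F_oscillation: "F \<kappa> \<beta> - \<beta> < F \<kappa> \<alpha> - \<alpha> + pi"
proof -
  obtain k :: int where k: "(\<beta> - \<alpha>) + of_int k * pi \<in> {0..pi}"
    using reduce_mod_period[OF pi_gt_zero] by blast
  define \<gamma> where "\<gamma> = \<beta> + of_int k * pi"
  have e: "F \<kappa> \<gamma> - \<gamma> = F \<kappa> \<beta> - \<beta>" by (simp add: \<gamma>_def F_pi)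
  have g: "\<alpha> \<le> \<gamma>" "\<gamma> \<le> \<alpha> + pi" using k by (auto simp: \<gamma>_def)
  have ap: "F \<kappa> (\<alpha> + pi) = F \<kappa> \<alpha> + pi" using F_pi[of \<kappa> \<alpha> 1] by simp
  show ?thesis
  proof (cases "\<gamma> = \<alpha> \<or> \<gamma> = \<alpha> + pi")
    case True
    then show ?thesis using e ap by auto
  next
    case False
    then have "F \<kappa> \<gamma> < F \<kappa> (\<alpha> + pi)" using g F_strict_mono by auto
    then show ?thesis using e ap g False by auto
  qed
qed

lemma F_reduce:
  obtains \<beta> where "\<beta> \<in> {0..pi}" "F \<kappa>' \<beta> - \<beta> = F \<kappa>' \<alpha> - \<alpha>"
proof -
  obtain k :: int where k: "\<alpha> + of_int k * pi \<in> {0..pi}"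
    using reduce_mod_period[OF pi_gt_zero] by blast
  show thesis by (rule that[OF k]) (simp add: F_pi)
qed

lemma F_continuous: "continuous_on UNIV (\<lambda>(\<kappa>, \<alpha>). F \<kappa> \<alpha>)"
proof (rule continuous_at_imp_continuous_on, intro ballI, clarify)
  fix \<kappa>0 \<alpha>0 :: real
  obtain C where C: "\<And>\<kappa> \<kappa>' \<theta> \<theta>' s t. \<bar>\<kappa>\<bar> \<le> \<bar>\<kappa>0\<bar> + 1 \<Longrightarrow> phase \<kappa> \<theta> \<Longrightarrow> phase \<kappa>' \<theta>' \<Longrightarrow>
    (\<theta> t - \<theta>' t)\<^sup>2 + (\<kappa> - \<kappa>')\<^sup>2 \<le> ((\<theta> s - \<theta>' s)\<^sup>2 + (\<kappa> - \<kappa>')\<^sup>2) * exp (C * \<bar>t - s\<bar>)"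
    using phase_dependence[of "\<bar>\<kappa>0\<bar> + 1"] by metis
  let ?b = "\<lambda>(\<kappa>, \<alpha>). sqrt (((\<alpha> - \<alpha>0)\<^sup>2 + (\<kappa> - \<kappa>0)\<^sup>2) * exp (C * \<bar>P\<bar>))"
  have b: "\<bar>F \<kappa> \<alpha> - F \<kappa>0 \<alpha>0\<bar> \<le> ?b (\<kappa>, \<alpha>)" if "\<bar>\<kappa>\<bar> \<le> \<bar>\<kappa>0\<bar> + 1" for \<kappa> \<alpha>
  proof -
    have "(F \<kappa> \<alpha> - F \<kappa>0 \<alpha>0)\<^sup>2 \<le> (F \<kappa> \<alpha> - F \<kappa>0 \<alpha>0)\<^sup>2 + (\<kappa> - \<kappa>0)\<^sup>2" by simp
    also have "\<dots> \<le> ((\<alpha> - \<alpha>0)\<^sup>2 + (\<kappa> - \<kappa>0)\<^sup>2) * exp (C * \<bar>P\<bar>)"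
      using C[OF that angle(1)[of \<kappa> \<alpha>] angle(1)[of \<kappa>0 \<alpha>0], of P 0] by (simp add: angle F_def)
    finally show ?thesis by (simp add: real_le_rsqrt)
  qed
  have ev: "\<forall>\<^sub>F z in at (\<kappa>0, \<alpha>0). norm ((\<lambda>(\<kappa>, \<alpha>). F \<kappa> \<alpha>) z - F \<kappa>0 \<alpha>0) \<le> ?b z"
  proof -
    have "\<forall>\<^sub>F z in at (\<kappa>0, \<alpha>0). dist z (\<kappa>0, \<alpha>0) < 1"
      by (rule eventually_at_ball'[of 1, unfolded ball_def, simplified, THEN eventually_mono]) (auto simp: dist_commute)
    then show ?thesis
    proof eventually_elim
      case (elim z)
      then have "dist (fst z) \<kappa>0 < 1" using dist_fst_le[of z "(\<kappa>0, \<alpha>0)"] by simp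
      then have "\<bar>fst z\<bar> \<le> \<bar>\<kappa>0\<bar> + 1" by (simp add: dist_real_def)
      then show ?case using b[of "fst z" "snd z"] by (cases z) simp
    qed
  qed
  have "(?b \<longlongrightarrow> sqrt (((\<alpha>0 - \<alpha>0)\<^sup>2 + (\<kappa>0 - \<kappa>0)\<^sup>2) * exp (C * \<bar>P\<bar>))) (at (\<kappa>0, \<alpha>0))"
    unfolding case_prod_beta by (intro tendsto_intros tendsto_fst[of _ "(\<kappa>0, \<alpha>0)", simplified] tendsto_snd[of _ "(\<kappa>0, \<alpha>0)", simplified])
  then have "(?b \<longlongrightarrow> 0) (at (\<kappa>0, \<alpha>0))" by simp
  from Lim_null_comparison[OF ev this] show "isCont (\<lambda>(\<kappa>, \<alpha>). F \<kappa> \<alpha>) (\<kappa>0, \<alpha>0)"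
    by (simp add: isCont_def LIM_zero_iff split_def)
qed

lemma F_continuous_in_parameter: "continuous_on UNIV (\<lambda>\<kappa>. F \<kappa> \<alpha>)"
proof -
  have "continuous_on UNIV (\<lambda>\<kappa>. (\<kappa>, \<alpha>))" by (intro continuous_intros)
  from continuous_on_compose2[OF F_continuous this] show ?thesis by simp
qed

lemma sol_unique:
  assumes s: "sol \<kappa> x y" and "x s = 0" "y s = 0"
  shows "x t = 0" "y t = 0"
proof -
  obtain M where M: "M > 0" "\<And>t. \<bar>(\<kappa> - V t) * p t - 1 / p t\<bar> \<le> M"
    using coefficient_difference_bounded[of "\<bar>\<kappa>\<bar>"] by (metis order_refl)
  have "(x t)\<^sup>2 + (y t)\<^sup>2 \<le> ((x s)\<^sup>2 + (y s)\<^sup>2) * exp (M * \<bar>t - s\<bar>)"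
  proof (rule gronwall_two_sided)
    fix t
    let ?e = "(\<kappa> - V t) * p t - 1 / p t"
    show "((\<lambda>t. (x t)\<^sup>2 + (y t)\<^sup>2) has_real_derivative - (2 * x t * y t) * ?e) (at t)"
      using s[unfolded sol_def, rule_format, of t] by (auto intro!: derivative_eq_intros simp: algebra_simps)
    have "\<bar>- (2 * x t * y t) * ?e\<bar> \<le> ((x t)\<^sup>2 + (y t)\<^sup>2) * M"
      unfolding abs_mult[of "- (2 * x t * y t)"]
      using M(2) sum_squares_bound[of "\<bar>x t\<bar>" "\<bar>y t\<bar>"] by (intro mult_mono) (auto simp: abs_mult)
    then show "\<bar>- (2 * x t * y t) * ?e\<bar> \<le> M * ((x t)\<^sup>2 + (y t)\<^sup>2)" by (simp add: mult.commute)
  qed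
  then have "(x t)\<^sup>2 + (y t)\<^sup>2 \<le> 0" using assms by simp
  then show "x t = 0" "y t = 0" by (simp_all add: sum_power2_le_zero_iff)
qed

lemma sol_combination:
  assumes "sol \<kappa> x y" "sol \<kappa> x' y'"
  shows "sol \<kappa> (\<lambda>t. c * x t + d * x' t) (\<lambda>t. c * y t + d * y' t)"
  unfolding sol_def
proof (intro allI conjI)
  fix t
  show "((\<lambda>t. c * x t + d * x' t) has_real_derivative (c * y t + d * y' t) / p t) (at t)"
    using assms[unfolded sol_def, rule_format, of t] by (auto intro!: derivative_eq_intros simp: add_divide_distrib mult.commute)
  show "((\<lambda>t. c * y t + d * y' t) has_real_derivative - ((\<kappa> - V t) * p t) * (c * x t + d * x' t)) (at t)"
    using assms[unfolded sol_def, rule_format, of t] by (auto intro!: derivative_eq_intros simp: algebra_simps)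
qed

lemma sol_eq:
  assumes "sol \<kappa> x y" "sol \<kappa> x' y'" "x s = x' s" "y s = y' s"
  shows "x t = x' t" "y t = y' t"
  using sol_unique[OF sol_combination[OF assms(1,2), of 1 "-1"], of s t] assms(3,4) by auto

lemma sol_period_shift: "sol \<kappa> x y \<Longrightarrow> sol \<kappa> (\<lambda>t. x (t + P)) (\<lambda>t. y (t + P))"
  unfolding sol_def
proof (intro allI)
  fix t assume th: "\<forall>t. (x has_real_derivative y t / p t) (at t) \<and>
     (y has_real_derivative - ((\<kappa> - V t) * p t) * x t) (at t)"
  show "((\<lambda>t. x (t + P)) has_real_derivative y (t + P) / p t) (at t) \<and>
     ((\<lambda>t. y (t + P)) has_real_derivative - ((\<kappa> - V t) * p t) * x (t + P)) (at t)"
    using th[rule_format, of "t + P"] unfolding p_periodic V_periodic by (simp add: DERIV_shift)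
qed

lemma wronskian_constant:
  assumes "sol \<kappa> x y" "sol \<kappa> x' y'"
  shows "x t * y' t - y t * x' t = x s * y' s - y s * x' s"
proof -
  have "((\<lambda>t. x t * y' t - y t * x' t) has_real_derivative 0) (at t)" for t
    using assms[unfolded sol_def, rule_format, of t] by (auto intro!: derivative_eq_intros simp: algebra_simps)
  then show ?thesis by (intro DERIV_isconst_all) auto
qed

text \<open>Conversely, a phase determines a solution: the amplitude satisfies a linear homogeneous equation, so
it is the exponential of an integral.\<close>

lemma phase_amplitude:
  assumes "phase \<kappa> \<theta>"
  obtains R where "\<And>t. R t > 0" "R 0 = 1" "sol \<kappa> (\<lambda>t. R t * sin (\<theta> t)) (\<lambda>t. R t * cos (\<theta> t))"
proof -
  let ?g = "\<lambda>t. sin (\<theta> t) * cos (\<theta> t) * (1 / p t - (\<kappa> - V t) * p t)"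
  have c: "continuous_on UNIV \<theta>"
    by (rule differentiable_imp_continuous_on[OF assms(1)[unfolded phase_def, rule_format]])
  have "continuous_on UNIV ?g"
    using p_pos by (intro continuous_intros c p_cont V_cont) (auto simp: less_imp_neq[symmetric])
  then obtain G where G: "G 0 = 0" "\<And>t. (G has_real_derivative ?g t) (at t)"
    using antiderivative_exists by blast
  have th: "(\<theta> has_real_derivative (cos (\<theta> t))\<^sup>2 / p t + (\<kappa> - V t) * p t * (sin (\<theta> t))\<^sup>2) (at t)" for t
    using assms(1) by (simp add: phase_def)
  have id: "s * c * (q - b) * s + (c * (c\<^sup>2 * q + b * s\<^sup>2)) = c * q"
     "s * c * (q - b) * c - s * (c\<^sup>2 * q + b * s\<^sup>2) = - b * s" if "s\<^sup>2 + c\<^sup>2 = 1" for s c q b :: real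
    using that by algebra+
  show thesis
  proof (rule that[of "\<lambda>t. exp (G t)"])
    show "sol \<kappa> (\<lambda>t. exp (G t) * sin (\<theta> t)) (\<lambda>t. exp (G t) * cos (\<theta> t))"
      unfolding sol_def
    proof (intro allI conjI)
      fix t
      let ?s = "sin (\<theta> t)" and ?c = "cos (\<theta> t)" and ?q = "1 / p t" and ?b = "(\<kappa> - V t) * p t"
      have e: "(exp \<circ> G has_real_derivative exp (G t) * ?g t) (at t)" for t
        by (rule DERIV_chain[OF DERIV_exp G(2)])
      have "((\<lambda>t. exp (G t) * sin (\<theta> t)) has_real_derivative
          exp (G t) * (?s * ?c * (?q - ?b) * ?s + (?c * (?c\<^sup>2 * ?q + ?b * ?s\<^sup>2)))) (at t)"
        by (rule derivative_eq_intros refl G th)+ (simp add: algebra_simps)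
      then show "((\<lambda>t. exp (G t) * sin (\<theta> t)) has_real_derivative exp (G t) * cos (\<theta> t) / p t) (at t)"
        unfolding id(1)[OF sin_cos_squared_add] by simp
      have "((\<lambda>t. exp (G t) * cos (\<theta> t)) has_real_derivative
          exp (G t) * (?s * ?c * (?q - ?b) * ?c - ?s * (?c\<^sup>2 * ?q + ?b * ?s\<^sup>2))) (at t)"
        by (rule derivative_eq_intros refl G th)+ (simp add: algebra_simps)
      then show "((\<lambda>t. exp (G t) * cos (\<theta> t)) has_real_derivative - ((\<kappa> - V t) * p t) * (exp (G t) * sin (\<theta> t))) (at t)"
        unfolding id(2)[OF sin_cos_squared_add] by (simp add: mult_ac)
    qed
  qed (auto simp: G)
qed

end

section \<open>Counting periodic eigenvalues by turning\<close>

lemma bounded_affine_is_constant: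
  fixes q d :: real
  assumes "(\<forall>p. p * q + d \<le> 0) \<or> (\<forall>p. p * q + d \<ge> 0)"
  shows "q = 0"
proof (rule ccontr)
  assume "q \<noteq> 0"
  then have "(1 - d) / q * q + d = 1" "(- 1 - d) / q * q + d = - 1" by simp_all
  with assms show False by (metis not_one_le_zero neg_0_le_iff_le)
qed

context sturm_liouville
begin

text \<open>Since \<open>F \<kappa>\<close> moves \<open>\<alpha>\<close> by a multiple of \<open>2 pi\<close>, the solution \<open>X\<close> with initial phase
\<open>\<alpha>\<close> is multiplied by some \<open>\<rho> > 0\<close> after one period. Let \<open>W\<close> be the solution with initial phase
\<open>\<alpha> + pi/2\<close>. The cross product of the initial vector of \<open>p X + W\<close> with its vector after one
period is affine in \<open>p\<close> with slope \<open>1/\<rho> - \<rho>\<close>, because the Wronskian is constant. Up to a positive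
factor, it is the sine of the displacement minus \<open>2 pi j\<close>, which has one sign if the displacement is
extremal at \<open>\<alpha>\<close>. An affine function of one sign is constant, hence \<open>\<rho> = 1\<close>.\<close>

lemma extremal_angle_periodic_solution:
  assumes start: "F \<kappa> \<alpha> = \<alpha> + 2 * pi * of_int j"
    and ext: "(\<forall>\<beta>. F \<kappa> \<beta> \<le> \<beta> + 2 * pi * of_int j) \<or> (\<forall>\<beta>. F \<kappa> \<beta> \<ge> \<beta> + 2 * pi * of_int j)"
  obtains X Y where "sol \<kappa> X Y" "X 0 = sin \<alpha>" "Y 0 = cos \<alpha>" "\<And>t. X (t + P) = X t"
proof -
  have turn: "sin (x + 2 * pi * of_int j) = sin x" "cos (x + 2 * pi * of_int j) = cos x" for x :: real
    using periodic_int_shift[of "sin :: real \<Rightarrow> real", OF sin_periodic, of x j]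
      periodic_int_shift[of "cos :: real \<Rightarrow> real", OF cos_periodic, of x j]
    by (simp_all add: mult.commute)
  obtain R where R: "\<And>t. R t > 0" "R 0 = 1"
    and X0: "sol \<kappa> (\<lambda>t. R t * sin (angle \<kappa> \<alpha> t)) (\<lambda>t. R t * cos (angle \<kappa> \<alpha> t))"
    using phase_amplitude[OF angle(1)] by blast
  define X where "X t = R t * sin (angle \<kappa> \<alpha> t)" for t
  define Y where "Y t = R t * cos (angle \<kappa> \<alpha> t)" for t
  have X: "sol \<kappa> X Y" using X0 unfolding X_def[abs_def] Y_def[abs_def] .
  obtain R' where R': "R' 0 = 1"
    and W0: "sol \<kappa> (\<lambda>t. R' t * sin (angle \<kappa> (\<alpha> + pi/2) t)) (\<lambda>t. R' t * cos (angle \<kappa> (\<alpha> + pi/2) t))"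
    using phase_amplitude[OF angle(1)] by blast
  define W where "W t = R' t * sin (angle \<kappa> (\<alpha> + pi/2) t)" for t
  define W' where "W' t = R' t * cos (angle \<kappa> (\<alpha> + pi/2) t)" for t
  have W: "sol \<kappa> W W'" using W0 unfolding W_def[abs_def] W'_def[abs_def] .
  define s c where "s = sin \<alpha>" and "c = cos \<alpha>"
  have sc: "s\<^sup>2 + c\<^sup>2 = 1" by (simp add: s_def c_def)
  have init: "X 0 = s" "Y 0 = c" "W 0 = c" "W' 0 = - s"
    by (simp_all add: X_def Y_def W_def W'_def R R' angle s_def c_def sin_add cos_add)
  define \<rho> where "\<rho> = R P"
  have \<rho>: "\<rho> > 0" using R by (simp add: \<rho>_def)
  have final: "X P = \<rho> * s" "Y P = \<rho> * c"
    using start by (simp_all add: X_def Y_def F_def \<rho>_def s_def c_def turn)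
  have wr: "\<rho> * (W P * c - W' P * s) = 1"
    using wronskian_constant[OF X W, of P 0] sc unfolding init final
    by (simp add: algebra_simps power2_eq_square)
  have sign: "(\<forall>p. p * (1 / \<rho> - \<rho>) + (- W P * s - W' P * c) \<le> 0) \<or>
     (\<forall>p. p * (1 / \<rho> - \<rho>) + (- W P * s - W' P * c) \<ge> 0)"
  proof -
    \<comment> \<open>\<open>\<beta>\<close> is the initial phase of \<open>p X + W\<close>, and \<open>K\<close> the product of its initial and final amplitudes\<close>
    have key: "\<exists>\<beta> K. K > 0 \<and> p * (1 / \<rho> - \<rho>) + (- W P * s - W' P * c) = K * sin (F \<kappa> \<beta> - \<beta> - 2 * pi * of_int j)" for p
    proof -
      define k where "k = sqrt (p\<^sup>2 + 1)"
      have k: "k > 0" "k\<^sup>2 = p\<^sup>2 + 1" by (simp_all add: k_def add_nonneg_pos)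
      have "(p * c - s)\<^sup>2 + (p * s + c)\<^sup>2 = k\<^sup>2" using sc k(2) by algebra
      then have "((p * c - s) / k)\<^sup>2 + ((p * s + c) / k)\<^sup>2 = 1"
        using k(1) by (simp add: power_divide flip: add_divide_distrib)
      then obtain \<beta> where \<beta>: "(p * c - s) / k = cos \<beta>" "(p * s + c) / k = sin \<beta>"
        using sincos_total_2pi by metis
      obtain Q where Q: "\<And>t. Q t > 0" "Q 0 = 1"
        and Qs: "sol \<kappa> (\<lambda>t. Q t * sin (angle \<kappa> \<beta> t)) (\<lambda>t. Q t * cos (angle \<kappa> \<beta> t))"
        using phase_amplitude[OF angle(1)] by blast
      have Z: "p * X P + 1 * W P = k * (Q P * sin (F \<kappa> \<beta>)) + 0 * (Q P * sin (F \<kappa> \<beta>))"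
           "p * Y P + 1 * W' P = k * (Q P * cos (F \<kappa> \<beta>)) + 0 * (Q P * cos (F \<kappa> \<beta>))"
        using sol_eq[OF sol_combination[OF X W, of p 1] sol_combination[OF Qs Qs, of k 0], of 0 P] \<beta> k(1)
        by (simp_all add: F_def angle Q init field_simps)
      have i: "p * c - s = k * cos \<beta>" "p * s + c = k * sin \<beta>" using \<beta> k(1) by (simp_all add: field_simps)
      have "p * (1 / \<rho> - \<rho>) + (- W P * s - W' P * c)
         = (p * X P + W P) * (p * c - s) - (p * Y P + W' P) * (p * s + c)"
      proof -
        have "1 / \<rho> = W P * c - W' P * s" using wr \<rho> by (simp add: field_simps)
        then show ?thesis unfolding final using sc by algebra
      qed
      also have "\<dots> = (k\<^sup>2 * Q P) * (sin (F \<kappa> \<beta>) * cos \<beta> - cos (F \<kappa> \<beta>) * sin \<beta>)"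
        using Z unfolding i by (simp add: algebra_simps power2_eq_square)
      also have "sin (F \<kappa> \<beta>) * cos \<beta> - cos (F \<kappa> \<beta>) * sin \<beta> = sin (F \<kappa> \<beta> - \<beta> - 2 * pi * of_int j)"
        using turn(1)[of "F \<kappa> \<beta> - \<beta> - 2 * pi * of_int j"] by (simp add: sin_diff)
      finally show ?thesis using k(1) Q(1)[of P] by (intro exI[of _ \<beta>] exI[of _ "k\<^sup>2 * Q P"]) auto
    qed
    from ext show ?thesis
    proof
      assume le: "\<forall>\<beta>. F \<kappa> \<beta> \<le> \<beta> + 2 * pi * of_int j"
      have "sin (F \<kappa> \<beta> - \<beta> - 2 * pi * of_int j) \<le> 0" for \<beta>
      proof -
        have "0 \<le> sin (- (F \<kappa> \<beta> - \<beta> - 2 * pi * of_int j))"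
          using le[rule_format, of \<beta>] F_oscillation[of \<kappa> \<alpha> \<beta>] start by (intro sin_ge_zero) linarith+
        then show ?thesis unfolding sin_minus by linarith
      qed
      then show ?thesis using key by (metis mult_le_0_iff less_imp_le)
    next
      assume ge: "\<forall>\<beta>. F \<kappa> \<beta> \<ge> \<beta> + 2 * pi * of_int j"
      have "sin (F \<kappa> \<beta> - \<beta> - 2 * pi * of_int j) \<ge> 0" for \<beta>
        using ge[rule_format, of \<beta>] F_oscillation[of \<kappa> \<beta> \<alpha>] start by (intro sin_ge_zero) linarith+
      then show ?thesis using key by (metis mult_nonneg_nonneg less_imp_le)
    qed
  qed
  have "\<rho> = 1"
  proof -
    have "1 / \<rho> - \<rho> = 0" by (rule bounded_affine_is_constant[OF sign])
    then have "\<rho>\<^sup>2 = 1" using \<rho> by (simp add: field_simps power2_eq_square)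
    then show ?thesis using \<rho> by (simp add: power2_eq_1_iff)
  qed
  then have "X (t + P) = X t" for t
    using sol_eq(1)[OF sol_period_shift[OF X] X, of 0 t] final init by simp
  then show thesis using that X init unfolding s_def c_def by blast
qed

definition eigenfunction :: "real \<Rightarrow> (real \<Rightarrow> real) \<Rightarrow> bool" where
  "eigenfunction \<kappa> u \<longleftrightarrow> (\<exists>y. sol \<kappa> u y) \<and> (\<forall>t. u (t + P) = u t)"

definition independent_eigenfunctions :: "real \<Rightarrow> nat \<Rightarrow> (nat \<Rightarrow> real \<Rightarrow> real) \<Rightarrow> bool" where
  "independent_eigenfunctions \<kappa> k U \<longleftrightarrow> (\<forall>i<k. eigenfunction \<kappa> (U i)) \<and>
     (\<forall>c. (\<forall>t. (\<Sum>i<k. c i * U i t) = 0) \<longrightarrow> (\<forall>i<k. c i = 0))"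

lemma sol_not_zero:
  assumes "sol \<kappa> x y" "x s \<noteq> 0 \<or> y s \<noteq> 0"
  obtains t where "x t \<noteq> 0"
proof (rule ccontr)
  assume "\<not> thesis"
  then have z: "x = (\<lambda>_. 0)" using that by blast
  have "(x has_real_derivative y s / p s) (at s)" using assms(1) by (simp add: sol_def)
  then have "y s / p s = 0" using DERIV_unique[of x "y s / p s" s 0] unfolding z by simp
  then show False using assms(2) p_pos[of s] z by auto
qed

lemma extremal_angle_eigenvalue:
  assumes "F \<kappa> \<alpha> = \<alpha> + 2 * pi * of_int j"
    and "(\<forall>\<beta>. F \<kappa> \<beta> \<le> \<beta> + 2 * pi * of_int j) \<or> (\<forall>\<beta>. F \<kappa> \<beta> \<ge> \<beta> + 2 * pi * of_int j)"
  shows "\<exists>U. independent_eigenfunctions \<kappa> 1 U"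
proof -
  obtain X Y where X: "sol \<kappa> X Y" "X 0 = sin \<alpha>" "Y 0 = cos \<alpha>" "\<And>t. X (t + P) = X t"
    using extremal_angle_periodic_solution[OF assms] by blast
  have "X 0 \<noteq> 0 \<or> Y 0 \<noteq> 0"
    unfolding X by (metis sin_cos_squared_add add.right_neutral power_zero_numeral zero_neq_one)
  then obtain t where "X t \<noteq> 0" using sol_not_zero[OF X(1)] by blast
  then show ?thesis
    using X by (intro exI[of _ "\<lambda>_. X"]) (auto simp: independent_eigenfunctions_def eigenfunction_def)
qed

text \<open>Every initial phase is extremal, so the solutions with initial phases \<open>0\<close> and \<open>pi/2\<close> are periodic.\<close>

lemma constant_turning_double_eigenvalue:
  assumes "\<And>\<beta>. F \<kappa> \<beta> = \<beta> + 2 * pi * of_int j"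
  shows "\<exists>U. independent_eigenfunctions \<kappa> 2 U"
proof -
  obtain X Y where X: "sol \<kappa> X Y" "X 0 = sin 0" "Y 0 = cos 0" "\<And>t. X (t + P) = X t"
    using extremal_angle_periodic_solution[OF assms, of 0] assms by auto
  obtain W W' where W: "sol \<kappa> W W'" "W 0 = sin (pi/2)" "W' 0 = cos (pi/2)" "\<And>t. W (t + P) = W t"
    using extremal_angle_periodic_solution[OF assms, of "pi/2"] assms by (metis order_refl)
  obtain t where t: "X t \<noteq> 0" using sol_not_zero[OF X(1), of 0] X by auto
  define U where "U = (\<lambda>i::nat. if i = 0 then X else W)"
  have "independent_eigenfunctions \<kappa> 2 U"
    unfolding independent_eigenfunctions_def
  proof (intro conjI allI impI)
    fix i show "eigenfunction \<kappa> (U i)" using X W by (auto simp: U_def eigenfunction_def)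
  next
    fix c and i :: nat assume c: "\<forall>t. (\<Sum>i<2. c i * U i t) = 0" and i: "i < 2"
    have s: "c 0 * X t + c 1 * W t = 0" for t
      using c[rule_format, of t] by (simp add: U_def eval_nat_numeral)
    have "c 1 = 0" using s[of 0] X(2) W(2) by simp
    moreover have "c 0 = 0" using s[of t] t calculation by simp
    ultimately show "c i = 0" using i by (auto simp: less_2_cases_iff)
  qed
  then show ?thesis by blast
qed

text \<open>For \<open>\<kappa> < inf V\<close> the phase equation at \<open>\<theta> = pi/2\<close> has a negative right-hand side, so \<open>pi/2\<close>
is crossed only downwards. By the bound on the oscillation, no phase then gains as much as \<open>pi\<close>.\<close>

lemma no_turning_below:
  obtains \<kappa>0 where "\<kappa>0 < 0" "F \<kappa>0 (pi/2) < pi/2"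
proof -
  obtain B where B: "B > 0" "\<And>t. \<bar>V t\<bar> \<le> B" using coefficients_bounded by metis
  define \<kappa>0 where "\<kappa>0 = - B - 1"
  let ?\<theta> = "angle \<kappa>0 (pi/2)"
  have d: "((\<lambda>t. - ?\<theta> t) has_real_derivative - ((cos (?\<theta> t))\<^sup>2 / p t + (\<kappa>0 - V t) * p t * (sin (?\<theta> t))\<^sup>2)) (at t)" for t
    using angle(1)[of \<kappa>0 "pi/2"] unfolding phase_def by (intro DERIV_minus) blast
  have "- ?\<theta> P > - (pi/2)"
  proof (rule upcrossing_is_permanent[OF d])
    fix t assume "- ?\<theta> t = - (pi/2)"
    then have "?\<theta> t = pi/2" by simp
    then have "sin (?\<theta> t) = 1" "cos (?\<theta> t) = 0" by (simp_all only: sin_pi_half cos_pi_half)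
    moreover have "(\<kappa>0 - V t) * p t < 0"
      using B(2)[of t] p_pos[of t] by (intro mult_neg_pos) (auto simp: \<kappa>0_def)
    ultimately show "0 < - ((cos (?\<theta> t))\<^sup>2 / p t + (\<kappa>0 - V t) * p t * (sin (?\<theta> t))\<^sup>2)" by simp
  qed (use P_pos in \<open>auto simp: angle\<close>)
  then show thesis using that[of \<kappa>0] B(1) by (simp add: F_def \<kappa>0_def)
qed

text \<open>Take the largest \<open>\<kappa>\<close> in \<open>[\<kappa>0, 0]\<close> for which some displacement is at most \<open>w\<close>; it exists because the
phases can be restricted to the compact interval \<open>[0, pi]\<close>. Just above it all displacements
exceed \<open>w\<close>, so at this \<open>\<kappa>\<close> the minimum is \<open>w\<close>.\<close>

lemma last_eigenvalue_with_turning: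
  assumes \<kappa>0: "\<kappa>0 < 0" and lo: "F \<kappa>0 \<alpha> \<le> \<alpha> + w" and hi: "\<And>\<beta>. F 0 \<beta> > \<beta> + w"
  obtains \<kappa> \<beta> where "\<kappa> < 0" "F \<kappa> \<beta> = \<beta> + w" "\<And>\<beta>. F \<kappa> \<beta> \<ge> \<beta> + w"
proof -
  define S where "S = ({\<kappa>0..0} \<times> {0..pi}) \<inter> {z. F (fst z) (snd z) - snd z \<le> w}"
  have Fc: "continuous_on UNIV (\<lambda>z. F (fst z) (snd z))"
    using F_continuous by (simp add: split_def)
  have "compact S" unfolding S_def
    by (intro compact_Int_closed compact_Times compact_Icc closed_Collect_le continuous_intros Fc)
  obtain \<alpha>' where a': "\<alpha>' \<in> {0..pi}" "F \<kappa>0 \<alpha>' - \<alpha>' = F \<kappa>0 \<alpha> - \<alpha>" using F_reduce by blast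
  then have "(\<kappa>0, \<alpha>') \<in> S" using \<kappa>0 lo by (auto simp: S_def)
  then have "S \<noteq> {}" by blast
  have "\<exists>z\<in>S. \<forall>z'\<in>S. fst z' \<le> fst z"
    by (rule continuous_attains_sup[OF \<open>compact S\<close> \<open>S \<noteq> {}\<close>]) (intro continuous_intros)
  then obtain z where z: "z \<in> S" "\<And>z'. z' \<in> S \<Longrightarrow> fst z' \<le> fst z" by blast
  define \<kappa> \<beta> where "\<kappa> = fst z" and "\<beta> = snd z"
  have zb: "\<kappa>0 \<le> \<kappa>" "\<kappa> \<le> 0" "F \<kappa> \<beta> \<le> \<beta> + w" using z(1) by (auto simp: S_def \<kappa>_def \<beta>_def)
  have k: "\<kappa> < 0" using zb hi[of \<beta>] by (cases "\<kappa> = 0") auto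
  have above: "F \<kappa>' \<gamma> > \<gamma> + w" if "\<kappa> < \<kappa>'" "\<kappa>' \<le> 0" for \<kappa>' \<gamma>
  proof (rule ccontr)
    assume n: "\<not> ?thesis"
    obtain \<gamma>' where g': "\<gamma>' \<in> {0..pi}" "F \<kappa>' \<gamma>' - \<gamma>' = F \<kappa>' \<gamma> - \<gamma>" using F_reduce by blast
    then have "(\<kappa>', \<gamma>') \<in> S" using that zb n by (auto simp: S_def)
    from z(2)[OF this] that(1) show False by (simp add: \<kappa>_def)
  qed
  have ge: "F \<kappa> \<gamma> \<ge> \<gamma> + w" for \<gamma>
  proof (rule tendsto_lowerbound[of "\<lambda>\<kappa>'. F \<kappa>' \<gamma>" _ "at_right \<kappa>"])
    show "((\<lambda>\<kappa>'. F \<kappa>' \<gamma>) \<longlongrightarrow> F \<kappa> \<gamma>) (at_right \<kappa>)"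
      using F_continuous_in_parameter[of \<gamma>] by (auto simp: continuous_on_def intro: tendsto_within_subset)
    show "\<forall>\<^sub>F \<kappa>' in at_right \<kappa>. \<gamma> + w \<le> F \<kappa>' \<gamma>"
      unfolding eventually_at_right[OF k] using k above by (intro exI[of _ 0]) (auto intro: less_imp_le)
  qed simp
  have "F \<kappa> \<beta> = \<beta> + w" using zb(3) ge[of \<beta>] by simp
  from that[OF k this ge] show thesis .
qed

text \<open>The mirror image: the smallest \<open>\<kappa>\<close> for which some displacement is at least \<open>w\<close>. There the maximum is
\<open>w\<close>.\<close>

lemma first_eigenvalue_with_turning:
  assumes \<kappa>0: "\<kappa>0 < 0" and lo: "\<And>\<beta>. F \<kappa>0 \<beta> \<le> \<beta> + w" and hi: "\<And>\<beta>. F 0 \<beta> > \<beta> + w"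
  obtains \<kappa> \<beta> where "\<kappa> < 0" "F \<kappa> \<beta> = \<beta> + w" "\<And>\<beta>. F \<kappa> \<beta> \<le> \<beta> + w"
proof -
  define S where "S = ({\<kappa>0..0} \<times> {0..pi}) \<inter> {z. w \<le> F (fst z) (snd z) - snd z}"
  have Fc: "continuous_on UNIV (\<lambda>z. F (fst z) (snd z))"
    using F_continuous by (simp add: split_def)
  have "compact S" unfolding S_def
    by (intro compact_Int_closed compact_Times compact_Icc closed_Collect_le continuous_intros Fc)
  have "(0, 0) \<in> S" using \<kappa>0 hi[of 0] by (auto simp: S_def)
  then have "S \<noteq> {}" by blast
  have "\<exists>z\<in>S. \<forall>z'\<in>S. fst z \<le> fst z'"
    by (rule continuous_attains_inf[OF \<open>compact S\<close> \<open>S \<noteq> {}\<close>]) (intro continuous_intros)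
  then obtain z where z: "z \<in> S" "\<And>z'. z' \<in> S \<Longrightarrow> fst z \<le> fst z'" by blast
  define \<kappa> \<beta> where "\<kappa> = fst z" and "\<beta> = snd z"
  have zb: "\<kappa>0 \<le> \<kappa>" "\<kappa> \<le> 0" "\<beta> + w \<le> F \<kappa> \<beta>" using z(1) by (auto simp: S_def \<kappa>_def \<beta>_def)
  have below: "F \<kappa>' \<gamma> \<le> \<gamma> + w" if "\<kappa>' < \<kappa>" "\<kappa>0 \<le> \<kappa>'" for \<kappa>' \<gamma>
  proof (rule ccontr)
    assume n: "\<not> ?thesis"
    obtain \<gamma>' where g': "\<gamma>' \<in> {0..pi}" "F \<kappa>' \<gamma>' - \<gamma>' = F \<kappa>' \<gamma> - \<gamma>" using F_reduce by blast
    then have "(\<kappa>', \<gamma>') \<in> S" using that zb n by (auto simp: S_def)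
    from z(2)[OF this] that(1) show False by (simp add: \<kappa>_def)
  qed
  have le: "F \<kappa> \<gamma> \<le> \<gamma> + w" for \<gamma>
  proof (cases "\<kappa>0 = \<kappa>")
    case True
    then show ?thesis using lo by simp
  next
    case False
    then have lt: "\<kappa>0 < \<kappa>" using zb by simp
    show ?thesis
    proof (rule tendsto_upperbound[of "\<lambda>\<kappa>'. F \<kappa>' \<gamma>" _ "at_left \<kappa>"])
      show "((\<lambda>\<kappa>'. F \<kappa>' \<gamma>) \<longlongrightarrow> F \<kappa> \<gamma>) (at_left \<kappa>)"
        using F_continuous_in_parameter[of \<gamma>] by (auto simp: continuous_on_def intro: tendsto_within_subset)
      show "\<forall>\<^sub>F \<kappa>' in at_left \<kappa>. F \<kappa>' \<gamma> \<le> \<gamma> + w"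
        unfolding eventually_at_left[OF lt] using lt below by (intro exI[of _ \<kappa>0]) auto
    qed simp
  qed
  have k: "\<kappa> < 0" using zb le[of 0] hi[of 0] by (cases "\<kappa> = 0") auto
  have "F \<kappa> \<beta> = \<beta> + w" using zb(3) le[of \<beta>] by simp
  from that[OF k this le] show thesis .
qed

text \<open>For each \<open>j < N\<close> the eigenvalues with displacement \<open>2 pi j\<close> form a group: the parameter at which the
minimum of the displacement is \<open>2 pi j\<close> and, for \<open>j > 0\<close>, the one at which the maximum is. A group
counts twice for \<open>j > 0\<close> even if the two coincide. For \<open>j = 0\<close> the maximum need not reach \<open>2 pi j\<close>,
which is why the total is \<open>2 N - 1\<close>.\<close>

theorem negative_eigenvalues_from_turning:
  assumes turn: "F 0 \<alpha>0 \<ge> \<alpha>0 + 2 * pi * real N"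
  obtains K d where "finite K" "K \<subseteq> {..<0}" "2 * N - 1 \<le> (\<Sum>\<kappa>\<in>K. d \<kappa>)"
    "\<And>\<kappa>. \<kappa> \<in> K \<Longrightarrow> d \<kappa> \<ge> 1" "\<And>\<kappa>. \<kappa> \<in> K \<Longrightarrow> \<exists>U. independent_eigenfunctions \<kappa> (d \<kappa>) U"
proof -
  obtain \<kappa>0 where \<kappa>0: "\<kappa>0 < 0" "F \<kappa>0 (pi/2) < pi/2" by (rule no_turning_below)
  have lo: "F \<kappa>0 \<beta> < \<beta> + pi" for \<beta> using F_oscillation[of \<kappa>0 \<beta> "pi/2"] \<kappa>0(2) by simp
  have hi: "F 0 \<beta> > \<beta> + 2 * pi * real j" if "j < N" for \<beta> j
  proof -
    have "2 * pi * (real j + 1) \<le> 2 * pi * real N" using that by (intro mult_left_mono) auto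
    then show ?thesis using F_oscillation[of 0 \<alpha>0 \<beta>] turn pi_gt_zero by (simp only: distrib_left)
  qed
  define d where "d \<kappa> = (if \<exists>U. independent_eigenfunctions \<kappa> 2 U then 2 else 1 :: nat)" for \<kappa>
  define win where "win j K \<longleftrightarrow> finite K \<and> K \<subseteq> {..<0} \<and> (\<forall>\<kappa>\<in>K. (\<exists>\<beta>. F \<kappa> \<beta> = \<beta> + 2 * pi * real j) \<and>
     (\<exists>U. independent_eigenfunctions \<kappa> 1 U)) \<and> (if j = 0 then 1 else 2) \<le> (\<Sum>\<kappa>\<in>K. d \<kappa>)" for j K
  have "\<exists>K. win j K" if j: "j < N" for j
  proof -
    have lo_last: "F \<kappa>0 (pi/2) \<le> pi/2 + 2 * pi * real j" using \<kappa>0(2) by (smt (verit) pi_gt_zero zero_le_mult_iff of_nat_0_le_iff)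
    obtain \<kappa>b \<beta>b where b: "\<kappa>b < 0" "F \<kappa>b \<beta>b = \<beta>b + 2 * pi * real j" "\<And>\<beta>. F \<kappa>b \<beta> \<ge> \<beta> + 2 * pi * real j"
      using last_eigenvalue_with_turning[OF \<kappa>0(1) lo_last hi[OF j]] by blast
    have eb: "\<exists>U. independent_eigenfunctions \<kappa>b 1 U"
      by (rule extremal_angle_eigenvalue[of \<kappa>b \<beta>b "int j"]) (use b in auto)
    show ?thesis
    proof (cases "j = 0")
      case True
      then show ?thesis using b eb by (intro exI[of _ "{\<kappa>b}"]) (auto simp: win_def d_def)
    next
      case False
      have "pi \<le> 2 * pi * real j"
      proof -
        have "2 * pi * 1 \<le> 2 * pi * real j" using False by (intro mult_left_mono) auto
        then show ?thesis using pi_gt_zero by simp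
      qed
      then have lo_first: "F \<kappa>0 \<beta> \<le> \<beta> + 2 * pi * real j" for \<beta> using lo[of \<beta>] by linarith
      obtain \<kappa>a \<beta>a where a: "\<kappa>a < 0" "F \<kappa>a \<beta>a = \<beta>a + 2 * pi * real j" "\<And>\<beta>. F \<kappa>a \<beta> \<le> \<beta> + 2 * pi * real j"
        using first_eigenvalue_with_turning[OF \<kappa>0(1) lo_first hi[OF j]] by blast
      have ea: "\<exists>U. independent_eigenfunctions \<kappa>a 1 U"
        by (rule extremal_angle_eigenvalue[of \<kappa>a \<beta>a "int j"]) (use a in auto)
      have "2 \<le> (\<Sum>\<kappa>\<in>{\<kappa>a, \<kappa>b}. d \<kappa>)"
      proof (cases "\<kappa>a = \<kappa>b")
        case True
        then have "F \<kappa>a \<beta> = \<beta> + 2 * pi * of_int (int j)" for \<beta> using a(3)[of \<beta>] b(3)[of \<beta>] by simp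
        from constant_turning_double_eigenvalue[OF this] show ?thesis using True by (simp add: d_def)
      next
        case False
        then show ?thesis by (simp add: d_def)
      qed
      then show ?thesis using a b ea eb False by (intro exI[of _ "{\<kappa>a, \<kappa>b}"]) (auto simp: win_def)
    qed
  qed
  then obtain Kf where Kf: "\<And>j. j < N \<Longrightarrow> win j (Kf j)" by metis
  have disj: "Kf i \<inter> Kf j = {}" if ij: "i < N" "j < N" "i \<noteq> j" for i j
  proof (rule ccontr)
    have *: False if "i < j" "F \<kappa> \<beta> = \<beta> + 2 * pi * real i" "F \<kappa> \<gamma> = \<gamma> + 2 * pi * real j" for \<kappa> \<beta> \<gamma> and i j :: nat
    proof -
      have "2 * pi * (real i + 1) \<le> 2 * pi * real j" using that(1) by (intro mult_left_mono) auto
      then show False using F_oscillation[of \<kappa> \<gamma> \<beta>] that pi_gt_zero by (simp only: distrib_left)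
    qed
    assume "\<not> ?thesis"
    then obtain \<kappa> where "\<kappa> \<in> Kf i" "\<kappa> \<in> Kf j" by auto
    then obtain \<beta> \<gamma> where "F \<kappa> \<beta> = \<beta> + 2 * pi * real i" "F \<kappa> \<gamma> = \<gamma> + 2 * pi * real j"
      using Kf[OF ij(1)] Kf[OF ij(2)] unfolding win_def by blast
    then show False using *[of i j \<kappa> \<beta> \<gamma>] *[of j i \<kappa> \<gamma> \<beta>] ij(3) by linarith
  qed
  define K where "K = (\<Union>j\<in>{..<N}. Kf j)"
  have sum: "2 * N - 1 \<le> (\<Sum>\<kappa>\<in>K. d \<kappa>)"
  proof -
    have "(\<Sum>\<kappa>\<in>K. d \<kappa>) = (\<Sum>j<N. \<Sum>\<kappa>\<in>Kf j. d \<kappa>)"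
      unfolding K_def using Kf disj by (intro sum.UNION_disjoint) (auto simp: win_def)
    also have "\<dots> \<ge> (\<Sum>j<N. if j = 0 then 1 else 2)"
      using Kf by (intro sum_mono) (auto simp: win_def)
    moreover have "(\<Sum>j<N. if j = 0 then 1 else 2) = 2 * N - (1::nat)"
      by (induction N) auto
    ultimately show ?thesis by simp
  qed
  show thesis
  proof (rule that[of K d])
    show "finite K" "K \<subseteq> {..<0}" using Kf by (auto simp: K_def win_def)
    show "d \<kappa> \<ge> 1" for \<kappa> by (simp add: d_def)
    show "\<exists>U. independent_eigenfunctions \<kappa> (d \<kappa>) U" if "\<kappa> \<in> K" for \<kappa>
      using that Kf by (auto simp: K_def win_def d_def)
  qed (rule sum)
qed

lemma sol_phase:
  assumes s: "sol \<kappa> x y" and nz: "\<And>t. x t \<noteq> 0 \<or> y t \<noteq> 0"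
  obtains \<theta> where "phase \<kappa> \<theta>" "\<And>t. x t = sqrt ((x t)\<^sup>2 + (y t)\<^sup>2) * sin (\<theta> t)"
    "\<And>t. y t = sqrt ((x t)\<^sup>2 + (y t)\<^sup>2) * cos (\<theta> t)"
proof -
  have dx: "(x has_real_derivative y t / p t) (at t)"
    and dy: "(y has_real_derivative - ((\<kappa> - V t) * p t) * x t) (at t)" for t
    using s by (auto simp: sol_def)
  have cx: "continuous_on UNIV (\<lambda>t. y t / p t)"
    using p_pos by (intro continuous_intros p_cont differentiable_imp_continuous_on[OF dy]) (auto simp: less_imp_neq[symmetric])
  have cy: "continuous_on UNIV (\<lambda>t. - ((\<kappa> - V t) * p t) * x t)"
    by (intro continuous_intros p_cont V_cont differentiable_imp_continuous_on[OF dx])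
  obtain \<theta> where \<theta>: "\<And>t. (\<theta> has_real_derivative (y t / p t * y t - - ((\<kappa> - V t) * p t) * x t * x t) / ((x t)\<^sup>2 + (y t)\<^sup>2)) (at t)"
    "\<And>t. x t = sqrt ((x t)\<^sup>2 + (y t)\<^sup>2) * sin (\<theta> t)" "\<And>t. y t = sqrt ((x t)\<^sup>2 + (y t)\<^sup>2) * cos (\<theta> t)"
    using differentiable_angle_exists[OF dx dy cx cy nz] by blast
  have "phase \<kappa> \<theta>"
    unfolding phase_def
  proof
    fix t
    define q where "q = (x t)\<^sup>2 + (y t)\<^sup>2"
    have q: "q > 0" using nz[of t] by (auto simp: q_def sum_power2_gt_zero_iff)
    have sq: "(x t)\<^sup>2 = q * (sin (\<theta> t))\<^sup>2" "(y t)\<^sup>2 = q * (cos (\<theta> t))\<^sup>2"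
      using \<theta>(2,3)[of t] q unfolding q_def[symmetric] by (metis power_mult_distrib real_sqrt_pow2 less_imp_le)+
    have "(y t / p t * y t - - ((\<kappa> - V t) * p t) * x t * x t) / q = ((y t)\<^sup>2 / p t + (\<kappa> - V t) * p t * (x t)\<^sup>2) / q"
      by (simp add: power2_eq_square)
    also have "\<dots> = (cos (\<theta> t))\<^sup>2 / p t + (\<kappa> - V t) * p t * (sin (\<theta> t))\<^sup>2"
      unfolding sq using q by (simp add: add_divide_distrib)
    finally show "(\<theta> has_real_derivative (cos (\<theta> t))\<^sup>2 / p t + (\<kappa> - V t) * p t * (sin (\<theta> t))\<^sup>2) (at t)"
      using \<theta>(1)[of t] unfolding q_def by simp
  qed
  then show thesis using that \<theta>(2,3) by blast
qed

text \<open>A periodic solution returns to the same point of the plane, so its phase gains a multiple of \<open>2 pi\<close>;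
the gain is the same from every starting time by uniqueness.\<close>

lemma periodic_sol_turning:
  assumes s: "sol \<kappa> x y" and nz: "\<And>t. x t \<noteq> 0 \<or> y t \<noteq> 0"
    and per: "\<And>t. x (t + P) = x t" "\<And>t. y (t + P) = y t"
  obtains \<theta> and j :: int where "phase \<kappa> \<theta>" "\<And>t. x t = 0 \<Longrightarrow> sin (\<theta> t) = 0" "\<And>t. \<theta> (t + P) = \<theta> t + 2 * pi * of_int j"
proof -
  obtain \<theta> where \<theta>: "phase \<kappa> \<theta>" "\<And>t. x t = sqrt ((x t)\<^sup>2 + (y t)\<^sup>2) * sin (\<theta> t)"
    "\<And>t. y t = sqrt ((x t)\<^sup>2 + (y t)\<^sup>2) * cos (\<theta> t)"
    using sol_phase[OF s nz] by blast
  have q: "sqrt ((x t)\<^sup>2 + (y t)\<^sup>2) > 0" for t using nz[of t] by (auto simp: sum_power2_gt_zero_iff)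
  have "sin (\<theta> (0 + P)) = sin (\<theta> 0)" "cos (\<theta> (0 + P)) = cos (\<theta> 0)"
    using \<theta>(2,3)[of "0 + P"] \<theta>(2,3)[of 0] q[of 0] unfolding per by (metis mult_left_cancel less_irrefl)+
  then obtain j :: int where j: "\<theta> (0 + P) = \<theta> 0 + 2 * pi * of_int j" using sin_cos_eq_iff by metis
  have "phase \<kappa> (\<lambda>t. \<theta> t + 2 * pi * of_int j)"
    using phase_pi_shift[OF \<theta>(1), of "2 * j"] by (simp add: mult_ac)
  from phase_unique[OF phase_period_shift[OF \<theta>(1)] this, of 0]
  have "\<theta> (t + P) = \<theta> t + 2 * pi * of_int j" for t using j by simp
  moreover have "sin (\<theta> t) = 0" if "x t = 0" for t using \<theta>(2)[of t] that q[of t] by (metis mult_eq_0_iff less_irrefl)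
  ultimately show thesis using that \<theta>(1) by blast
qed

text \<open>Used with \<open>\<psi>\<close> the argument of a curve whose real part is the solution. Whenever \<open>\<psi>\<close> has advanced by
\<open>pi\<close> the solution has a further zero, and from one zero to the next the phase \<open>\<theta>\<close> gains at least
\<open>pi\<close>, since it increases between two multiples of \<open>pi\<close>.\<close>

lemma phase_gains_per_zero:
  assumes th: "phase \<kappa> \<theta>" and \<psi>: "continuous_on UNIV \<psi>" and zero: "\<And>t. cos (\<psi> t) = 0 \<Longrightarrow> sin (\<theta> t) = 0"
  shows "cos (\<psi> a) = 0 \<Longrightarrow> a \<le> b \<Longrightarrow> \<psi> b \<ge> \<psi> a + real k * pi \<Longrightarrow> \<theta> b \<ge> \<theta> a + real k * pi"
proof (induction k arbitrary: a)
  case 0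
  then show ?case using phase_gains[OF th zero, of a b] by (cases "a = b") auto
next
  case (Suc k)
  have "\<exists>s\<ge>a. s \<le> b \<and> \<psi> s = \<psi> a + pi"
  proof (rule IVT')
    have "real (Suc k) * pi = real k * pi + pi" "0 \<le> real k * pi" by (simp_all add: distrib_right)
    then show "\<psi> a + pi \<le> \<psi> b" using Suc.prems(3) by linarith
  qed (use Suc.prems in \<open>auto intro: continuous_on_subset[OF \<psi>]\<close>)
  then obtain s where s: "a \<le> s" "s \<le> b" "\<psi> s = \<psi> a + pi" by blast
  then have as: "a < s" by (cases "a = s") auto
  have cs: "cos (\<psi> s) = 0" using Suc.prems(1) by (simp add: s)
  have "\<theta> s \<ge> \<theta> a + pi"
  proof -
    have gt: "\<theta> s > \<theta> a" using phase_gains[OF th zero[OF Suc.prems(1)] as] .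
    obtain i j :: int where "\<theta> a = of_int i * pi" "\<theta> s = of_int j * pi"
      using zero[OF Suc.prems(1)] zero[OF cs] by (auto simp: sin_zero_iff_int2)
    moreover from this gt have "i < j" by simp
    then have "(of_int i + 1) * pi \<le> of_int j * pi" by (intro mult_right_mono) auto
    ultimately show ?thesis by (simp add: distrib_right)
  qed
  moreover have "\<theta> b \<ge> \<theta> s + real k * pi"
    using Suc.prems(3) by (intro Suc.IH cs s(2)) (simp add: s(3) distrib_right)
  ultimately show ?case by (simp add: distrib_right)
qed

end

lemma periodic_derivative:
  fixes f :: "real \<Rightarrow> real"
  assumes d: "\<And>t. (f has_real_derivative f' t) (at t)" and per: "\<And>t. f (t + P) = f t"
  shows "f' (t + P) = f' t"
proof -
  have "((\<lambda>t. f (t + P)) has_real_derivative f' (t + P)) (at t)" using d[of "t + P"] by (simp add: DERIV_shift)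
  then show ?thesis using DERIV_unique[OF _ d[of t]] by (simp add: per)
qed

section \<open>Functions of class \<open>C\<^sup>k\<close>\<close>

lemma Ck_on_Suc_imp: "Ck_on (Suc k) f S \<Longrightarrow> Ck_on k f S"
proof (induction k arbitrary: f)
  case 0
  then show ?case by (auto intro!: continuous_at_imp_continuous_on differentiable_imp_continuous_within)
qed simp

text \<open>The congruence property of the lower order appears as a hypothesis so that the rule can already be
used in the inductive proof of that property.\<close>

lemma Ck_on_SucI:
  fixes f :: "'a::real_normed_vector \<Rightarrow> 'b::real_normed_vector"
  assumes "\<And>x. x \<in> S \<Longrightarrow> (f has_derivative D x) (at x)" and "\<And>v. Ck_on k (\<lambda>x. D x v) S"
    and cong: "\<And>f g :: 'a \<Rightarrow> 'b. (\<And>x. x \<in> S \<Longrightarrow> f x = g x) \<Longrightarrow> Ck_on k f S \<Longrightarrow> Ck_on k g S"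
  shows "Ck_on (Suc k) f S"
proof -
  have e: "frechet_derivative f (at x) v = D x v" if "x \<in> S" for x v
    using frechet_derivative_at[OF assms(1)[OF that]] by simp
  have "Ck_on k (\<lambda>x. frechet_derivative f (at x) v) S" for v
    using assms(2)[of v] by (rule cong[rotated]) (simp add: e)
  then show ?thesis using assms(1) by (auto simp: differentiable_def)
qed

lemma Ck_on_cong:
  assumes "open S" "\<And>x. x \<in> S \<Longrightarrow> f x = g x" "Ck_on k f S"
  shows "Ck_on k g S"
  using assms(2,3)
proof (induction k arbitrary: f g)
  case 0
  then show ?case using continuous_on_cong[of S S f g] by simp
next
  case (Suc k)
  show ?case
  proof (rule Ck_on_SucI[where D = "\<lambda>x. frechet_derivative f (at x)"])
    fix x assume x: "x \<in> S"
    then have "(f has_derivative frechet_derivative f (at x)) (at x)"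
      using Suc.prems(2) by (simp add: frechet_derivative_works)
    then show "(g has_derivative frechet_derivative f (at x)) (at x)"
      by (rule has_derivative_transform_within_open[OF _ \<open>open S\<close> x]) (use Suc.prems(1) in auto)
  qed (use Suc in auto)
qed

lemmas Ck_on_SucI_open = Ck_on_SucI[OF _ _ Ck_on_cong]

lemma Ck_on_Suc_has_derivative:
  "Ck_on (Suc k) f S \<Longrightarrow> x \<in> S \<Longrightarrow> (f has_derivative frechet_derivative f (at x)) (at x)"
  by (simp add: frechet_derivative_works)

lemma Ck_on_const: "open S \<Longrightarrow> Ck_on k (\<lambda>_. c) S"
proof (induction k arbitrary: c)
  case (Suc k)
  show ?case by (rule Ck_on_SucI_open[where D = "\<lambda>_ _. 0"]) (use Suc in \<open>auto intro: derivative_intros\<close>)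
qed simp

lemma Ck_on_bounded_linear: "open S \<Longrightarrow> bounded_linear f \<Longrightarrow> Ck_on k f S"
proof (cases k)
  case (Suc m)
  assume S: "open S" and f: "bounded_linear f"
  show ?thesis unfolding Suc
    by (rule Ck_on_SucI_open[where D = "\<lambda>_. f"])
      (use S f in \<open>auto intro: bounded_linear_imp_has_derivative Ck_on_const\<close>)
qed (auto intro: linear_continuous_on)

lemma Ck_on_add: "open S \<Longrightarrow> Ck_on k f S \<Longrightarrow> Ck_on k g S \<Longrightarrow> Ck_on k (\<lambda>x. f x + g x) S"
proof (induction k arbitrary: f g)
  case (Suc k)
  show ?case
    by (rule Ck_on_SucI_open[where D = "\<lambda>x v. frechet_derivative f (at x) v + frechet_derivative g (at x) v"])
      (use Suc Ck_on_Suc_has_derivative[OF Suc.prems(2)] Ck_on_Suc_has_derivative[OF Suc.prems(3)]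
        in \<open>auto intro!: has_derivative_add\<close>)
qed (auto intro: continuous_intros)

lemma Ck_on_mult:
  fixes f g :: "'a::real_normed_vector \<Rightarrow> real"
  shows "open S \<Longrightarrow> Ck_on k f S \<Longrightarrow> Ck_on k g S \<Longrightarrow> Ck_on k (\<lambda>x. f x * g x) S"
proof (induction k arbitrary: f g)
  case (Suc k)
  note d = Ck_on_Suc_has_derivative[OF Suc.prems(2)] Ck_on_Suc_has_derivative[OF Suc.prems(3)]
  have Df: "Ck_on k (\<lambda>x. frechet_derivative f (at x) v) S" for v using Suc.prems(2) by simp
  have Dg: "Ck_on k (\<lambda>x. frechet_derivative g (at x) v) S" for v using Suc.prems(3) by simp
  show ?case
    by (rule Ck_on_SucI_open[where D = "\<lambda>x v. f x * frechet_derivative g (at x) v + frechet_derivative f (at x) v * g x"])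
      (use Suc.prems(1) d in \<open>auto intro!: has_derivative_mult Ck_on_add Suc.IH Df Dg
         Ck_on_Suc_imp[OF Suc.prems(2)] Ck_on_Suc_imp[OF Suc.prems(3)]\<close>)
qed (auto intro: continuous_intros)

lemma Ck_on_power:
  fixes f :: "'a::real_normed_vector \<Rightarrow> real"
  shows "open S \<Longrightarrow> Ck_on k f S \<Longrightarrow> Ck_on k (\<lambda>x. f x ^ m) S"
  by (induction m) (auto intro: Ck_on_const Ck_on_mult)

lemma Ck_on_inverse:
  fixes f :: "'a::real_normed_vector \<Rightarrow> real"
  assumes "open S" "\<And>x. x \<in> S \<Longrightarrow> f x \<noteq> 0"
  shows "Ck_on k f S \<Longrightarrow> Ck_on k (\<lambda>x. inverse (f x)) S"
proof (induction k)
  case 0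
  then show ?case using assms by (auto intro!: continuous_on_inverse)
next
  case (Suc k)
  note d = Ck_on_Suc_has_derivative[OF Suc.prems]
  have Df: "Ck_on k (\<lambda>x. frechet_derivative f (at x) v) S" for v using Suc.prems by simp
  have I: "Ck_on k (\<lambda>x. inverse (f x)) S" by (rule Suc.IH[OF Ck_on_Suc_imp[OF Suc.prems]])
  show ?case
  proof (rule Ck_on_SucI_open[where D = "\<lambda>x v. (-1) * (inverse (f x) * frechet_derivative f (at x) v * inverse (f x))"])
    fix x assume "x \<in> S"
    from Deriv.has_derivative_inverse[OF assms(2)[OF this] d[OF this]]
    show "((\<lambda>x. inverse (f x)) has_derivative (\<lambda>v. (-1) * (inverse (f x) * frechet_derivative f (at x) v * inverse (f x)))) (at x)"
      by simp
  next
    show "Ck_on k (\<lambda>x. (-1) * (inverse (f x) * frechet_derivative f (at x) v * inverse (f x))) S" for v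
      by (intro Ck_on_mult Ck_on_const assms(1) I Df)
  qed (rule assms(1))
qed

lemma Ck_on_compose_linear:
  assumes L: "bounded_linear L" and "open S"
  shows "Ck_on k f UNIV \<Longrightarrow> Ck_on k (\<lambda>x. f (L x)) S"
proof (induction k arbitrary: f)
  case 0
  then show ?case using continuous_on_compose2[of UNIV f S L] linear_continuous_on[OF L] by auto
next
  case (Suc k)
  show ?case
  proof (rule Ck_on_SucI_open[where D = "\<lambda>x v. frechet_derivative f (at (L x)) (L v)"])
    fix x assume "x \<in> S"
    show "((\<lambda>x. f (L x)) has_derivative (\<lambda>v. frechet_derivative f (at (L x)) (L v))) (at x)"
      by (rule has_derivative_compose[OF bounded_linear_imp_has_derivative[OF L] Ck_on_Suc_has_derivative[OF Suc.prems]]) simp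
  next
    show "Ck_on k (\<lambda>x. frechet_derivative f (at (L x)) (L v)) S" for v
      by (rule Suc.IH) (use Suc.prems in simp)
  qed (rule \<open>open S\<close>)
qed

lemma Ck_on_norm_fst: "Ck_on k (\<lambda>q::(real^'n) \<times> real. norm (fst q)) ((- {0}) \<times> UNIV)"
proof (induction k)
  case (Suc k)
  have o: "open ((- {0::real^'n}) \<times> (UNIV :: real set))" by (intro open_Times) auto
  show ?case
  proof (rule Ck_on_SucI_open[where D = "\<lambda>q v. (fst q \<bullet> fst v) * inverse (norm (fst q))"])
    fix q :: "(real^'n) \<times> real" assume "q \<in> (- {0}) \<times> UNIV"
    then have "fst q \<noteq> 0" by auto
    from has_derivative_compose[OF has_derivative_fst[OF has_derivative_ident] has_derivative_norm[OF this]]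
    show "((\<lambda>q. norm (fst q)) has_derivative (\<lambda>v. (fst q \<bullet> fst v) * inverse (norm (fst q)))) (at q)"
      by (simp add: sgn_div_norm inner_commute divide_inverse mult.commute)
  next
    have bl: "bounded_linear (\<lambda>q::(real^'n) \<times> real. fst q \<bullet> fst v)" for v :: "(real^'n) \<times> real"
      by (intro bounded_linear_intros)
    show "Ck_on k (\<lambda>q::(real^'n) \<times> real. (fst q \<bullet> fst v) * inverse (norm (fst q))) ((- {0}) \<times> UNIV)" for v :: "(real^'n) \<times> real"
      by (intro Ck_on_mult[OF o] Ck_on_inverse[OF o] Suc Ck_on_bounded_linear[OF o] bl) auto
  qed (rule o)
qed (auto intro!: continuous_intros)

text \<open>The radial extension of such a function is \<open>u(t) (a + (b \<bullet> z) / |z|)\<close>, and \<open>|z|\<close> is smooth away from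
the origin.\<close>

lemma smooth_on_cylinder_separated:
  fixes b :: "real^'n" and u :: "real \<Rightarrow> real"
  assumes "\<And>k. Ck_on k u UNIV"
  shows "smooth_on_cylinder (\<lambda>(y::real^'n, t). u t * (a + b \<bullet> y))"
proof -
  have o: "open ((- {0::real^'n}) \<times> (UNIV :: real set))" by (intro open_Times) auto
  have e: "radial_ext (\<lambda>(y::real^'n, t). u t * (a + b \<bullet> y)) =
     (\<lambda>q. u (snd q) * (a + (b \<bullet> fst q) * inverse (norm (fst q))))"
    by (auto simp: radial_ext_def fun_eq_iff mult.commute)
  have "bounded_linear (\<lambda>q::(real^'n) \<times> real. b \<bullet> fst q)" "bounded_linear (snd :: (real^'n) \<times> real \<Rightarrow> real)"
    by (intro bounded_linear_intros)+
  then show ?thesis unfolding smooth_on_cylinder_def smooth_on_open_def e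
    by (intro conjI allI o Ck_on_mult[OF o] Ck_on_add[OF o] Ck_on_const[OF o] Ck_on_inverse[OF o]
         Ck_on_bounded_linear[OF o] Ck_on_compose_linear[OF _ o] Ck_on_norm_fst assms) auto
qed

lemma Ck_on_real_SucI:
  fixes f :: "real \<Rightarrow> real"
  assumes "\<And>t. (f has_real_derivative f' t) (at t)" "Ck_on k f' UNIV"
  shows "Ck_on (Suc k) f UNIV"
proof (rule Ck_on_SucI_open[where D = "\<lambda>t v. f' t * v"])
  show "(f has_derivative (*) (f' t)) (at t)" for t
    using assms(1)[of t] by (simp add: has_field_derivative_def)
  show "Ck_on k (\<lambda>t. f' t * v) UNIV" for v by (intro Ck_on_mult Ck_on_const assms) auto
qed simp

lemma Ck_on_real_SucD:
  fixes f :: "real \<Rightarrow> real"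
  assumes "Ck_on (Suc k) f UNIV"
  shows "(f has_real_derivative deriv f t) (at t)" "Ck_on k (deriv f) UNIV"
proof -
  have d: "(f has_real_derivative frechet_derivative f (at t) 1) (at t)" for t
  proof -
    have D: "(f has_derivative frechet_derivative f (at t)) (at t)"
      by (rule Ck_on_Suc_has_derivative[OF assms]) simp
    have "frechet_derivative f (at t) v = frechet_derivative f (at t) 1 * v" for v
      using linear_scale[OF has_derivative_linear[OF D], of v 1] by simp
    then have "frechet_derivative f (at t) = (*) (frechet_derivative f (at t) 1)" by blast
    with D show ?thesis by (simp add: has_field_derivative_def)
  qed
  then have e: "deriv f t = frechet_derivative f (at t) 1" for t by (rule DERIV_imp_deriv)
  show "(f has_real_derivative deriv f t) (at t)" using d[of t] by (simp add: e)
  have "deriv f = (\<lambda>t. frechet_derivative f (at t) 1)" using e by blast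
  then show "Ck_on k (deriv f) UNIV" using assms by simp
qed

section \<open>Tangential derivatives on the cylinder and orthonormal expansions\<close>

lemma normalization_has_derivative:
  fixes p :: "(real^'n) \<times> real"
  assumes "p \<in> cylinder"
  shows "((\<lambda>q. (fst q /\<^sub>R norm (fst q), snd q)) has_derivative
     (\<lambda>v. (fst v - (fst v \<bullet> fst p) *\<^sub>R fst p, snd v))) (at p)"
proof -
  have n: "norm (fst p) = 1" "fst p \<noteq> 0" using assms by (auto simp: mem_Times_iff)
  have "((\<lambda>q::(real^'n) \<times> real. norm (fst q)) has_derivative (\<lambda>v. fst v \<bullet> fst p)) (at p)"
    using has_derivative_compose[OF has_derivative_fst[OF has_derivative_ident] has_derivative_norm[OF n(2)]]
    by (simp add: sgn_div_norm n)
  then have "((\<lambda>q::(real^'n) \<times> real. inverse (norm (fst q))) has_derivative (\<lambda>v. - (fst v \<bullet> fst p))) (at p)"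
    using Deriv.has_derivative_inverse[of "\<lambda>q. norm (fst q)" p] n by simp
  from has_derivative_scaleR[OF this has_derivative_fst[OF has_derivative_ident]]
  have "((\<lambda>q::(real^'n) \<times> real. fst q /\<^sub>R norm (fst q)) has_derivative (\<lambda>v. fst v - (fst v \<bullet> fst p) *\<^sub>R fst p)) (at p)"
    by (simp add: n)
  then show ?thesis by (intro has_derivative_Pair has_derivative_snd has_derivative_ident)
qed

text \<open>To differentiate along the cylinder, extend the function in any convenient way and differentiate in
the direction of the tangential projection. The chain rule for the radial projection shows that this
agrees with the radial extension.\<close>

lemma mderiv_eqI:
  fixes f g :: "(real^'n) \<times> real \<Rightarrow> 'b::real_normed_vector"
  assumes p: "p \<in> cylinder" and eq: "\<And>q. q \<in> cylinder \<Longrightarrow> f q = g q"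
    and g: "(g has_derivative D) (at p)"
  shows "mderiv f p v = D (fst v - (fst v \<bullet> fst p) *\<^sub>R fst p, snd v)"
proof -
  let ?\<pi> = "\<lambda>q::(real^'n) \<times> real. (fst q /\<^sub>R norm (fst q), snd q)"
  have n: "norm (fst p) = 1" "fst p \<noteq> 0" using p by (auto simp: mem_Times_iff)
  have "?\<pi> p = p" using n by simp
  with g have "(g has_derivative D) (at (?\<pi> p))" by simp
  from has_derivative_compose[OF normalization_has_derivative[OF p] this]
  have "((\<lambda>q. g (?\<pi> q)) has_derivative (\<lambda>v. D (fst v - (fst v \<bullet> fst p) *\<^sub>R fst p, snd v))) (at p)" .
  moreover have "open ((- {0::real^'n}) \<times> (UNIV :: real set))" by (intro open_Times) auto
  moreover have "p \<in> (- {0}) \<times> UNIV" using n by (simp add: mem_Times_iff)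
  moreover have "g (?\<pi> q) = radial_ext f q" if "q \<in> (- {0}) \<times> UNIV" for q
  proof -
    have "?\<pi> q \<in> cylinder" using that by (auto simp: mem_Times_iff)
    from eq[OF this] show ?thesis by (simp add: radial_ext_def split_def)
  qed
  ultimately have "(radial_ext f has_derivative (\<lambda>v. D (fst v - (fst v \<bullet> fst p) *\<^sub>R fst p, snd v))) (at p)"
    by (rule has_derivative_transform_within_open)
  from fun_cong[OF frechet_derivative_at[OF this], of v] show ?thesis unfolding mderiv_def by (rule sym)
qed

text \<open>Parseval's identity for a form \<open>g\<close> that is only known to be linear in its first argument. It makes
sums over a frame independent of the frame.\<close>

lemma orthonormal_expansion:
  fixes g :: "'a::real_vector \<Rightarrow> 'a \<Rightarrow> real"
  assumes lin: "\<And>w. linear (\<lambda>v. g v w)" and B: "finite B" "\<And>a b. a \<in> B \<Longrightarrow> b \<in> B \<Longrightarrow> g a b = (if a = b then 1 else 0)"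
    and w: "w \<in> span B"
  shows "g w x = (\<Sum>e\<in>B. g w e * g e x)"
proof -
  obtain c where c: "w = (\<Sum>e\<in>B. c e *\<^sub>R e)" using w by (auto simp: span_finite[OF B(1)])
  have g: "g w x = (\<Sum>e\<in>B. c e * g e x)" for x
    unfolding c by (simp add: linear_sum[OF lin] linear_scale[OF lin])
  have gc: "g w b = c b" if "b \<in> B" for b
  proof -
    have "g w b = (\<Sum>e\<in>B. c e * g e b)" by (rule g)
    also have "\<dots> = (\<Sum>e\<in>B. if e = b then c e else 0)" using that by (intro sum.cong) (auto simp: B(2))
    also have "\<dots> = c b" using that B(1) by simp
    finally show ?thesis .
  qed
  have "(\<Sum>e\<in>B. g w e * g e x) = (\<Sum>e\<in>B. c e * g e x)" by (intro sum.cong) (simp_all add: gc)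
  then show "g w x = (\<Sum>e\<in>B. g w e * g e x)" using g[of x] by simp
qed

section \<open>Hypersurfaces generated by a spherical curve\<close>

text \<open>If \<open>m\<close> is orthogonal to \<open>a\<close> and \<open>b\<close>, then \<open>m \<times> (a \<times> b) = 0\<close>. For unit vectors \<open>m\<close> and
\<open>a \<times> b\<close> this leaves only \<open>m = a \<times> b\<close> and \<open>m = - a \<times> b\<close>.\<close>

lemma orthogonal_to_two_is_cross_multiple:
  fixes a1 a2 a3 b1 b2 b3 m1 m2 m3 :: real
  defines "x1 \<equiv> a2 * b3 - a3 * b2" and "x2 \<equiv> a3 * b1 - a1 * b3" and "x3 \<equiv> a1 * b2 - a2 * b1"
  assumes "a1 * m1 + a2 * m2 + a3 * m3 = 0" "b1 * m1 + b2 * m2 + b3 * m3 = 0"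
    and "x1\<^sup>2 + x2\<^sup>2 + x3\<^sup>2 = 1" "m1\<^sup>2 + m2\<^sup>2 + m3\<^sup>2 = 1"
  obtains \<epsilon> where "\<epsilon>\<^sup>2 = 1" "m1 = \<epsilon> * x1" "m2 = \<epsilon> * x2" "m3 = \<epsilon> * x3"
proof -
  define \<epsilon> where "\<epsilon> = m1 * x1 + m2 * x2 + m3 * x3"
  have "m1 * x2 - m2 * x1 = a3 * (b1 * m1 + b2 * m2 + b3 * m3) - b3 * (a1 * m1 + a2 * m2 + a3 * m3)"
    "m1 * x3 - m3 * x1 = b2 * (a1 * m1 + a2 * m2 + a3 * m3) - a2 * (b1 * m1 + b2 * m2 + b3 * m3)"
    "m2 * x3 - m3 * x2 = a1 * (b1 * m1 + b2 * m2 + b3 * m3) - b1 * (a1 * m1 + a2 * m2 + a3 * m3)"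
    by (simp_all add: x1_def x2_def x3_def algebra_simps)
  then have c: "m1 * x2 - m2 * x1 = 0" "m1 * x3 - m3 * x1 = 0" "m2 * x3 - m3 * x2 = 0"
    unfolding assms(4,5) by simp_all
  have "m1 * (x1\<^sup>2 + x2\<^sup>2 + x3\<^sup>2) = \<epsilon> * x1 + x2 * (m1 * x2 - m2 * x1) + x3 * (m1 * x3 - m3 * x1)"
    "m2 * (x1\<^sup>2 + x2\<^sup>2 + x3\<^sup>2) = \<epsilon> * x2 - x1 * (m1 * x2 - m2 * x1) + x3 * (m2 * x3 - m3 * x2)"
    "m3 * (x1\<^sup>2 + x2\<^sup>2 + x3\<^sup>2) = \<epsilon> * x3 - x1 * (m1 * x3 - m3 * x1) - x2 * (m2 * x3 - m3 * x2)"
    by (simp_all add: \<epsilon>_def power2_eq_square algebra_simps)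
  then have m: "m1 = \<epsilon> * x1" "m2 = \<epsilon> * x2" "m3 = \<epsilon> * x3"
    unfolding assms(6) c by simp_all
  have "\<epsilon>\<^sup>2 * (x1\<^sup>2 + x2\<^sup>2 + x3\<^sup>2) = 1"
    using assms(7) unfolding m by (simp add: power_mult_distrib distrib_left)
  then have "\<epsilon>\<^sup>2 = 1" unfolding assms(6) by simp
  with m show thesis using that by blast
qed

text \<open>A unit speed curve \<open>(r, C, S)\<close> in the unit sphere of \<open>\<real>\<^sup>3\<close>; the functions with suffix 1 and 2 are its
derivatives. The cross product of position and velocity is a unit normal of the curve in the sphere.
Its first component is \<open>r lam\<close>, and the curvature with respect to it is \<open>- mu\<close>, so that \<open>lam\<close> and
\<open>mu\<close> are, up to a common sign, the principal curvatures of the hypersurface generated by the curve.\<close>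

locale spherical_curve =
  fixes r C S r1 C1 S1 r2 C2 S2 lam mu :: "real \<Rightarrow> real"
  assumes dr: "(r has_real_derivative r1 t) (at t)" and dC: "(C has_real_derivative C1 t) (at t)"
    and dS: "(S has_real_derivative S1 t) (at t)"
    and dr1: "(r1 has_real_derivative r2 t) (at t)" and dC1: "(C1 has_real_derivative C2 t) (at t)"
    and dS1: "(S1 has_real_derivative S2 t) (at t)"
    and r_pos: "r t > 0"
    and on_sphere: "(r t)\<^sup>2 + (C t)\<^sup>2 + (S t)\<^sup>2 = 1"
    and unit_speed: "(r1 t)\<^sup>2 + (C1 t)\<^sup>2 + (S1 t)\<^sup>2 = 1"
    and normal_radial: "C t * S1 t - S t * C1 t = r t * lam t"
    and normal_curvature: "r2 t * (C t * S1 t - S t * C1 t) + C2 t * (S t * r1 t - r t * S1 t)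
       + S2 t * (r t * C1 t - C t * r1 t) = - mu t"
begin

lemma orthogonality:
  "r t * r1 t + C t * C1 t + S t * S1 t = 0" "r1 t * r2 t + C1 t * C2 t + S1 t * S2 t = 0"
proof -
  have "((\<lambda>t. (r t)\<^sup>2 + (C t)\<^sup>2 + (S t)\<^sup>2) has_real_derivative 2 * (r t * r1 t + C t * C1 t + S t * S1 t)) (at t)"
    by (auto intro!: derivative_eq_intros dr dC dS simp: algebra_simps)
  moreover have "((\<lambda>t. (r t)\<^sup>2 + (C t)\<^sup>2 + (S t)\<^sup>2) has_real_derivative 0) (at t)" by (simp add: on_sphere)
  ultimately show "r t * r1 t + C t * C1 t + S t * S1 t = 0" using DERIV_unique by fastforce
  have "((\<lambda>t. (r1 t)\<^sup>2 + (C1 t)\<^sup>2 + (S1 t)\<^sup>2) has_real_derivative 2 * (r1 t * r2 t + C1 t * C2 t + S1 t * S2 t)) (at t)"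
    by (auto intro!: derivative_eq_intros dr1 dC1 dS1 simp: algebra_simps)
  moreover have "((\<lambda>t. (r1 t)\<^sup>2 + (C1 t)\<^sup>2 + (S1 t)\<^sup>2) has_real_derivative 0) (at t)" by (simp add: unit_speed)
  ultimately show "r1 t * r2 t + C1 t * C2 t + S1 t * S2 t = 0" using DERIV_unique by fastforce
qed

definition \<phi> :: "(real^'n) \<times> real \<Rightarrow> (real^'n) \<times> real \<times> real" where
  "\<phi> = (\<lambda>(y, t). (r t *\<^sub>R y, C t, S t))"

definition proj :: "real^'n \<Rightarrow> real^'n \<Rightarrow> real^'n" where
  "proj y v = v - (v \<bullet> y) *\<^sub>R y"

lemma proj_tangent: "v \<bullet> y = 0 \<Longrightarrow> proj y v = v"
  by (simp add: proj_def)

lemma proj_orthogonal: "norm y = 1 \<Longrightarrow> proj y v \<bullet> y = 0" "norm y = 1 \<Longrightarrow> y \<bullet> proj y v = 0"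
  by (auto simp: proj_def inner_diff_left inner_diff_right inner_commute norm_eq_1)

lemma proj_linear: "linear (proj y)"
  unfolding proj_def[abs_def] by (intro linearI) (simp_all add: algebra_simps inner_add_left)

lemma snd_deriv:
  assumes "(h has_real_derivative h') (at (snd p))"
  shows "((\<lambda>q::(real^'n) \<times> real. h (snd q)) has_derivative (\<lambda>v. snd v * h')) (at p)"
  using has_derivative_compose[OF has_derivative_snd[OF has_derivative_ident] assms[unfolded has_field_derivative_def]]
  by (simp add: mult.commute)

lemma mderiv_\<phi>:
  assumes y: "norm y = 1"
  shows "mderiv \<phi> (y, t) v =
    (r t *\<^sub>R proj y (fst v) + (snd v * r1 t) *\<^sub>R y, snd v * C1 t, snd v * S1 t)"
proof -
  let ?p = "(y, t)"
  have p: "?p \<in> cylinder" using y by simp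
  have g: "((\<lambda>q. (r (snd q) *\<^sub>R fst q, C (snd q), S (snd q))) has_derivative
      (\<lambda>v. (r (snd ?p) *\<^sub>R fst v + (snd v * r1 (snd ?p)) *\<^sub>R fst ?p, snd v * C1 (snd ?p), snd v * S1 (snd ?p)))) (at ?p)"
    by (rule has_derivative_Pair[OF has_derivative_scaleR[OF snd_deriv[OF dr] has_derivative_fst[OF has_derivative_ident]]
          has_derivative_Pair[OF snd_deriv[OF dC] snd_deriv[OF dS]]])
  have e: "\<phi> q = (r (snd q) *\<^sub>R fst q, C (snd q), S (snd q))" for q :: "(real^'n) \<times> real"
    by (simp add: \<phi>_def split_def)
  from mderiv_eqI[OF p e g, of v] show ?thesis by (simp add: proj_def)
qed

text \<open>In other words, the metric is \<open>dt\<^sup>2 + r\<^sup>2 g\<close> with \<open>g\<close> the metric of the unit sphere.\<close>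

lemma metric:
  assumes "norm y = 1"
  shows "induced_metric \<phi> (y, t) v w = (r t)\<^sup>2 * (proj y (fst v) \<bullet> proj y (fst w)) + snd v * snd w"
proof -
  have yy: "y \<bullet> y = 1" using assms by (simp add: norm_eq_1)
  have o: "(k *\<^sub>R a + c *\<^sub>R y) \<bullet> (k *\<^sub>R a' + c' *\<^sub>R y) = k\<^sup>2 * (a \<bullet> a') + c * c'"
    if "a \<bullet> y = 0" "y \<bullet> a' = 0" for a a' and k c c' :: real
    using that yy by (simp add: inner_add_left inner_add_right power2_eq_square)
  have "induced_metric \<phi> (y, t) v w = (r t)\<^sup>2 * (proj y (fst v) \<bullet> proj y (fst w))
      + (snd v * r1 t) * (snd w * r1 t) + (snd v * C1 t) * (snd w * C1 t) + (snd v * S1 t) * (snd w * S1 t)"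
    unfolding induced_metric_def mderiv_\<phi>[OF assms] inner_Pair
    using o[OF proj_orthogonal(1,2)[OF assms]] by simp
  also have "\<dots> = (r t)\<^sup>2 * (proj y (fst v) \<bullet> proj y (fst w)) + snd v * snd w * ((r1 t)\<^sup>2 + (C1 t)\<^sup>2 + (S1 t)\<^sup>2)"
    by (simp add: power2_eq_square algebra_simps)
  finally show ?thesis by (simp add: unit_speed)
qed

lemma metric_tangent:
  assumes "norm y = 1" "v \<in> tangent_space (y, t)" "w \<in> tangent_space (y, t)"
  shows "induced_metric \<phi> (y, t) v w = (r t)\<^sup>2 * (fst v \<bullet> fst w) + snd v * snd w"
  using assms by (simp add: metric tangent_space_def proj_tangent)

lemma metric_linear: "norm y = 1 \<Longrightarrow> linear (\<lambda>v. induced_metric \<phi> (y, t) v w)"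
  by (intro linearI) (simp_all add: metric linear_add[OF proj_linear] linear_scale[OF proj_linear] algebra_simps inner_add_left)

lemma metric_sym: "induced_metric \<phi> p v w = induced_metric \<phi> p w v"
  by (simp add: induced_metric_def inner_commute)

lemma tangent_space_subspace: "subspace (tangent_space p)"
  by (auto simp: tangent_space_def subspace_def inner_add_left)

lemma dim_tangent_space:
  fixes y :: "real^'n"
  assumes "norm y = 1"
  shows "dim (tangent_space (y, t)) = CARD('n)"
proof -
  have "(y, 0::real) \<bullet> v = fst v \<bullet> y" for v by (simp add: inner_prod_def inner_commute)
  then have T: "tangent_space (y, t) = {v. (y, 0) \<bullet> v = 0}" by (simp add: tangent_space_def)
  have "y \<noteq> 0" using assms by auto
  then have "(y, 0::real) \<noteq> 0" by (simp add: zero_prod_def)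
  from dim_hyperplane[OF this] show ?thesis unfolding T by simp
qed

text \<open>A frame exists because stretching the spherical directions by \<open>1/r\<close> carries an orthonormal basis of
the tangent space for the metric of \<open>\<real>\<^sup>n \<times> \<real>\<close> to one for the induced metric.\<close>

lemma frame:
  fixes y :: "real^'n" and t :: real
  assumes y: "norm y = 1"
  defines "B \<equiv> orthonormal_frame \<phi> (y, t)"
  shows "finite B" "span B = tangent_space (y, t)"
    "\<And>a b. a \<in> B \<Longrightarrow> b \<in> B \<Longrightarrow> induced_metric \<phi> (y, t) a b = (if a = b then 1 else 0)"
    "B \<subseteq> tangent_space (y, t)" "card B = CARD('n)"
proof -
  let ?T = "tangent_space (y, t)"
  let ?P = "\<lambda>B. finite B \<and> span B = ?T \<and> (\<forall>a\<in>B. \<forall>b\<in>B. induced_metric \<phi> (y, t) a b = (if a = b then 1 else 0))"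
  have "\<exists>B. ?P B"
  proof -
    obtain A where A: "A \<subseteq> ?T" "pairwise orthogonal A" "\<And>x. x \<in> A \<Longrightarrow> norm x = 1" "independent A"
        "card A = dim ?T" "span A = ?T"
      by (rule orthonormal_basis_subspace[OF tangent_space_subspace[of "(y, t)"]]) iprover
    have fA: "finite A" using A(4) by (rule independent_imp_finite)
    let ?L = "\<lambda>v::(real^'n) \<times> real. (fst v /\<^sub>R r t, snd v)"
    have L: "linear ?L" by (intro linearI) (simp_all add: algebra_simps)
    have LT: "?L ` ?T = ?T"
    proof
      show "?L ` ?T \<subseteq> ?T" by (auto simp: tangent_space_def)
      show "?T \<subseteq> ?L ` ?T"
      proof
        fix v assume "v \<in> ?T"
        then have "(r t *\<^sub>R fst v, snd v) \<in> ?T" by (simp add: tangent_space_def)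
        moreover have "v = ?L (r t *\<^sub>R fst v, snd v)" using r_pos[of t] by simp
        ultimately show "v \<in> ?L ` ?T" by blast
      qed
    qed
    have met: "induced_metric \<phi> (y, t) (?L a) (?L b) = a \<bullet> b" if "a \<in> ?T" "b \<in> ?T" for a b
    proof -
      have "?L a \<in> ?T" "?L b \<in> ?T" using LT that by auto
      from metric_tangent[OF y this] show ?thesis
        using r_pos[of t] by (simp add: inner_prod_def power2_eq_square field_simps)
    qed
    have inj: "?L a = ?L b \<longleftrightarrow> a = b" for a b using r_pos[of t] by (auto simp: prod_eq_iff)
    have on: "a \<bullet> b = (if a = b then 1 else 0)" if "a \<in> A" "b \<in> A" for a b
    proof (cases "a = b")
      case True
      then show ?thesis using A(3)[OF that(1)] by (simp add: norm_eq_1)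
    next
      case False
      then show ?thesis using A(2) that by (simp add: pairwise_def orthogonal_def)
    qed
    have "\<forall>a'\<in>?L ` A. \<forall>b'\<in>?L ` A. induced_metric \<phi> (y, t) a' b' = (if a' = b' then 1 else 0)"
    proof (intro ballI)
      fix a' b' assume "a' \<in> ?L ` A" "b' \<in> ?L ` A"
      then obtain a b where ab: "a \<in> A" "b \<in> A" "a' = ?L a" "b' = ?L b" by blast
      have "induced_metric \<phi> (y, t) a' b' = a \<bullet> b" unfolding ab(3,4) using met ab(1,2) A(1) by blast
      moreover have "a' = b' \<longleftrightarrow> a = b" unfolding ab(3,4) by (rule inj)
      ultimately show "induced_metric \<phi> (y, t) a' b' = (if a' = b' then 1 else 0)" using on[OF ab(1,2)] by simp
    qed
    moreover have "finite (?L ` A)" using fA by simp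
    moreover have "span (?L ` A) = ?T" using A(6) LT linear_span_image[OF L, of A] by simp
    ultimately have "?P (?L ` A)" by blast
    then show ?thesis by blast
  qed
  from someI_ex[OF this] have P: "?P B" unfolding B_def orthonormal_frame_def .
  then show fin: "finite B" and sp: "span B = ?T"
    and on: "\<And>a b. a \<in> B \<Longrightarrow> b \<in> B \<Longrightarrow> induced_metric \<phi> (y, t) a b = (if a = b then 1 else 0)" by blast+
  show "B \<subseteq> ?T" using sp span_superset by blast
  have "independent B"
  proof (rule independent_if_scalars_zero[OF fin])
    fix f x assume z: "(\<Sum>x\<in>B. f x *\<^sub>R x) = 0" and x: "x \<in> B"
    note lin = metric_linear[OF y, of t x]
    have "0 = induced_metric \<phi> (y, t) (\<Sum>x\<in>B. f x *\<^sub>R x) x" unfolding z using linear_0[OF lin] by simp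
    also have "\<dots> = (\<Sum>e\<in>B. f e * induced_metric \<phi> (y, t) e x)"
      by (simp add: linear_sum[OF lin] linear_scale[OF lin])
    also have "\<dots> = (\<Sum>e\<in>B. if e = x then f e else 0)" using x by (intro sum.cong) (auto simp: on)
    also have "\<dots> = f x" using x fin by simp
    finally show "f x = 0" by simp
  qed
  then have "dim (span B) = card B" by (simp add: dim_eq_card_independent)
  then show "card B = CARD('n)" unfolding sp dim_tangent_space[OF y] by (rule sym)
qed

text \<open>All traces below reduce to these sums. They follow from Parseval's identity applied to the unit
vector \<open>(0, 1)\<close> and to the spherical vector \<open>(proj y b, 0)\<close>, which are orthogonal; the total length
of the frame is its cardinality \<open>n\<close>.\<close>

lemma frame_sums:
  fixes y b :: "real^'n" and t :: real
  assumes y: "norm y = 1"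
  defines "B \<equiv> orthonormal_frame \<phi> (y, t)"
  shows "(\<Sum>e\<in>B. (snd e)\<^sup>2) = 1" "(\<Sum>e\<in>B. fst e \<bullet> fst e) = (real CARD('n) - 1) / (r t)\<^sup>2"
    "(\<Sum>e\<in>B. snd e * (b \<bullet> fst e)) = 0"
    "v \<in> tangent_space (y, t) \<Longrightarrow> (\<Sum>e\<in>B. (induced_metric \<phi> (y, t) v e)\<^sup>2) = induced_metric \<phi> (y, t) v v"
proof -
  note fr = frame[OF y, where t = t, folded B_def]
  let ?g = "induced_metric \<phi> (y, t)"
  have ex: "?g w x = (\<Sum>e\<in>B. ?g w e * ?g e x)" if "w \<in> tangent_space (y, t)" for w x
    using fr(1-3) that by (intro orthonormal_expansion[of ?g B w x] metric_linear[OF y]) auto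
  show sq: "(\<Sum>e\<in>B. (?g v e)\<^sup>2) = ?g v v" if "v \<in> tangent_space (y, t)" for v
  proof -
    have "?g v e * ?g e v = (?g v e)\<^sup>2" for e
      using metric_sym[of "(y, t)" e v] by (simp add: power2_eq_square)
    then show ?thesis using ex[OF that, of v] by simp
  qed
  have T: "(0, 1) \<in> tangent_space (y, t)" "(proj y b, 0) \<in> tangent_space (y, t)"
    using y by (auto simp: tangent_space_def proj_orthogonal)
  have p0: "proj y 0 = 0" by (simp add: proj_def)
  have g1: "?g (0, 1) e = snd e" for e using y by (simp add: metric p0)
  show s1: "(\<Sum>e\<in>B. (snd e)\<^sup>2) = 1" using sq[OF T(1)] by (simp add: g1)
  have g2: "?g e (proj y b, 0) = (r t)\<^sup>2 * (b \<bullet> fst e)" if "e \<in> B" for e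
  proof -
    have e: "e \<in> tangent_space (y, t)" using fr(4) that by blast
    then have "proj y b \<bullet> fst e = b \<bullet> fst e" by (simp add: proj_def tangent_space_def inner_diff_left inner_commute[of y])
    then show ?thesis using metric_tangent[OF y e T(2)] by (simp add: inner_commute)
  qed
  have "0 = (\<Sum>e\<in>B. ?g (0, 1) e * ?g e (proj y b, 0))"
    using ex[OF T(1), of "(proj y b, 0)"] by (simp add: g1)
  also have "\<dots> = (r t)\<^sup>2 * (\<Sum>e\<in>B. snd e * (b \<bullet> fst e))"
    unfolding sum_distrib_left by (intro sum.cong) (simp_all add: g1 g2)
  finally show "(\<Sum>e\<in>B. snd e * (b \<bullet> fst e)) = 0" using r_pos[of t] by simp
  have "real CARD('n) = (\<Sum>e\<in>B. ?g e e)" using fr(3,5) by simp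
  also have "\<dots> = (\<Sum>e\<in>B. (r t)\<^sup>2 * (fst e \<bullet> fst e) + (snd e)\<^sup>2)"
    using fr(4) by (intro sum.cong refl) (auto simp: metric_tangent[OF y] power2_eq_square)
  also have "\<dots> = (r t)\<^sup>2 * (\<Sum>e\<in>B. fst e \<bullet> fst e) + 1"
    by (simp add: sum.distrib sum_distrib_left s1)
  finally show "(\<Sum>e\<in>B. fst e \<bullet> fst e) = (real CARD('n) - 1) / (r t)\<^sup>2"
    using r_pos[of t] by (simp add: field_simps)
qed

lemma inner_fst_deriv:
  fixes b :: "real^'n" and p :: "(real^'n) \<times> real"
  shows "((\<lambda>q. b \<bullet> fst q) has_derivative (\<lambda>v. b \<bullet> fst v)) (at p)"
  by (rule has_derivative_inner_right[OF has_derivative_fst[OF has_derivative_ident]])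

lemma fst_deriv: "((\<lambda>q::(real^'n) \<times> real. fst q) has_derivative (\<lambda>v. fst v)) (at p)"
  by (rule has_derivative_fst[OF has_derivative_ident])

context
  fixes u u1 u2 :: "real \<Rightarrow> real" and a :: real and b :: "real^'n"
  assumes du: "(u has_real_derivative u1 t) (at t)" and du1: "(u1 has_real_derivative u2 t) (at t)"
begin

definition "height y = a + b \<bullet> y"
definition "separated = (\<lambda>(y, t). u t * height y)"

lemma height_deriv: "((\<lambda>q::(real^'n) \<times> real. height (fst q)) has_derivative (\<lambda>v. b \<bullet> fst v)) (at p)"
  unfolding height_def using has_derivative_add[OF has_derivative_const inner_fst_deriv, of a b p] by simp

lemma mderiv_separated:
  assumes "norm y = 1"
  shows "mderiv separated (y, t) v = u t * (b \<bullet> proj y (fst v)) + snd v * u1 t * height y"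
proof -
  let ?p = "(y, t)"
  have p: "?p \<in> cylinder" using assms by simp
  have e: "separated q = u (snd q) * height (fst q)" for q by (simp add: separated_def split_def)
  from mderiv_eqI[OF p e has_derivative_mult[OF snd_deriv[OF du] height_deriv], of v]
  show ?thesis by (simp add: proj_def)
qed

lemma inner_proj: "v \<bullet> y = 0 \<Longrightarrow> proj y b \<bullet> v = b \<bullet> v"
  using inner_commute[of v y] by (simp add: proj_def inner_diff_left)

lemma gradient_separated:
  assumes y: "norm y = 1"
  shows "gradient \<phi> separated (y, t) = ((u t / (r t)\<^sup>2) *\<^sub>R proj y b, u1 t * height y)" (is "_ = ?U")
  unfolding gradient_def
proof (rule the_equality)
  let ?T = "tangent_space (y, t)"
  have UT: "?U \<in> ?T" using proj_orthogonal(1)[OF y] by (simp add: tangent_space_def)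
  have eq: "induced_metric \<phi> (y, t) ?U v = mderiv separated (y, t) v" if v: "v \<in> ?T" for v
  proof -
    have vy: "fst v \<bullet> y = 0" using v by (simp add: tangent_space_def)
    show ?thesis using r_pos[of t]
      by (simp add: metric_tangent[OF y UT v] mderiv_separated[OF y] proj_tangent[OF vy] inner_proj[OF vy])
  qed
  show "?U \<in> ?T \<and> (\<forall>v\<in>?T. induced_metric \<phi> (y, t) ?U v = mderiv separated (y, t) v)"
    using UT eq by blast
  fix w assume w: "w \<in> ?T \<and> (\<forall>v\<in>?T. induced_metric \<phi> (y, t) w v = mderiv separated (y, t) v)"
  define d where "d = w - ?U"
  have dT: "d \<in> ?T" unfolding d_def using w UT by (intro subspace_diff tangent_space_subspace) auto
  have "induced_metric \<phi> (y, t) d d = 0"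
    using linear_diff[OF metric_linear[OF y, of t d], of w ?U] w eq[OF dT] dT by (simp add: d_def[symmetric])
  then have z: "(r t)\<^sup>2 * (fst d \<bullet> fst d) + (snd d)\<^sup>2 = 0"
    using metric_tangent[OF y dT dT] by (simp add: power2_eq_square)
  have "0 \<le> (r t)\<^sup>2 * (fst d \<bullet> fst d)" by simp
  with z have "(snd d)\<^sup>2 = 0" "(r t)\<^sup>2 * (fst d \<bullet> fst d) = 0"
    using zero_le_power2[of "snd d"] by linarith+
  then have "d = 0" using r_pos[of t] by (simp add: prod_eq_iff)
  then show "w = ?U" by (simp add: d_def)
qed

text \<open>The differential of the immersion applied to the gradient, written as the restriction of a smooth
function of the ambient variables, which can be differentiated.\<close>

lemma gradient_image:
  assumes "q \<in> cylinder"
  shows "mderiv \<phi> q (gradient \<phi> separated q) =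
    ((u (snd q) / r (snd q)) *\<^sub>R (b - (b \<bullet> fst q) *\<^sub>R fst q) + (u1 (snd q) * r1 (snd q) * height (fst q)) *\<^sub>R fst q,
      u1 (snd q) * C1 (snd q) * height (fst q), u1 (snd q) * S1 (snd q) * height (fst q))"
proof -
  obtain y t where q: "q = (y, t)" by (cases q)
  have y: "norm y = 1" using assms q by simp
  have e: "proj y ((u t / (r t)\<^sup>2) *\<^sub>R proj y b) = (u t / (r t)\<^sup>2) *\<^sub>R proj y b"
    by (rule proj_tangent) (simp add: proj_orthogonal(1)[OF y])
  show ?thesis using r_pos[of t]
    unfolding q gradient_separated[OF y] mderiv_\<phi>[OF y] fst_conv snd_conv e by (simp add: proj_def power2_eq_square mult_ac)
qed

text \<open>The first and the last term are the diagonal part; the sum of the off-diagonal term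
\<open>snd e * (b \<bullet> fst e)\<close> over a frame vanishes.\<close>

lemma divergence_term:
  assumes y: "norm y = 1" and e: "e \<in> tangent_space (y, t)"
  shows "mderiv (\<lambda>q. mderiv \<phi> q (gradient \<phi> separated q)) (y, t) e \<bullet> mderiv \<phi> (y, t) e =
     (fst e \<bullet> fst e) * (r t * r1 t * u1 t * height y - u t * (b \<bullet> y))
     + snd e * (b \<bullet> fst e) * (r t * ((u1 t * r t - u t * r1 t) / (r t * r t)) - u t / r t * r1 t + u1 t)
     + (snd e)\<^sup>2 * (u2 t * height y)"
proof -
  let ?p = "(y, t)"
  have p: "?p \<in> cylinder" using y by simp
  have dh: "((\<lambda>t. u t / r t) has_real_derivative (u1 t * r t - u t * r1 t) / (r t * r t)) (at t)" for t
    using DERIV_divide[OF du dr] r_pos[of t] by simp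
  have dk: "((\<lambda>t. u1 t * c t) has_real_derivative u1 t * c' + u2 t * c t) (at t)"
    if "(c has_real_derivative c') (at t)" for c c' t
    using DERIV_mult[OF du1 that] by (simp add: algebra_simps)
  note D = has_derivative_Pair[OF has_derivative_add[OF
      has_derivative_scaleR[OF snd_deriv[OF dh] has_derivative_diff[OF has_derivative_const
         has_derivative_scaleR[OF inner_fst_deriv fst_deriv]]]
      has_derivative_scaleR[OF has_derivative_mult[OF snd_deriv[OF dk[OF dr1]] height_deriv] fst_deriv]]
      has_derivative_Pair[OF has_derivative_mult[OF snd_deriv[OF dk[OF dC1]] height_deriv]
        has_derivative_mult[OF snd_deriv[OF dk[OF dS1]] height_deriv]]]
  have vy: "fst e \<bullet> y = 0" "y \<bullet> fst e = 0" using e by (simp_all add: tangent_space_def inner_commute)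
  have yy: "y \<bullet> y = 1" using y by (simp add: norm_eq_1)
  have yb: "y \<bullet> b = b \<bullet> y" "fst e \<bullet> b = b \<bullet> fst e" by (simp_all add: inner_commute)
  define h h' where "h = u t / r t" and "h' = (u1 t * r t - u t * r1 t) / (r t * r t)"
  have hr: "h * r t = u t" using r_pos[of t] by (simp add: h_def)
  have "mderiv (\<lambda>q. mderiv \<phi> q (gradient \<phi> separated q)) ?p e =
    ((h *\<^sub>R (- ((b \<bullet> y) *\<^sub>R fst e + (b \<bullet> fst e) *\<^sub>R y)) + (snd e * h') *\<^sub>R (b - (b \<bullet> y) *\<^sub>R y))
       + ((u1 t * r1 t * height y) *\<^sub>R fst e + (u1 t * r1 t * (b \<bullet> fst e) + snd e * (u1 t * r2 t + u2 t * r1 t) * height y) *\<^sub>R y),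
      u1 t * C1 t * (b \<bullet> fst e) + snd e * (u1 t * C2 t + u2 t * C1 t) * height y,
      u1 t * S1 t * (b \<bullet> fst e) + snd e * (u1 t * S2 t + u2 t * S1 t) * height y)"
    by (rule trans[OF mderiv_eqI[OF p gradient_image D]]) (simp_all add: vy h_def h'_def)
  moreover have "mderiv \<phi> ?p e = (r t *\<^sub>R fst e + (snd e * r1 t) *\<^sub>R y, snd e * C1 t, snd e * S1 t)"
    by (simp add: mderiv_\<phi>[OF y] proj_tangent[OF vy(1)])
  ultimately have "mderiv (\<lambda>q. mderiv \<phi> q (gradient \<phi> separated q)) ?p e \<bullet> mderiv \<phi> ?p e =
     (fst e \<bullet> fst e) * (r t * (u1 t * r1 t * height y) - (h * r t) * (b \<bullet> y))
     + snd e * (b \<bullet> fst e) * (r t * h' - h * r1 t + u1 t * ((r1 t)\<^sup>2 + (C1 t)\<^sup>2 + (S1 t)\<^sup>2))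
     + (snd e)\<^sup>2 * height y * (u2 t * ((r1 t)\<^sup>2 + (C1 t)\<^sup>2 + (S1 t)\<^sup>2) + u1 t * (r1 t * r2 t + C1 t * C2 t + S1 t * S2 t))"
    by (simp add: inner_add_left inner_add_right inner_diff_left inner_diff_right vy yy yb)
      (simp add: algebra_simps power2_eq_square)
  then show ?thesis unfolding hr unit_speed orthogonality by (simp add: h_def h'_def mult_ac)
qed

lemma laplacian_separated:
  assumes y: "norm y = 1"
  shows "laplacian \<phi> separated (y, t) =
    (real CARD('n) - 1) / (r t)\<^sup>2 * (r t * r1 t * u1 t * height y - u t * (b \<bullet> y)) + u2 t * height y"
proof -
  note fr = frame[OF y, where t = t] and s = frame_sums[OF y, where t = t]
  let ?B = "orthonormal_frame \<phi> (y, t)"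
  define c1 c2 c3 where "c1 = r t * r1 t * u1 t * height y - u t * (b \<bullet> y)"
    and "c2 = r t * ((u1 t * r t - u t * r1 t) / (r t * r t)) - u t / r t * r1 t + u1 t" and "c3 = u2 t * height y"
  have "laplacian \<phi> separated (y, t) = (\<Sum>e\<in>?B. (fst e \<bullet> fst e) * c1 + snd e * (b \<bullet> fst e) * c2 + (snd e)\<^sup>2 * c3)"
    unfolding laplacian_def divergence_def c1_def c2_def c3_def
    using fr(4) by (intro sum.cong refl divergence_term[OF y]) auto
  also have "\<dots> = (\<Sum>e\<in>?B. fst e \<bullet> fst e) * c1 + (\<Sum>e\<in>?B. snd e * (b \<bullet> fst e)) * c2 + (\<Sum>e\<in>?B. (snd e)\<^sup>2) * c3"
    by (simp add: sum.distrib sum_distrib_right)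
  finally show ?thesis unfolding s(1-3) by (simp add: c1_def c3_def)
qed

end

text \<open>A vector normal to the spherical directions is a multiple of \<open>y\<close> in its first component. What remains
is a vector of \<open>\<real>\<^sup>3\<close> orthogonal to the position and the velocity of the profile curve. The sign
\<open>\<epsilon>\<close> reflects the arbitrary choice of the normal.\<close>

lemma unit_normal_eq:
  fixes y :: "real^'n"
  assumes y: "norm y = 1"
  obtains \<epsilon> where "\<epsilon>\<^sup>2 = 1" "unit_normal \<phi> (y, t) =
     ((\<epsilon> * (C t * S1 t - S t * C1 t)) *\<^sub>R y, \<epsilon> * (S t * r1 t - r t * S1 t), \<epsilon> * (r t * C1 t - C t * r1 t))"
proof -
  let ?p = "(y, t)"
  let ?x1 = "C t * S1 t - S t * C1 t" and ?x2 = "S t * r1 t - r t * S1 t" and ?x3 = "r t * C1 t - C t * r1 t"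
  let ?Q = "\<lambda>\<nu>. norm \<nu> = 1 \<and> \<nu> \<bullet> \<phi> ?p = 0 \<and> (\<forall>v\<in>tangent_space ?p. \<nu> \<bullet> mderiv \<phi> ?p v = 0)"
  have yy: "y \<bullet> y = 1" using y by (simp add: norm_eq_1)
  have x: "?x1\<^sup>2 + ?x2\<^sup>2 + ?x3\<^sup>2 = 1"
  proof -
    have "(c * s' - s * c')\<^sup>2 + (s * q' - q * s')\<^sup>2 + (q * c' - c * q')\<^sup>2
      = (q\<^sup>2 + c\<^sup>2 + s\<^sup>2) * (q'\<^sup>2 + c'\<^sup>2 + s'\<^sup>2) - (q * q' + c * c' + s * s')\<^sup>2" for q c s q' c' s' :: real
      by algebra
    from this[of "C t" "S1 t" "S t" "C1 t" "r1 t" "r t"] show ?thesis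
      unfolding on_sphere unit_speed orthogonality by simp
  qed
  have d: "mderiv \<phi> ?p v = (r t *\<^sub>R fst v + (snd v * r1 t) *\<^sub>R y, snd v * C1 t, snd v * S1 t)" if "fst v \<bullet> y = 0" for v
    by (simp add: mderiv_\<phi>[OF y] proj_tangent[OF that])
  have "?Q (?x1 *\<^sub>R y, ?x2, ?x3)"
  proof (intro conjI ballI)
    have "(?x1 *\<^sub>R y, ?x2, ?x3) \<bullet> (?x1 *\<^sub>R y, ?x2, ?x3) = 1"
      using x by (simp add: yy power2_eq_square)
    then show "norm (?x1 *\<^sub>R y, ?x2, ?x3) = 1" by (simp add: norm_eq_1)
    show "(?x1 *\<^sub>R y, ?x2, ?x3) \<bullet> \<phi> ?p = 0" by (simp add: \<phi>_def yy algebra_simps)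
    fix v assume "v \<in> tangent_space ?p"
    then have v: "fst v \<bullet> y = 0" "y \<bullet> fst v = 0" by (simp_all add: tangent_space_def inner_commute)
    show "(?x1 *\<^sub>R y, ?x2, ?x3) \<bullet> mderiv \<phi> ?p v = 0"
      by (simp add: d[OF v(1)] inner_add_right yy v algebra_simps)
  qed
  then have ex: "\<exists>\<nu>. ?Q \<nu>" by blast
  define \<nu> where "\<nu> = unit_normal \<phi> ?p"
  have Q: "?Q \<nu>" unfolding \<nu>_def unit_normal_def by (rule someI_ex[OF ex])
  obtain w c s where \<nu>: "\<nu> = (w, c, s)" by (cases \<nu>)
  define k where "k = w \<bullet> y"
  have w: "w = k *\<^sub>R y"
  proof -
    let ?v = "w - k *\<^sub>R y"
    have v: "?v \<bullet> y = 0" by (simp add: inner_diff_left yy k_def)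
    then have "\<nu> \<bullet> mderiv \<phi> ?p (?v, 0) = 0" using Q by (simp add: tangent_space_def)
    then have "r t * (w \<bullet> ?v) = 0" unfolding \<nu> by (subst (asm) d) (simp_all add: v)
    then have "w \<bullet> ?v = 0" using r_pos[of t] by simp
    moreover have "?v \<bullet> ?v = w \<bullet> ?v - k * (?v \<bullet> y)" by (simp add: inner_diff_left inner_diff_right inner_commute[of y w])
    ultimately have "?v \<bullet> ?v = 0" using v by simp
    then show ?thesis by simp
  qed
  have "r t * k + C t * c + S t * s = 0"
    using Q by (simp add: \<nu> w \<phi>_def yy mult_ac)
  moreover have "r1 t * k + C1 t * c + S1 t * s = 0"
  proof -
    have "\<nu> \<bullet> mderiv \<phi> ?p (0, 1) = 0" using Q by (simp add: tangent_space_def)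
    then show ?thesis unfolding \<nu> by (subst (asm) d) (simp_all add: w yy mult_ac)
  qed
  moreover have "k\<^sup>2 + c\<^sup>2 + s\<^sup>2 = 1"
  proof -
    have "\<nu> \<bullet> \<nu> = 1" using Q by (simp add: norm_eq_1)
    then show ?thesis by (simp add: \<nu> w yy power2_eq_square)
  qed
  ultimately obtain \<epsilon> where "\<epsilon>\<^sup>2 = 1" "k = \<epsilon> * ?x1" "c = \<epsilon> * ?x2" "s = \<epsilon> * ?x3"
    using orthogonal_to_two_is_cross_multiple[of "r t" k "C t" c "S t" s "r1 t" "C1 t" "S1 t"] x by blast
  then show thesis using that[of \<epsilon>] by (simp add: \<nu> w flip: \<nu>_def)
qed

text \<open>Only the square is independent of the choice of the normal.\<close>

lemma second_fundamental_form_sq: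
  fixes y :: "real^'n"
  assumes y: "norm y = 1" and v: "v \<in> tangent_space (y, t)" and w: "w \<in> tangent_space (y, t)"
  shows "(second_fundamental_form \<phi> (y, t) w v)\<^sup>2 = ((r t)\<^sup>2 * lam t * (fst v \<bullet> fst w) + mu t * (snd v * snd w))\<^sup>2"
proof -
  let ?p = "(y, t)"
  have p: "?p \<in> cylinder" using y by simp
  have e: "mderiv \<phi> q v = (r (snd q) *\<^sub>R (fst v - (fst v \<bullet> fst q) *\<^sub>R fst q) + (snd v * r1 (snd q)) *\<^sub>R fst q,
      snd v * C1 (snd q), snd v * S1 (snd q))" if "q \<in> cylinder" for q
  proof (cases q)
    case (Pair y' t')
    with that have "norm y' = 1" by simp
    from mderiv_\<phi>[OF this] show ?thesis unfolding Pair by (simp add: proj_def)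
  qed
  have dk: "((\<lambda>t. snd v * c t) has_real_derivative snd v * c') (at t)"
    if "(c has_real_derivative c') (at t)" for c c' t
    using DERIV_cmult[OF that] by simp
  note D = has_derivative_Pair[OF has_derivative_add[OF
      has_derivative_scaleR[OF snd_deriv[OF dr] has_derivative_diff[OF has_derivative_const
         has_derivative_scaleR[OF inner_fst_deriv fst_deriv]]]
      has_derivative_scaleR[OF snd_deriv[OF dk[OF dr1]] fst_deriv]]
      has_derivative_Pair[OF snd_deriv[OF dk[OF dC1]] snd_deriv[OF dk[OF dS1]]]]
  have vy: "fst v \<bullet> y = 0" "y \<bullet> fst v = 0" "fst w \<bullet> y = 0" "y \<bullet> fst w = 0"
    using v w by (simp_all add: tangent_space_def inner_commute)
  have yy: "y \<bullet> y = 1" using y by (simp add: norm_eq_1)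
  have d: "mderiv (\<lambda>q. mderiv \<phi> q v) ?p w =
    ((r t *\<^sub>R (- ((fst v \<bullet> fst w) *\<^sub>R y)) + (snd w * r1 t) *\<^sub>R fst v)
       + ((snd v * r1 t) *\<^sub>R fst w + (snd w * (snd v * r2 t)) *\<^sub>R y),
      snd w * (snd v * C2 t), snd w * (snd v * S2 t))"
    by (rule trans[OF mderiv_eqI[OF p e D]]) (simp_all add: vy)
  obtain \<epsilon> where \<epsilon>: "\<epsilon>\<^sup>2 = 1" "unit_normal \<phi> ?p =
     ((\<epsilon> * (C t * S1 t - S t * C1 t)) *\<^sub>R y, \<epsilon> * (S t * r1 t - r t * S1 t), \<epsilon> * (r t * C1 t - C t * r1 t))"
    using unit_normal_eq[OF y] by blast
  have "second_fundamental_form \<phi> ?p w v =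
     \<epsilon> * (- (r t * (C t * S1 t - S t * C1 t) * (fst v \<bullet> fst w)) + snd v * snd w *
      (r2 t * (C t * S1 t - S t * C1 t) + C2 t * (S t * r1 t - r t * S1 t) + S2 t * (r t * C1 t - C t * r1 t)))"
    unfolding second_fundamental_form_def d \<epsilon>(2) by (simp add: inner_add_left vy yy algebra_simps)
  also have "\<dots> = - \<epsilon> * ((r t)\<^sup>2 * lam t * (fst v \<bullet> fst w) + mu t * (snd v * snd w))"
    unfolding normal_curvature unfolding normal_radial by (simp add: algebra_simps power2_eq_square)
  finally show ?thesis by (simp add: power_mult_distrib \<epsilon>)
qed

text \<open>Up to sign, the second fundamental form is \<open>g(A v, w)\<close> for the shape operator \<open>A\<close> with eigenvalues \<open>lam\<close> and
\<open>mu\<close>. Parseval's identity evaluates the sum over \<open>w\<close>, and the frame sums the one over \<open>v\<close>.\<close>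

lemma sq_norm_second_fundamental_form_eq:
  fixes y :: "real^'n"
  assumes y: "norm y = 1"
  shows "sq_norm_second_fundamental_form \<phi> (y, t) = (real CARD('n) - 1) * (lam t)\<^sup>2 + (mu t)\<^sup>2"
proof -
  note fr = frame[OF y, where t = t] and s = frame_sums[OF y, where t = t]
  let ?B = "orthonormal_frame \<phi> (y, t)"
  let ?A = "\<lambda>v::(real^'n) \<times> real. (lam t *\<^sub>R fst v, mu t * snd v)"
  have row: "(\<Sum>w\<in>?B. (second_fundamental_form \<phi> (y, t) v w)\<^sup>2)
     = (lam t)\<^sup>2 * (r t)\<^sup>2 * (fst v \<bullet> fst v) + (mu t)\<^sup>2 * (snd v)\<^sup>2" if v: "v \<in> ?B" for v
  proof -
    have vT: "v \<in> tangent_space (y, t)" using fr(4) v by blast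
    have AT: "?A v \<in> tangent_space (y, t)" using vT by (simp add: tangent_space_def)
    have "(\<Sum>w\<in>?B. (second_fundamental_form \<phi> (y, t) v w)\<^sup>2) = (\<Sum>w\<in>?B. (induced_metric \<phi> (y, t) (?A v) w)\<^sup>2)"
    proof (intro sum.cong refl)
      fix w assume "w \<in> ?B"
      then have wT: "w \<in> tangent_space (y, t)" using fr(4) by blast
      show "(second_fundamental_form \<phi> (y, t) v w)\<^sup>2 = (induced_metric \<phi> (y, t) (?A v) w)\<^sup>2"
        unfolding second_fundamental_form_sq[OF y wT vT] metric_tangent[OF y AT wT]
        by (simp add: inner_commute mult_ac)
    qed
    also have "\<dots> = induced_metric \<phi> (y, t) (?A v) (?A v)" by (rule s(4)[OF AT])
    also have "\<dots> = (lam t)\<^sup>2 * (r t)\<^sup>2 * (fst v \<bullet> fst v) + (mu t)\<^sup>2 * (snd v)\<^sup>2"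
      unfolding metric_tangent[OF y AT AT] by (simp add: power2_eq_square mult_ac)
    finally show ?thesis .
  qed
  have "sq_norm_second_fundamental_form \<phi> (y, t) = (\<Sum>v\<in>?B. (lam t)\<^sup>2 * (r t)\<^sup>2 * (fst v \<bullet> fst v) + (mu t)\<^sup>2 * (snd v)\<^sup>2)"
    unfolding sq_norm_second_fundamental_form_def by (intro sum.cong refl row)
  also have "\<dots> = (lam t)\<^sup>2 * (r t)\<^sup>2 * (\<Sum>v\<in>?B. fst v \<bullet> fst v) + (mu t)\<^sup>2 * (\<Sum>v\<in>?B. (snd v)\<^sup>2)"
    by (simp add: sum.distrib sum_distrib_left)
  finally show ?thesis using r_pos[of t] unfolding s(1,2) by simp
qed

text \<open>Constant and linear functions on the sphere are eigenfunctions of its Laplacian with the eigenvalues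
\<open>0\<close> and \<open>n - 1\<close>; the last term is the contribution of the latter.\<close>

theorem jacobi_operator_separated:
  fixes b :: "real^'n"
  assumes du: "\<And>t. (u has_real_derivative u1 t) (at t)" and du1: "\<And>t. (u1 has_real_derivative u2 t) (at t)"
    and y: "norm y = 1"
  shows "jacobi_operator \<phi> (\<lambda>(y, t). u t * (a + b \<bullet> y)) (y, t) =
    - (u2 t + (real CARD('n) - 1) * (r1 t / r t) * u1 t
        + (real CARD('n) + (real CARD('n) - 1) * (lam t)\<^sup>2 + (mu t)\<^sup>2) * u t) * (a + b \<bullet> y)
    + (real CARD('n) - 1) / (r t)\<^sup>2 * u t * (b \<bullet> y)"
proof -
  define g where "g = a + b \<bullet> y"
  define N where "N = real CARD('n) - 1"
  have e: "N / (r t)\<^sup>2 * (r t * r1 t * u1 t * g - u t * (b \<bullet> y)) = N * (r1 t / r t) * u1 t * g - N / (r t)\<^sup>2 * u t * (b \<bullet> y)"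
    using r_pos[of t] by (simp add: field_simps power2_eq_square)
  have "laplacian \<phi> (\<lambda>(y, t). u t * (a + b \<bullet> y)) (y, t) = N * (r1 t / r t) * u1 t * g - N / (r t)\<^sup>2 * u t * (b \<bullet> y) + u2 t * g"
    using laplacian_separated[of u u1 u2 y a b t, OF du du1 y]
    unfolding separated_def[OF du du1] height_def[OF du du1] e[symmetric] by (simp add: g_def N_def)
  then show ?thesis
    unfolding jacobi_operator_def sq_norm_second_fundamental_form_eq[OF y] g_def[symmetric] N_def[symmetric]
    by (simp add: algebra_simps g_def)
qed

end

section \<open>The profile curve of a rotational hypersurface of constant mean curvature\<close>

locale rotational_profile =
  fixes n :: nat and H c T :: real and r :: "real \<Rightarrow> real"
  assumes n: "n \<ge> 2" and c_pos: "c > 0" and r_smooth: "\<And>k. Ck_on k r UNIV"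
    and r_range: "0 < r t" "r t < 1" and r_nonconst: "\<not> r constant_on UNIV"
    and T_pos: "T > 0" and r_periodic: "r (t + T) = r t"
    and r_ode: "(deriv r t)\<^sup>2 + (r t)\<^sup>2 * (1 + (rot_lambda n H c r t)\<^sup>2) = 1"
begin

definition "r1 = deriv r"
text \<open>The deviation of the principal curvature \<open>lam\<close> from the mean curvature.\<close>

definition "D t = c powr (- real n / 2) * inverse (r t) ^ n"
definition "lam t = H + D t"
definition "mu t = lam t - real n * D t"

lemma rot_lambda_eq: "rot_lambda n H c r t = lam t"
  using r_range(1)[of t] by (simp add: rot_lambda_def lam_def D_def powr_minus powr_realpow power_inverse)

lemma dr: "(r has_real_derivative r1 t) (at t)" and r1_smooth: "Ck_on k r1 UNIV"
  unfolding r1_def using Ck_on_real_SucD[OF r_smooth[of "Suc k"]] by auto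

lemma D_pos: "D t > 0"
  using r_range(1)[of t] c_pos by (simp add: D_def)

lemma dD: "(D has_real_derivative - (real n * D t * (r1 t / r t))) (at t)"
proof -
  have "((\<lambda>t. inverse (r t) ^ n) has_real_derivative - (real n * inverse (r t) ^ n * (r1 t / r t))) (at t)"
  proof -
    have "((\<lambda>t. inverse (r t)) has_real_derivative - (inverse (r t) * r1 t * inverse (r t))) (at t)"
      by (rule DERIV_inverse'[OF dr]) (use r_range(1)[of t] in simp)
    from DERIV_power[OF this, of n] n
    show ?thesis by (cases n) (auto simp: field_simps)
  qed
  from DERIV_cmult[OF this, of "c powr (- real n / 2)"] show ?thesis
    unfolding D_def[abs_def] by (simp add: mult_ac)
qed

lemma dlam: "(lam has_real_derivative (mu t - lam t) * (r1 t / r t)) (at t)"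
  unfolding lam_def[abs_def] mu_def by (rule DERIV_cong[OF DERIV_add[OF DERIV_const dD]]) simp

lemma dmu: "(mu has_real_derivative (real n - 1) * (lam t - mu t) * (r1 t / r t)) (at t)"
proof -
  have "(mu has_real_derivative (mu t - lam t) * (r1 t / r t) - real n * - (real n * D t * (r1 t / r t))) (at t)"
    unfolding mu_def[abs_def] using DERIV_diff[OF dlam DERIV_cmult[OF dD]] by (simp add: mu_def)
  then show ?thesis by (rule DERIV_cong) (simp add: mu_def algebra_simps)
qed

lemma ode: "(r1 t)\<^sup>2 + (r t)\<^sup>2 * (1 + (lam t)\<^sup>2) = 1"
  using r_ode[of t] by (simp add: r1_def rot_lambda_eq)

text \<open>Differentiating the first integral yields \<open>E r' = 0\<close> for the defect \<open>E = r'' + r (1 + lam mu)\<close>, but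
says nothing where \<open>r' = 0\<close>. Where \<open>E\<close> does not vanish, \<open>r' = 0\<close> in a neighbourhood, hence \<open>E' = 0\<close>. So
\<open>E\<^sup>2\<close> has derivative \<open>2 E E' = 0\<close> everywhere and is constant. If the constant were not zero, \<open>r\<close> would
be constant.\<close>

lemma dr1: "(r1 has_real_derivative - (r t * (1 + lam t * mu t))) (at t)"
proof -
  define r2 r3 where "r2 = deriv r1" and "r3 = deriv r2"
  have d2: "(r1 has_real_derivative r2 t) (at t)" for t
    unfolding r2_def using Ck_on_real_SucD(1)[OF r1_smooth[of "Suc 0"]] .
  have "Ck_on 1 r2 UNIV" unfolding r2_def using Ck_on_real_SucD(2)[OF r1_smooth[of "Suc 1"]] .
  then have d3: "(r2 has_real_derivative r3 t) (at t)" for t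
    unfolding r3_def using Ck_on_real_SucD(1)[of 0 r2] by simp
  define E where "E t = r2 t + r t * (1 + lam t * mu t)" for t
  have Er: "E t * r1 t = 0" for t
  proof -
    have "((\<lambda>t. (r1 t)\<^sup>2 + (r t)\<^sup>2 * (1 + (lam t)\<^sup>2)) has_real_derivative
       2 * r1 t * r2 t + (2 * r t * r1 t * (1 + (lam t)\<^sup>2) + (r t)\<^sup>2 * (2 * lam t * ((mu t - lam t) * (r1 t / r t))))) (at t)"
      by (auto intro!: derivative_eq_intros dr d2 dlam simp: algebra_simps)
    moreover have "((\<lambda>t. (r1 t)\<^sup>2 + (r t)\<^sup>2 * (1 + (lam t)\<^sup>2)) has_real_derivative 0) (at t)" by (simp add: ode)
    ultimately have "2 * r1 t * r2 t + (2 * r t * r1 t * (1 + (lam t)\<^sup>2) + (r t)\<^sup>2 * (2 * lam t * ((mu t - lam t) * (r1 t / r t)))) = 0"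
      by (rule DERIV_unique)
    moreover have "(r t)\<^sup>2 * (2 * lam t * ((mu t - lam t) * (r1 t / r t))) = 2 * r t * lam t * (mu t - lam t) * r1 t"
      using r_range(1)[of t] by (simp add: power2_eq_square)
    ultimately show ?thesis unfolding E_def by (simp add: algebra_simps power2_eq_square)
  qed
  define E' where "E' t = r3 t + (r1 t * (1 + lam t * mu t) + r t * ((mu t - lam t) * (r1 t / r t) * mu t
      + lam t * ((real n - 1) * (lam t - mu t) * (r1 t / r t))))" for t
  have dE: "(E has_real_derivative E' t) (at t)" for t
    unfolding E_def[abs_def] E'_def by (auto intro!: derivative_eq_intros dr d3 dlam dmu simp: algebra_simps)
  have EE: "E t * E' t = 0" for t
  proof (cases "E t = 0")
    case False
    \<comment> \<open>on this open set \<open>r1\<close> vanishes, hence so do its derivatives\<close>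
    define U where "U = {t. E t \<noteq> 0}"
    have U: "open U" unfolding U_def
      by (intro open_Collect_neq differentiable_imp_continuous_on[OF dE] continuous_intros)
    have z1: "r1 s = 0" if "s \<in> U" for s using Er[of s] that by (simp add: U_def)
    have loc: "h' = 0" if "(h has_real_derivative h') (at s)" "s \<in> U" "\<And>s. s \<in> U \<Longrightarrow> h s = 0" for h h' s
    proof -
      have "(h has_real_derivative 0) (at s)"
        by (rule has_field_derivative_transform_within_open[OF DERIV_const U that(2)]) (use that(3) in simp)
      with that(1) show ?thesis by (rule DERIV_unique)
    qed
    have z2: "r2 s = 0" if "s \<in> U" for s by (rule loc[OF d2 that z1])
    have "r3 t = 0" by (rule loc[OF d3 _ z2]) (use False in \<open>auto simp: U_def\<close>)
    then show ?thesis using z1[of t] False by (simp add: E'_def U_def)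
  qed simp
  have "((\<lambda>t. (E t)\<^sup>2) has_real_derivative 0) (at t)" for t
    by (rule DERIV_cong[OF DERIV_power[OF dE, where n = 2]]) (use EE[of t] in auto)
  then have const: "(E t)\<^sup>2 = (E s)\<^sup>2" for t s by (intro DERIV_isconst_all) auto
  have "E t = 0"
  proof (rule ccontr)
    assume "E t \<noteq> 0"
    then have "E s \<noteq> 0" for s using const[of s t] by auto
    then have "r1 s = 0" for s using Er[of s] by simp
    then have "r x = r 0" for x using dr by (intro DERIV_isconst_all) auto
    then have "r constant_on UNIV" unfolding constant_on_def by blast
    then show False using r_nonconst by blast
  qed
  then have "r2 t = - (r t * (1 + lam t * mu t))" unfolding E_def by linarith
  with d2[of t] show ?thesis by simp
qed

lemma r1_periodic: "r1 (t + T) = r1 t"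
  by (rule periodic_derivative[OF dr r_periodic])

lemma curvatures_periodic: "lam (t + T) = lam t" "mu (t + T) = mu t"
  by (simp_all add: lam_def mu_def D_def r_periodic)

lemma s_pos: "1 - (r t)\<^sup>2 > 0"
  using r_range[of t] by (simp add: abs_square_less_1)

definition "s t = sqrt (1 - (r t)\<^sup>2)"
definition "th t = rot_theta n H c r t"

lemma s: "s t > 0" "(s t)\<^sup>2 = 1 - (r t)\<^sup>2"
  using s_pos[of t] by (simp_all add: s_def)

lemma continuous: "continuous_on A r" "continuous_on A r1" "continuous_on A lam" "continuous_on A mu"
  using differentiable_imp_continuous_on[OF dr] differentiable_imp_continuous_on[OF dr1]
    differentiable_imp_continuous_on[OF dlam] differentiable_imp_continuous_on[OF dmu] by auto

lemma dth: "(th has_real_derivative r t * lam t / (s t)\<^sup>2) (at t)"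
proof -
  let ?g = "\<lambda>\<tau>. r \<tau> * rot_lambda n H c r \<tau> / (1 - (r \<tau>)\<^sup>2)"
  have g: "continuous_on A ?g" for A
    unfolding rot_lambda_eq using s_pos by (intro continuous_intros continuous) (metis less_irrefl)
  obtain F where F: "F 0 = 0" "\<And>t. (F has_real_derivative ?g t) (at t)"
    using antiderivative_exists[OF g] by blast
  have "th t = F t" for t
  proof -
    have "(LBINT \<tau>=ereal 0..ereal t. ?g \<tau>) = F t - F 0"
      by (rule interval_integral_FTC_finite[OF g])
        (use F(2) in \<open>auto simp: has_real_derivative_iff_has_vector_derivative intro: has_vector_derivative_at_within\<close>)
    then show ?thesis by (simp add: th_def rot_theta_def F(1) zero_ereal_def)
  qed
  then have "th = F" by blast
  then show ?thesis using F(2)[of t] by (simp add: rot_lambda_eq s)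
qed

lemma ds: "(s has_real_derivative - (r t * r1 t) / s t) (at t)"
  unfolding s_def[abs_def] using s_pos[of t]
  by (auto intro!: derivative_eq_intros dr simp: field_simps)

definition "C t = s t * cos (th t)"
definition "S t = s t * sin (th t)"
definition "C1 t = - (r t * r1 t * cos (th t) + r t * lam t * sin (th t)) / s t"
definition "S1 t = (r t * lam t * cos (th t) - r t * r1 t * sin (th t)) / s t"
text \<open>The last two components of the unit normal of the profile curve are \<open>NC\<close> and \<open>NS\<close>; the first one is
\<open>r lam\<close>.\<close>

definition "NC t = (r1 t * sin (th t) - (r t)\<^sup>2 * lam t * cos (th t)) / s t"
definition "NS t = - (r1 t * cos (th t) + (r t)\<^sup>2 * lam t * sin (th t)) / s t"

lemma dC: "(C has_real_derivative C1 t) (at t)"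
proof -
  have "(C has_real_derivative - (r t * r1 t) / s t * cos (th t) + s t * (- sin (th t) * (r t * lam t / (s t)\<^sup>2))) (at t)"
    unfolding C_def[abs_def] by (auto intro!: derivative_eq_intros ds dth)
  then show ?thesis by (rule DERIV_cong) (use s(1)[of t] in \<open>simp add: C1_def field_simps power2_eq_square\<close>)
qed

lemma dS: "(S has_real_derivative S1 t) (at t)"
proof -
  have "(S has_real_derivative - (r t * r1 t) / s t * sin (th t) + s t * (cos (th t) * (r t * lam t / (s t)\<^sup>2))) (at t)"
    unfolding S_def[abs_def] by (auto intro!: derivative_eq_intros ds dth)
  then show ?thesis by (rule DERIV_cong) (use s(1)[of t] in \<open>simp add: S1_def field_simps power2_eq_square\<close>)
qed

lemma drlam: "((\<lambda>t. r t * lam t) has_real_derivative mu t * r1 t) (at t)"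
  by (rule DERIV_cong[OF DERIV_mult[OF dr dlam]]) (use r_range(1)[of t] in \<open>simp add: field_simps\<close>)

text \<open>The quotient rule for \<open>C1\<close> or \<open>S1\<close>, as an identity in free variables: \<open>q\<close> and \<open>q'\<close> are \<open>r\<close> and its
derivative, \<open>l\<close> and \<open>m'\<close> the curvatures, and \<open>cs\<close>, \<open>sn\<close> the cosine and sine of the angle or, for
\<open>S1\<close>, the sine and minus the cosine. Both sides are linear in \<open>cs\<close> and \<open>sn\<close>, so the identity holds for
all values of these.\<close>

lemma second_derivative_identity:
  fixes q q' l m' s cs sn :: real
  assumes "s > 0" "s\<^sup>2 = 1 - q\<^sup>2" "q'\<^sup>2 + q\<^sup>2 * (1 + l\<^sup>2) = 1"
  shows "(- ((q' * q' - q * (q * (1 + l * m'))) * cs - q * q' * sn * (q * l / s\<^sup>2) + (m' * q' * sn + q * l * cs * (q * l / s\<^sup>2))) * s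
      - - (q * q' * cs + q * l * sn) * (- (q * q') / s)) / (s * s)
    = - (s * cs) - m' * ((q' * sn - q\<^sup>2 * l * cs) / s)"
proof -
  have s0: "s \<noteq> 0" using assms by simp
  define W Y Z where "W = q * l / s\<^sup>2" and "Y = - (q * q') / s" and "Z = (q' * sn - q\<^sup>2 * l * cs) / s"
  have "W * s\<^sup>2 = q * l" "Y * s = - (q * q')" "Z * s = q' * sn - q\<^sup>2 * l * cs"
    using s0 by (simp_all add: W_def Y_def Z_def)
  then have "(- ((q' * q' - q * (q * (1 + l * m'))) * cs - q * q' * sn * W + (m' * q' * sn + q * l * cs * W)) * s
      - - (q * q' * cs + q * l * sn) * Y) * s = (- (s * cs) - m' * Z) * (s * s) * s"
    using assms(2,3) by algebra
  then show ?thesis unfolding W_def[symmetric] Y_def[symmetric] Z_def[symmetric] using s0 by (simp add: nonzero_divide_eq_eq)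
qed

lemma dcos_th: "((\<lambda>t. cos (th t)) has_real_derivative - sin (th t) * (r t * lam t / (s t)\<^sup>2)) (at t)"
  and dsin_th: "((\<lambda>t. sin (th t)) has_real_derivative cos (th t) * (r t * lam t / (s t)\<^sup>2)) (at t)"
  by (rule DERIV_fun_cos[OF dth] DERIV_fun_sin[OF dth])+

lemma dC1: "(C1 has_real_derivative - C t - mu t * NC t) (at t)"
proof -
  have a: "((\<lambda>t. r t * r1 t) has_real_derivative r1 t * r1 t - r t * (r t * (1 + lam t * mu t))) (at t)"
    by (rule DERIV_cong[OF DERIV_mult[OF dr dr1]]) simp
  have "((\<lambda>t. - (r t * r1 t * cos (th t) + r t * lam t * sin (th t))) has_real_derivative
    - ((r1 t * r1 t - r t * (r t * (1 + lam t * mu t))) * cos (th t) - r t * r1 t * sin (th t) * (r t * lam t / (s t)\<^sup>2)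
      + (mu t * r1 t * sin (th t) + r t * lam t * cos (th t) * (r t * lam t / (s t)\<^sup>2)))) (at t)"
    by (rule DERIV_cong[OF DERIV_minus[OF DERIV_add[OF DERIV_mult[OF a dcos_th] DERIV_mult[OF drlam dsin_th]]]]) (simp add: algebra_simps)
  from DERIV_divide[OF this ds] s(1)[of t]
  show ?thesis unfolding C1_def[abs_def] C_def NC_def
    second_derivative_identity[OF s(1) s(2) ode, symmetric] by simp
qed

lemma dS1: "(S1 has_real_derivative - S t - mu t * NS t) (at t)"
proof -
  have a: "((\<lambda>t. r t * r1 t) has_real_derivative r1 t * r1 t - r t * (r t * (1 + lam t * mu t))) (at t)"
    by (rule DERIV_cong[OF DERIV_mult[OF dr dr1]]) simp
  have "((\<lambda>t. - (r t * r1 t * sin (th t) + r t * lam t * - cos (th t))) has_real_derivative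
    - ((r1 t * r1 t - r t * (r t * (1 + lam t * mu t))) * sin (th t) - r t * r1 t * - cos (th t) * (r t * lam t / (s t)\<^sup>2)
      + (mu t * r1 t * - cos (th t) + r t * lam t * sin (th t) * (r t * lam t / (s t)\<^sup>2)))) (at t)"
    by (rule DERIV_cong[OF DERIV_minus[OF DERIV_add[OF DERIV_mult[OF a dsin_th] DERIV_mult[OF drlam DERIV_minus[OF dcos_th]]]]]) (simp add: algebra_simps)
  from DERIV_divide[OF this ds] s(1)[of t]
  have "((\<lambda>t. - (r t * r1 t * sin (th t) + r t * lam t * - cos (th t)) / s t) has_real_derivative
      - (s t * sin (th t)) - mu t * ((r1 t * - cos (th t) - (r t)\<^sup>2 * lam t * sin (th t)) / s t)) (at t)"
    unfolding second_derivative_identity[OF s(1) s(2) ode, symmetric] by simp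
  then show ?thesis unfolding S1_def[abs_def] S_def NS_def by simp
qed

sublocale spherical_curve r C S r1 C1 S1 "\<lambda>t. - (r t * (1 + lam t * mu t))" "\<lambda>t. - C t - mu t * NC t" "\<lambda>t. - S t - mu t * NS t" lam mu
proof
  fix t
  define cs sn where "cs = cos (th t)" and "sn = sin (th t)"
  have sc: "sn\<^sup>2 + cs\<^sup>2 = 1" by (simp add: cs_def sn_def)
  note defs = C_def S_def C1_def S1_def NC_def NS_def cs_def[symmetric] sn_def[symmetric]
  have s0: "s t \<noteq> 0" using s(1)[of t] by simp
  show "(r t)\<^sup>2 + (C t)\<^sup>2 + (S t)\<^sup>2 = 1"
    unfolding defs using sc s(2)[of t] by algebra
  have C1': "C1 t * s t = - (r t * r1 t * cs + r t * lam t * sn)" "S1 t * s t = r t * lam t * cs - r t * r1 t * sn"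
    and N': "NC t * s t = r1 t * sn - (r t)\<^sup>2 * lam t * cs" "NS t * s t = - (r1 t * cs + (r t)\<^sup>2 * lam t * sn)"
    and CS': "C t = s t * cs" "S t = s t * sn"
    unfolding defs using s0 by simp_all
  have "((r1 t)\<^sup>2 + (C1 t)\<^sup>2 + (S1 t)\<^sup>2) * (s t)\<^sup>2 = 1 * (s t)\<^sup>2"
    using C1' sc s(2)[of t] ode[of t] by algebra
  then show us: "(r1 t)\<^sup>2 + (C1 t)\<^sup>2 + (S1 t)\<^sup>2 = 1" using s0 by simp
  have "(C t * S1 t - S t * C1 t) = cs * (S1 t * s t) - sn * (C1 t * s t)" unfolding CS' by (simp add: algebra_simps)
  also have "\<dots> = r t * lam t" unfolding C1' using sc by algebra
  finally show nr: "C t * S1 t - S t * C1 t = r t * lam t" .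
  have "(S t * r1 t - r t * S1 t) * s t = NC t * s t" "(r t * C1 t - C t * r1 t) * s t = NS t * s t"
    using C1' N' CS' s(2)[of t] by algebra+
  then have N: "S t * r1 t - r t * S1 t = NC t" "r t * C1 t - C t * r1 t = NS t" using s0 by simp_all
  have "C t * NC t + S t * NS t = cs * (NC t * s t) + sn * (NS t * s t)" unfolding CS' by (simp add: algebra_simps)
  also have "\<dots> = - ((r t)\<^sup>2 * lam t)" unfolding N' using sc by algebra
  finally have CN: "C t * NC t + S t * NS t = - ((r t)\<^sup>2 * lam t)" .
  have "((r t * lam t)\<^sup>2 + (NC t)\<^sup>2 + (NS t)\<^sup>2) * (s t)\<^sup>2 = 1 * (s t)\<^sup>2"
    using N' sc s(2)[of t] ode[of t] by algebra
  then have NN: "(r t * lam t)\<^sup>2 + (NC t)\<^sup>2 + (NS t)\<^sup>2 = 1" using s0 by simp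
  show "- (r t * (1 + lam t * mu t)) * (C t * S1 t - S t * C1 t) + (- C t - mu t * NC t) * (S t * r1 t - r t * S1 t)
       + (- S t - mu t * NS t) * (r t * C1 t - C t * r1 t) = - mu t"
    unfolding nr N using CN NN by algebra
qed (auto intro: dr dC dS dr1 dC1 dS1 r_range)

lemma immersion_eq:
  assumes "n = CARD('n::finite)"
  shows "(rot_immersion H c r :: (real^'n) \<times> real \<Rightarrow> _) = \<phi>"
  by (simp add: rot_immersion_def \<phi>_def fun_eq_iff C_def S_def s_def th_def flip: assms)

end

section \<open>Jacobi fields induced by rotations\<close>

context rotational_profile
begin

definition "p t = r t ^ (n - 1)"
text \<open>For \<open>e = 0\<close> the potential of the Jacobi operator on functions of \<open>t\<close>, for \<open>e = 1\<close> the one on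
functions \<open>u(t) y\<^sub>i\<close>.\<close>

definition "V e t = e * (real n - 1) / (r t)\<^sup>2 - (real n + (real n - 1) * (lam t)\<^sup>2 + (mu t)\<^sup>2)" for e :: real

lemma p_pos: "p t > 0"
  using r_range(1)[of t] by (simp add: p_def)

lemma dp: "(p has_real_derivative (real n - 1) * (r1 t / r t) * p t) (at t)"
proof -
  obtain k where k: "n - 1 = Suc k" using n by (cases "n - 1") auto
  have "real n - 1 = real (Suc k)" using k n by (simp add: of_nat_diff flip: k)
  then show ?thesis unfolding p_def[abs_def] k
    by (intro DERIV_cong[OF DERIV_power[OF dr]]) (use r_range(1)[of t] in \<open>simp add: field_simps\<close>)
qed

lemma sturm_liouville_multiple_period:
  assumes "k \<ge> 1"
  shows "sturm_liouville p (V e) (real k * T)"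
proof
  have m: "f (t + real k * T) = f t" if "\<And>t. f (t + T) = f t" for f :: "real \<Rightarrow> real" and t
    using periodic_int_shift[of f, OF that, of t "int k"] by simp
  show "continuous_on UNIV p" "continuous_on UNIV (V e)"
    unfolding p_def[abs_def] V_def[abs_def] using r_range(1)
    by (intro continuous_intros continuous; simp add: less_imp_neq[symmetric])+
  show "p t > 0" for t by (rule p_pos)
  show "real k * T > 0" using assms T_pos by simp
  show "p (t + real k * T) = p t" for t by (rule m) (simp add: p_def r_periodic)
  show "V e (t + real k * T) = V e t" for t by (rule m) (simp add: V_def r_periodic curvatures_periodic)
qed

lemma sol_iff_second_order:
  assumes k: "sturm_liouville p (V e) P"
    and du: "\<And>t. (u has_real_derivative u1 t) (at t)" and du1: "\<And>t. (u1 has_real_derivative u2 t) (at t)"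
    and eq: "\<And>t. u2 t + (real n - 1) * (r1 t / r t) * u1 t + (\<kappa> - V e t) * u t = 0"
  shows "sturm_liouville.sol p (V e) \<kappa> u (\<lambda>t. p t * u1 t)"
  unfolding sturm_liouville.sol_def[OF k]
proof (intro allI conjI)
  fix t
  show "(u has_real_derivative p t * u1 t / p t) (at t)" using du[of t] p_pos[of t] by simp
  have "((\<lambda>t. p t * u1 t) has_real_derivative p t * (u2 t + (real n - 1) * (r1 t / r t) * u1 t)) (at t)"
    by (rule DERIV_cong[OF DERIV_mult[OF dp du1]]) (simp add: algebra_simps)
  moreover have "u2 t + (real n - 1) * (r1 t / r t) * u1 t = - ((\<kappa> - V e t) * u t)" using eq[of t] by linarith
  ultimately show "((\<lambda>t. p t * u1 t) has_real_derivative - ((\<kappa> - V e t) * p t) * u t) (at t)"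
    by (simp add: mult_ac)
qed

lemma dr2: "((\<lambda>t. - (r t * (1 + lam t * mu t))) has_real_derivative
   - (r1 t * (1 + (mu t)\<^sup>2 + (real n - 1) * (lam t)\<^sup>2 - (real n - 1) * lam t * mu t))) (at t)"
proof -
  have "((\<lambda>t. - (r t * (1 + lam t * mu t))) has_real_derivative
    - (r1 t * (1 + lam t * mu t) + r t * ((mu t - lam t) * (r1 t / r t) * mu t
      + lam t * ((real n - 1) * (lam t - mu t) * (r1 t / r t))))) (at t)"
    by (auto intro!: derivative_eq_intros dr dlam dmu simp: algebra_simps)
  then show ?thesis
    by (rule DERIV_cong) (use r_range(1)[of t] in \<open>simp add: field_simps power2_eq_square\<close>)
qed

text \<open>The normal component of the rotation of the last two coordinates is \<open>- r'\<close>.\<close>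

lemma rotation_jacobi_field_radial:
  assumes "sturm_liouville p (V 0) P"
  shows "sturm_liouville.sol p (V 0) 0 r1 (\<lambda>t. p t * - (r t * (1 + lam t * mu t)))"
  by (rule sol_iff_second_order[OF assms dr1 dr2])
    (use r_range(1) in \<open>simp add: V_def field_simps power2_eq_square less_imp_neq[symmetric]\<close>)

lemma real_r1_nonzero: "\<exists>t. r1 t \<noteq> 0"
proof (rule ccontr)
  assume "\<not> ?thesis"
  then have "r x = r 0" for x using dr by (intro DERIV_isconst_all) auto
  then have "r constant_on UNIV" unfolding constant_on_def by blast
  then show False using r_nonconst by blast
qed

text \<open>By Rolle's theorem \<open>r'\<close> has a zero \<open>z\<close>. From \<open>z\<close> to \<open>z + T\<close> the phase increases, and by periodicity it
increases by a multiple of \<open>2 pi\<close>, hence by at least \<open>2 pi\<close>.\<close>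

lemma radial_turning:
  assumes m: "m \<ge> 1"
  shows "\<exists>\<alpha>. sturm_liouville.F p (V 0) (real m * T) 0 \<alpha> \<ge> \<alpha> + 2 * pi * real m"
proof -
  interpret sl: sturm_liouville p "V 0" T using sturm_liouville_multiple_period[of 1 0] by simp
  interpret slm: sturm_liouville p "V 0" "real m * T" using sturm_liouville_multiple_period[OF m] .
  let ?y = "\<lambda>t. p t * - (r t * (1 + lam t * mu t))"
  have sol: "sl.sol 0 r1 ?y" by (rule rotation_jacobi_field_radial) unfold_locales
  have nz: "r1 t \<noteq> 0 \<or> ?y t \<noteq> 0" for t
  proof (rule ccontr)
    assume z: "\<not> ?thesis"
    have "r1 s = 0" for s by (rule sl.sol_unique(1)[OF sol, of t]) (use z in simp_all)
    then show False using real_r1_nonzero by blast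
  qed
  obtain \<theta> and j :: int where \<theta>: "sl.phase 0 \<theta>" "\<And>t. r1 t = 0 \<Longrightarrow> sin (\<theta> t) = 0" "\<And>t. \<theta> (t + T) = \<theta> t + 2 * pi * of_int j"
  proof -
    have y_per: "?y (t + T) = ?y t" for t by (simp add: p_def r_periodic curvatures_periodic)
    show thesis by (rule sl.periodic_sol_turning[OF sol nz r1_periodic y_per]) (rule that)
  qed
  obtain z where z: "r1 z = 0"
  proof -
    have "\<exists>z. 0 < z \<and> z < T \<and> (r has_real_derivative 0) (at z)"
    proof (rule Rolle[OF T_pos])
      show "r differentiable (at x)" for x using dr[of x] real_differentiable_def by blast
    qed (use r_periodic[of 0] continuous(1) in auto)
    then show thesis using that DERIV_unique[OF dr] by blast
  qed
  have "\<theta> (z + T) > \<theta> z" by (rule sl.phase_gains[OF \<theta>(1) \<theta>(2)[OF z]]) (use T_pos in simp)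
  then have j: "j \<ge> 1" using \<theta>(3)[of z] by (simp add: zero_less_mult_iff)
  have shift: "\<theta> (t + real k * T) = \<theta> t + real k * (2 * pi * of_int j)" for t k
  proof (induction k)
    case (Suc k)
    then show ?case using \<theta>(3)[of "t + real k * T"] by (simp add: algebra_simps)
  qed simp
  have "2 * pi * real m * 1 \<le> 2 * pi * real m * of_int j" using j by (intro mult_left_mono) auto
  then have "\<theta> (real m * T) \<ge> \<theta> 0 + 2 * pi * real m" using shift[of 0 m] by (simp add: mult_ac)
  moreover have "slm.F 0 (\<theta> 0) = \<theta> (real m * T)" unfolding slm.F_def by (rule slm.angle_eqI[OF \<theta>(1), symmetric])
  ultimately show ?thesis by (intro exI[of _ "\<theta> 0"]) simp
qed

text \<open>The normal component of the rotation in the plane of \<open>y\<^sub>i\<close> and the next to last coordinate is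
\<open>w(t) y\<^sub>i\<close>.\<close>

definition "w t = r t * NC t - r t * lam t * C t"
definition "w1 t = r1 t * NC t + r t * (mu t * C1 t) - (mu t * r1 t * C t + r t * lam t * C1 t)"

text \<open>The derivative of the normal of a curve in the sphere is tangential, with factor \<open>mu\<close>.\<close>

lemma dNC: "(NC has_real_derivative mu t * C1 t) (at t)"
proof -
  have s0: "s t \<noteq> 0" for t using s(1)[of t] by simp
  have N: "NC t = S t * r1 t - r t * S1 t" for t
  proof -
    have "NC t * s t = r1 t * sin (th t) - (r t)\<^sup>2 * lam t * cos (th t)"
      "S1 t * s t = r t * lam t * cos (th t) - r t * r1 t * sin (th t)" "S t = s t * sin (th t)"
      using s0[of t] by (simp_all add: NC_def S1_def S_def)
    then have "NC t * s t = (S t * r1 t - r t * S1 t) * s t" using s(2)[of t] by algebra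
    then show ?thesis using s0[of t] by simp
  qed
  have q: "r t * (NS t - lam t * S t) = C1 t"
  proof -
    have "NS t * s t = - (r1 t * cos (th t) + (r t)\<^sup>2 * lam t * sin (th t))"
      "C1 t * s t = - (r t * r1 t * cos (th t) + r t * lam t * sin (th t))" "S t = s t * sin (th t)"
      using s0[of t] by (simp_all add: NS_def C1_def S_def)
    then have "r t * (NS t - lam t * S t) * s t = C1 t * s t" using s(2)[of t] by algebra
    then show ?thesis using s0[of t] by simp
  qed
  have "((\<lambda>t. S t * r1 t - r t * S1 t) has_real_derivative
     S1 t * r1 t + - (r t * (1 + lam t * mu t)) * S t - (r1 t * S1 t + (- S t - mu t * NS t) * r t)) (at t)"
    by (rule DERIV_diff[OF DERIV_mult[OF dS dr1] DERIV_mult[OF dr dS1]])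
  then have "(NC has_real_derivative mu t * (r t * (NS t - lam t * S t))) (at t)"
    unfolding N[abs_def] by (rule DERIV_cong) (simp add: algebra_simps)
  then show ?thesis by (simp only: q)
qed

lemma dw: "(w has_real_derivative w1 t) (at t)"
  unfolding w_def[abs_def] w1_def
  by (rule DERIV_cong[OF DERIV_diff[OF DERIV_mult[OF dr dNC] DERIV_mult[OF drlam dC]]]) (simp add: algebra_simps)

text \<open>The Jacobi equation for \<open>w\<close>. After inserting the derivatives, both sides differ by a multiple of
\<open>q\<^sup>2 - (R\<^sup>2 - 1 - lam\<^sup>2)\<close> with \<open>q = r'/r\<close> and \<open>R = 1/r\<close>, which vanishes by the first
integral.\<close>

lemma dw1: "(w1 has_real_derivative
    - (real n - 1) * (r1 t / r t) * w1 t - (0 - V 1 t) * w t) (at t)"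
proof -
  define q where "q = r1 t / r t"
  have r0: "r t \<noteq> 0" using r_range(1)[of t] by simp
  have rq: "r1 t = q * r t" using r0 by (simp add: q_def)
  have dmr: "((\<lambda>t. mu t * r1 t) has_real_derivative
      (real n - 1) * (lam t - mu t) * (r1 t / r t) * r1 t + - (r t * (1 + lam t * mu t)) * mu t) (at t)"
    by (rule DERIV_mult[OF dmu dr1])
  have dmC: "((\<lambda>t. mu t * C1 t) has_real_derivative
      (real n - 1) * (lam t - mu t) * (r1 t / r t) * C1 t + (- C t - mu t * NC t) * mu t) (at t)"
    by (rule DERIV_mult[OF dmu dC1])
  define R where "R = inverse (r t)"
  have R: "R * r t = 1" using r0 by (simp add: R_def)
  have V1: "V 1 t = (real n - 1) * R\<^sup>2 - (real n + (real n - 1) * (lam t)\<^sup>2 + (mu t)\<^sup>2)"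
    by (simp add: V_def R_def power_inverse divide_inverse)
  have "(w1 has_real_derivative
     (- (r t * (1 + lam t * mu t)) * NC t + mu t * C1 t * r1 t)
     + (r1 t * (mu t * C1 t) + ((real n - 1) * (lam t - mu t) * (r1 t / r t) * C1 t + (- C t - mu t * NC t) * mu t) * r t)
     - (((real n - 1) * (lam t - mu t) * (r1 t / r t) * r1 t + - (r t * (1 + lam t * mu t)) * mu t) * C t + C1 t * (mu t * r1 t)
        + (mu t * r1 t * C1 t + (- C t - mu t * NC t) * (r t * lam t)))) (at t)"
    unfolding w1_def[abs_def]
    by (rule DERIV_diff[OF DERIV_add[OF DERIV_mult[OF dr1 dNC] DERIV_mult[OF dr dmC]]
          DERIV_add[OF DERIV_mult[OF dmr dC] DERIV_mult[OF drlam dC1]]])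
  then show ?thesis
  proof (rule DERIV_cong)
    define N where "N = real n - 1"
    have "R\<^sup>2 * ((q * r t)\<^sup>2 + (r t)\<^sup>2 * (1 + (lam t)\<^sup>2)) = R\<^sup>2" using ode[of t] by (simp add: rq)
    moreover have "R\<^sup>2 * ((q * r t)\<^sup>2 + (r t)\<^sup>2 * (1 + (lam t)\<^sup>2)) = (R * r t)\<^sup>2 * (q\<^sup>2 + (1 + (lam t)\<^sup>2))"
      by (simp add: power_mult_distrib algebra_simps)
    ultimately have q2: "q\<^sup>2 - (R\<^sup>2 - 1 - (lam t)\<^sup>2) = 0" by (simp add: R)
    have id: "(- (\<rho> * (1 + l * m)) * nc + m * c1 * (q * \<rho>))
       + (q * \<rho> * (m * c1) + (N * (l - m) * q * c1 + (- c - m * nc) * m) * \<rho>)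
       - ((N * (l - m) * q * (q * \<rho>) + - (\<rho> * (1 + l * m)) * m) * c + c1 * (m * (q * \<rho>))
        + (m * (q * \<rho>) * c1 + (- c - m * nc) * (\<rho> * l)))
       = - N * q * (q * \<rho> * nc + \<rho> * (m * c1) - (m * (q * \<rho>) * c + \<rho> * l * c1))
         - (0 - (N * R\<^sup>2 - (N + 1 + N * l\<^sup>2 + m\<^sup>2))) * (\<rho> * nc - \<rho> * l * c)
         + N * (\<rho> * nc - \<rho> * l * c) * (q\<^sup>2 - (R\<^sup>2 - 1 - l\<^sup>2))" for \<rho> l m nc c c1 :: real
      by (simp add: algebra_simps power2_eq_square)
    have nN: "real n = N + 1" by (simp add: N_def)
    show "(- (r t * (1 + lam t * mu t)) * NC t + mu t * C1 t * r1 t)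
     + (r1 t * (mu t * C1 t) + ((real n - 1) * (lam t - mu t) * (r1 t / r t) * C1 t + (- C t - mu t * NC t) * mu t) * r t)
     - (((real n - 1) * (lam t - mu t) * (r1 t / r t) * r1 t + - (r t * (1 + lam t * mu t)) * mu t) * C t + C1 t * (mu t * r1 t)
        + (mu t * r1 t * C1 t + (- C t - mu t * NC t) * (r t * lam t)))
      = - (real n - 1) * (r1 t / r t) * w1 t - (0 - V 1 t) * w t"
      unfolding w_def w1_def V1 unfolding q_def[symmetric] unfolding rq nN add_diff_cancel_right' id q2 by simp
  qed
qed

lemma rotation_jacobi_field_linear:
  assumes "sturm_liouville p (V 1) P"
  shows "sturm_liouville.sol p (V 1) 0 w (\<lambda>t. p t * w1 t)"
proof (rule sol_iff_second_order[OF assms dw dw1])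
  have "- N * q * x - y * z + N * q * x + y * z = 0" for N q x y z :: real by simp
  then show "- (real n - 1) * (r1 t / r t) * w1 t - (0 - V 1 t) * w t + (real n - 1) * (r1 t / r t) * w1 t + (0 - V 1 t) * w t = 0" for t .
qed

text \<open>When \<open>lam = 0\<close>, the derivative of \<open>lam\<close> is \<open>- n D r'/r\<close>, of the sign opposite to \<open>r'\<close>. So the point
\<open>lam + i r'\<close> crosses the imaginary axis counterclockwise. If its argument decreased in a period, it
would pass some \<open>pi/2 + k pi\<close>, and from there on it could only be larger, a contradiction after one
further period.\<close>

lemma polar_angle_of_curvature:
  obtains \<eta> and j :: int where "continuous_on UNIV \<eta>" "\<And>t. \<exists>\<rho>>0. lam t = \<rho> * cos (\<eta> t) \<and> r1 t = \<rho> * sin (\<eta> t)"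
    "\<And>t. \<eta> (t + T) = \<eta> t + 2 * pi * of_int j" "j \<ge> 0"
proof -
  let ?r2 = "\<lambda>t. - (r t * (1 + lam t * mu t))" and ?l1 = "\<lambda>t. (mu t - lam t) * (r1 t / r t)"
  have nz: "r1 t \<noteq> 0 \<or> lam t \<noteq> 0" for t
    using ode[of t] s_pos[of t] by (cases "r1 t = 0 \<and> lam t = 0") auto
  have c2: "continuous_on UNIV ?r2" by (intro continuous_intros continuous)
  have cl: "continuous_on UNIV ?l1"
    using r_range(1) by (intro continuous_intros continuous) (auto simp: less_imp_neq[symmetric])
  define d where "d t = (?r2 t * lam t - ?l1 t * r1 t) / ((r1 t)\<^sup>2 + (lam t)\<^sup>2)" for t
  obtain \<eta> where \<eta>: "\<And>t. (\<eta> has_real_derivative d t) (at t)"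
    "\<And>t. r1 t = sqrt ((r1 t)\<^sup>2 + (lam t)\<^sup>2) * sin (\<eta> t)" "\<And>t. lam t = sqrt ((r1 t)\<^sup>2 + (lam t)\<^sup>2) * cos (\<eta> t)"
    using differentiable_angle_exists[OF dr1 dlam c2 cl nz] unfolding d_def by blast
  define \<rho> where "\<rho> t = sqrt ((r1 t)\<^sup>2 + (lam t)\<^sup>2)" for t
  have \<rho>: "\<rho> t > 0" for t using nz[of t] by (auto simp: \<rho>_def sum_power2_gt_zero_iff)
  have polar: "r1 t = \<rho> t * sin (\<eta> t)" "lam t = \<rho> t * cos (\<eta> t)" for t
    using \<eta>(2,3)[of t] unfolding \<rho>_def .
  have \<rho>_per: "\<rho> (t + T) = \<rho> t" for t by (simp add: \<rho>_def r1_periodic curvatures_periodic)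
  have "sin (\<eta> (0 + T)) = sin (\<eta> 0)" "cos (\<eta> (0 + T)) = cos (\<eta> 0)"
    using polar[of "0 + T"] polar[of 0] \<rho>[of 0]
    unfolding r1_periodic curvatures_periodic \<rho>_per by (metis mult_left_cancel less_irrefl)+
  then obtain j :: int where j: "\<eta> (0 + T) = \<eta> 0 + 2 * pi * of_int j" using sin_cos_eq_iff by metis
  have per: "\<eta> (t + T) = \<eta> t + 2 * pi * of_int j" for t
  proof -
    have "((\<lambda>t. \<eta> (t + T) - \<eta> t) has_real_derivative d (t + T) - d t) (at t)" for t
      using \<eta>(1)[of "t + T"] by (intro DERIV_diff \<eta>) (simp add: DERIV_shift)
    moreover have "d (t + T) = d t" for t by (simp add: d_def r1_periodic curvatures_periodic r_periodic)
    ultimately have "\<eta> (t + T) - \<eta> t = \<eta> (0 + T) - \<eta> 0" by (intro DERIV_isconst_all) auto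
    then show ?thesis using j by simp
  qed
  have cont: "continuous_on A \<eta>" for A by (rule differentiable_imp_continuous_on[OF \<eta>(1)])
  have gain: "\<eta> t > \<eta> z" if z: "cos (\<eta> z) = 0" and "z < t" for z t
  proof (rule upcrossing_is_permanent[OF \<eta>(1) _ refl \<open>z < t\<close>])
    fix u assume "\<eta> u = \<eta> z"
    then have l0: "lam u = 0" using polar(2)[of u] z by simp
    then have "r1 u \<noteq> 0" using nz[of u] by simp
    moreover have "d u = real n * D u / r u"
      using \<open>r1 u \<noteq> 0\<close> l0 by (simp add: d_def mu_def power2_eq_square)
    ultimately show "0 < d u" using n D_pos[of u] r_range(1)[of u] by simp
  qed
  have "j \<ge> 0"
  proof (rule ccontr)
    assume neg: "\<not> j \<ge> 0"
    then have "2 * pi * of_int j \<le> 2 * pi * (- 1)" by (intro mult_left_mono) auto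
    then have le: "\<eta> (0 + T) \<le> \<eta> 0 - 2 * pi" using j by simp
    define k where "k = \<lfloor>(\<eta> 0 - pi / 2) / pi\<rfloor>"
    have k: "pi / 2 + of_int k * pi \<le> \<eta> 0" "\<eta> 0 - pi < pi / 2 + of_int k * pi"
      using floor_divide_lower[OF pi_gt_zero, of "\<eta> 0 - pi / 2"] floor_divide_upper[OF pi_gt_zero, of "\<eta> 0 - pi / 2"]
      by (simp_all add: k_def algebra_simps)
    have "\<exists>z\<ge>0. z \<le> T \<and> \<eta> z = pi / 2 + of_int k * pi"
      using le k T_pos pi_gt_zero by (intro IVT2' cont) auto
    then obtain z where z: "\<eta> z = pi / 2 + of_int k * pi" by blast
    have "cos (\<eta> z) = 0" unfolding z by (simp add: cos_add sin_zero_iff_int2)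
    from gain[OF this, of "z + T"] have "\<eta> (z + T) > \<eta> z" using T_pos by simp
    then show False using per[of z] neg by (simp add: zero_less_mult_iff)
  qed
  moreover have "\<exists>\<rho>>0. lam t = \<rho> * cos (\<eta> t) \<and> r1 t = \<rho> * sin (\<eta> t)" for t
    using \<rho>[of t] polar[of t] by (intro exI[of _ "\<rho> t"]) simp
  ultimately show thesis using that cont per by blast
qed

lemma w_polar: "w t = - (r t / s t) * (lam t * cos (th t) - r1 t * sin (th t))"
proof -
  have s0: "s t \<noteq> 0" using s(1)[of t] by simp
  have "NC t * s t = r1 t * sin (th t) - (r t)\<^sup>2 * lam t * cos (th t)" "C t = s t * cos (th t)"
    using s0 by (simp_all add: NC_def C_def)
  then have "w t * s t = - r t * (lam t * cos (th t) - r1 t * sin (th t))"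
    unfolding w_def using s(2)[of t] by algebra
  then show ?thesis using s0 by (simp add: field_simps)
qed

text \<open>The argument \<open>\<psi>\<close> of \<open>(lam + i r') exp(i th)\<close> advances by at least \<open>2 pi l\<close> in a period \<open>m T\<close>, and the
zeros of \<open>w\<close> are those of \<open>cos \<psi>\<close>. Each advance of \<open>\<psi>\<close> by \<open>pi\<close> therefore forces the phase of \<open>w\<close> to
gain at least \<open>pi\<close>.\<close>

lemma linear_turning:
  assumes m: "m \<ge> 1" and l: "l \<ge> 1" and th_T: "th T = 2 * pi * (real l / real m)"
  shows "\<exists>\<alpha>. sturm_liouville.F p (V 1) (real m * T) 0 \<alpha> \<ge> \<alpha> + 2 * pi * real l"
proof -
  interpret sturm_liouville p "V 1" "real m * T" using sturm_liouville_multiple_period[OF m] .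
  let ?P = "real m * T"
  have sol: "sol 0 w (\<lambda>t. p t * w1 t)" by (rule rotation_jacobi_field_linear) unfold_locales
  have shift: "f (t + real k * T) = f t + real k * d" if "\<And>t. f (t + T) = f t + d" for f :: "real \<Rightarrow> real" and d t k
  proof (induction k)
    case (Suc k)
    then show ?case using that[of "t + real k * T"] by (simp add: algebra_simps)
  qed simp
  have th0: "th 0 = 0" by (simp add: th_def rot_theta_def zero_ereal_def[symmetric])
  have th_per: "th (t + T) = th t + th T" for t
  proof -
    have "((\<lambda>t. th (t + T)) has_real_derivative r t * lam t / (s t)\<^sup>2) (at t)" for t
      using dth[of "t + T"] by (simp add: DERIV_shift r_periodic curvatures_periodic s_def)
    then have "((\<lambda>t. th (t + T) - th t) has_real_derivative 0) (at t)" for t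
      using DERIV_diff[OF _ dth, of "\<lambda>t. th (t + T)"] by fastforce
    then have "th (t + T) - th t = th (0 + T) - th 0" by (intro DERIV_isconst_all) auto
    then show ?thesis by (simp add: th0)
  qed
  have thP: "th (t + ?P) = th t + 2 * pi * real l" for t
    using shift[of th, OF th_per, of t m] th_T m by simp
  have "cos (th (t + ?P)) = cos (th t)" "sin (th (t + ?P)) = sin (th t)" for t
    unfolding thP using periodic_int_shift[of "cos :: real \<Rightarrow> real", OF cos_periodic, of "th t" "int l"]
      periodic_int_shift[of "sin :: real \<Rightarrow> real", OF sin_periodic, of "th t" "int l"] by (simp_all add: mult_ac)
  moreover have "f (t + ?P) = f t" if "\<And>t. f (t + T) = f t" for f :: "real \<Rightarrow> real" and t
    using shift[of f 0 t m] that by simp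
  note this[of r, OF r_periodic] this[of r1, OF r1_periodic] this[of lam, OF curvatures_periodic(1)]
  ultimately have w_per: "w (t + ?P) = w t" for t by (simp add: w_polar s_def)
  have w1_per: "w1 (t + ?P) = w1 t" for t by (rule periodic_derivative[OF dw w_per])
  obtain \<eta> and j :: int where \<eta>: "continuous_on UNIV \<eta>" "\<And>t. \<exists>\<rho>>0. lam t = \<rho> * cos (\<eta> t) \<and> r1 t = \<rho> * sin (\<eta> t)"
    "\<And>t. \<eta> (t + T) = \<eta> t + 2 * pi * of_int j" "j \<ge> 0"
    using polar_angle_of_curvature by blast
  define \<psi> where "\<psi> t = th t + \<eta> t" for t
  have \<psi>_cont: "continuous_on A \<psi>" for A unfolding \<psi>_def
    by (intro continuous_intros differentiable_imp_continuous_on[OF dth] continuous_on_subset[OF \<eta>(1)]) auto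
  have zero: "w t = 0 \<longleftrightarrow> cos (\<psi> t) = 0" for t
  proof -
    obtain \<rho> where \<rho>: "\<rho> > 0" "lam t = \<rho> * cos (\<eta> t)" "r1 t = \<rho> * sin (\<eta> t)" using \<eta>(2) by blast
    define K where "K = r t / s t * \<rho>"
    have K: "K > 0" using \<rho>(1) s(1)[of t] r_range(1)[of t] by (simp add: K_def)
    have "w t = - K * cos (\<psi> t)"
      unfolding w_polar \<psi>_def cos_add \<rho>(2,3) K_def by (simp add: algebra_simps)
    then show ?thesis using K by simp
  qed
  have gain: "\<psi> (t + ?P) \<ge> \<psi> t + real (2 * l) * pi" for t
  proof -
    have "\<eta> (t + ?P) = \<eta> t + real m * (2 * pi * of_int j)" by (rule shift[of \<eta>, OF \<eta>(3)])
    moreover have "real m * (2 * pi * of_int j) \<ge> 0" using \<eta>(4) by simp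
    ultimately show ?thesis unfolding \<psi>_def thP by simp
  qed
  have gain_pi: "\<psi> ?P \<ge> \<psi> 0 + pi"
  proof -
    have "1 * pi \<le> real (2 * l) * pi" using l by (intro mult_right_mono) auto
    then show ?thesis using gain[of 0] unfolding add_0 by linarith
  qed
  obtain t0 where t0: "cos (\<psi> t0) = 0"
  proof -
    define k where "k = \<lceil>(\<psi> 0 - pi / 2) / pi\<rceil>"
    have k: "\<psi> 0 \<le> pi / 2 + of_int k * pi" "pi / 2 + of_int k * pi \<le> \<psi> 0 + pi"
      using ceiling_divide_upper[OF pi_gt_zero, of "\<psi> 0 - pi / 2"] ceiling_divide_lower[OF pi_gt_zero, of "\<psi> 0 - pi / 2"]
      by (simp_all add: k_def algebra_simps)
    have "\<exists>z\<ge>0. z \<le> ?P \<and> \<psi> z = pi / 2 + of_int k * pi"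
      using gain_pi k P_pos by (intro IVT' \<psi>_cont) auto
    then obtain z where z: "\<psi> z = pi / 2 + of_int k * pi" by blast
    have "cos (\<psi> z) = 0" unfolding z by (simp add: cos_add sin_zero_iff_int2)
    then show thesis by (rule that)
  qed
  have nz: "w t \<noteq> 0 \<or> p t * w1 t \<noteq> 0" for t
  proof (rule ccontr)
    assume z: "\<not> ?thesis"
    have "w u = 0" for u by (rule sol_unique(1)[OF sol, of t]) (use z in simp_all)
    then have c0: "cos (\<psi> u) = 0" for u using zero by blast
    have "\<exists>z\<ge>0. z \<le> ?P \<and> \<psi> z = \<psi> 0 + pi / 2"
    proof (rule IVT'[OF _ _ _ \<psi>_cont])
      show "\<psi> 0 \<le> \<psi> 0 + pi / 2" "\<psi> 0 + pi / 2 \<le> \<psi> ?P" using gain_pi pi_gt_zero by linarith+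
    qed (use P_pos in simp)
    then obtain z where "\<psi> z = \<psi> 0 + pi / 2" by blast
    then have "sin (\<psi> 0) = 0" using c0[of z] by (simp add: cos_add)
    then show False using c0[of 0] sin_cos_squared_add[of "\<psi> 0"] by simp
  qed
  obtain \<theta> and i :: int where \<theta>: "phase 0 \<theta>" "\<And>t. w t = 0 \<Longrightarrow> sin (\<theta> t) = 0" "\<And>t. \<theta> (t + ?P) = \<theta> t + 2 * pi * of_int i"
  proof -
    have y_per: "p (t + ?P) * w1 (t + ?P) = p t * w1 t" for t by (simp only: p_periodic w1_per)
    show thesis by (rule periodic_sol_turning[OF sol nz w_per y_per]) (rule that)
  qed
  have "\<theta> (t0 + ?P) \<ge> \<theta> t0 + real (2 * l) * pi"
    by (rule phase_gains_per_zero[OF \<theta>(1) \<psi>_cont _ t0 _ gain]) (use \<theta>(2) zero P_pos in auto)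
  then have "2 * pi * of_int i \<ge> 2 * pi * real l" using \<theta>(3)[of t0] by simp
  moreover have "F 0 (\<theta> 0) = \<theta> 0 + 2 * pi * of_int i"
    using angle_eqI[OF \<theta>(1), of ?P] \<theta>(3)[of 0] by (simp add: F_def)
  ultimately show ?thesis by (intro exI[of _ "\<theta> 0"]) simp
qed

end

section \<open>Separation of variables and the count\<close>

lemma multiplicity_ge_card:
  fixes F :: "'i \<Rightarrow> (real^'n) \<times> real \<Rightarrow> real"
  assumes fin: "finite I" and F: "\<And>i. i \<in> I \<Longrightarrow> F i \<in> jacobi_eigenspace \<phi> P \<kappa>"
    and indep: "\<And>c. (\<And>p. p \<in> cylinder \<Longrightarrow> (\<Sum>i\<in>I. c i * F i p) = 0) \<Longrightarrow> \<forall>i\<in>I. c i = 0"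
  shows "enat (card I) \<le> jacobi_multiplicity \<phi> P \<kappa>"
proof -
  obtain h where h: "bij_betw h {0..<card I} I" using ex_bij_betw_nat_finite[OF fin] by blast
  then have h: "bij_betw h {..<card I} I" by (simp add: atLeast0LessThan)
  have "lin_indep_on_cylinder (card I) (\<lambda>i. F (h i))"
    unfolding lin_indep_on_cylinder_def
  proof (intro allI impI)
    fix c :: "nat \<Rightarrow> real" and i assume z: "\<forall>p\<in>cylinder. (\<Sum>i<card I. c i * F (h i) p) = 0" and i: "i < card I"
    define c' where "c' = (\<lambda>x. c (the_inv_into {..<card I} h x))"
    have ch: "c' (h j) = c j" if "j < card I" for j
      using the_inv_into_f_f[of h "{..<card I}" j] h that by (simp add: c'_def bij_betw_def)
    have "(\<Sum>x\<in>I. c' x * F x p) = 0" if "p \<in> cylinder" for p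
    proof -
      have "(\<Sum>x\<in>I. c' x * F x p) = (\<Sum>j<card I. c' (h j) * F (h j) p)"
        by (rule sum.reindex_bij_betw[OF h, symmetric])
      also have "\<dots> = (\<Sum>j<card I. c j * F (h j) p)" by (intro sum.cong) (simp_all add: ch)
      finally show ?thesis using z that by simp
    qed
    from indep[OF this] have "c' (h i) = 0" using bij_betwE[OF h] i by blast
    then show "c i = 0" using ch[OF i] by simp
  qed
  moreover have "\<forall>i<card I. F (h i) \<in> jacobi_eigenspace \<phi> P \<kappa>"
    using bij_betwE[OF h] F by blast
  ultimately show ?thesis unfolding jacobi_multiplicity_def by (intro SUP_upper CollectI exI[of _ "\<lambda>i. F (h i)"] conjI)
qed

context rotational_profile
begin

lemmas Ck_on_UNIV = Ck_on_const[OF open_UNIV] Ck_on_add[OF open_UNIV] Ck_on_mult[OF open_UNIV] Ck_on_power[OF open_UNIV]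

lemma curvature_smooth: "Ck_on k (\<lambda>t. inverse (r t)) UNIV" "Ck_on k lam UNIV" "Ck_on k mu UNIV"
proof -
  have r0: "r t \<noteq> 0" for t using r_range(1)[of t] by simp
  show i: "Ck_on k (\<lambda>t. inverse (r t)) UNIV" by (rule Ck_on_inverse[OF open_UNIV r0 r_smooth])
  have D: "Ck_on k D UNIV" unfolding D_def[abs_def] by (intro Ck_on_UNIV i)
  show lam: "Ck_on k lam UNIV" unfolding lam_def[abs_def] by (intro Ck_on_UNIV D)
  have "mu = (\<lambda>t. lam t + (- real n) * D t)" by (simp add: mu_def fun_eq_iff)
  moreover have "Ck_on k (\<lambda>t. lam t + (- real n) * D t) UNIV" by (intro Ck_on_UNIV D lam)
  ultimately show "Ck_on k mu UNIV" by (simp only:)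
qed

lemma coefficients_smooth: "Ck_on k p UNIV" "Ck_on k (\<lambda>t. inverse (p t)) UNIV" "Ck_on k (V e) UNIV"
proof -
  have p0: "p t \<noteq> 0" for t using p_pos[of t] by simp
  show p: "Ck_on k p UNIV" unfolding p_def[abs_def] by (intro Ck_on_UNIV r_smooth)
  show "Ck_on k (\<lambda>t. inverse (p t)) UNIV" by (rule Ck_on_inverse[OF open_UNIV p0 p])
  have "V e = (\<lambda>t. e * (real n - 1) * inverse (r t) ^ 2 + (- 1) * (real n + ((real n - 1) * lam t ^ 2 + mu t ^ 2)))"
    by (simp add: V_def fun_eq_iff divide_inverse power_inverse)
  moreover have "Ck_on k (\<lambda>t. e * (real n - 1) * inverse (r t) ^ 2 + (- 1) * (real n + ((real n - 1) * lam t ^ 2 + mu t ^ 2))) UNIV"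
    by (intro Ck_on_UNIV curvature_smooth)
  ultimately show "Ck_on k (V e) UNIV" by (simp only:)
qed

lemma sol_smooth:
  assumes sl: "sturm_liouville p (V e) P" and s: "sturm_liouville.sol p (V e) \<kappa> x y"
  shows "Ck_on k x UNIV"
proof -
  note d = s[unfolded sturm_liouville.sol_def[OF sl], rule_format]
  have "Ck_on k x UNIV \<and> Ck_on k y UNIV"
  proof (induction k)
    case 0
    have dx: "(x has_real_derivative y t / p t) (at t)" and dy: "(y has_real_derivative - ((\<kappa> - V e t) * p t) * x t) (at t)" for t
      using d by blast+
    show ?case
      using differentiable_imp_continuous_on[OF dx] differentiable_imp_continuous_on[OF dy] by simp
  next
    case (Suc k)
    have 1: "Ck_on k (\<lambda>t. y t * inverse (p t)) UNIV"
      by (intro Ck_on_UNIV coefficients_smooth) (use Suc in auto)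
    have 2: "Ck_on k (\<lambda>t. ((-1) * ((\<kappa> + (-1) * V e t) * p t)) * x t) UNIV"
      by (intro Ck_on_UNIV coefficients_smooth) (use Suc in auto)
    have "Ck_on (Suc k) x UNIV" by (rule Ck_on_real_SucI[OF _ 1]) (use d in \<open>simp add: divide_inverse\<close>)
    moreover have "Ck_on (Suc k) y UNIV" by (rule Ck_on_real_SucI[OF _ 2]) (use d in simp)
    ultimately show ?case by blast
  qed
  then show ?thesis by blast
qed

lemma separated_eigenfunction:
  fixes b :: "real^'n"
  assumes nn: "n = CARD('n)" and sl: "sturm_liouville p (V e) P"
    and u: "sturm_liouville.eigenfunction p (V e) P \<kappa> u"
    and mode: "e = 0 \<and> b = 0 \<or> e = 1 \<and> a = 0"
  shows "(\<lambda>(y, t). u t * (a + b \<bullet> y)) \<in> jacobi_eigenspace \<phi> P \<kappa>"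
proof -
  obtain y where y: "sturm_liouville.sol p (V e) \<kappa> u y" and per: "\<And>t. u (t + P) = u t"
    using u unfolding sturm_liouville.eigenfunction_def[OF sl] by blast
  note d = y[unfolded sturm_liouville.sol_def[OF sl], rule_format]
  define u1 where "u1 t = y t / p t" for t
  have du: "(u has_real_derivative u1 t) (at t)" for t using d[of t] by (simp add: u1_def)
  have du1: "(u1 has_real_derivative - ((\<kappa> - V e t) * u t) - (real n - 1) * (r1 t / r t) * u1 t) (at t)" for t
  proof -
    have dy: "(y has_real_derivative - ((\<kappa> - V e t) * p t) * u t) (at t)" using d[of t] by blast
    have p0: "p t \<noteq> 0" using p_pos[of t] by simp
    define q where "q = r1 t / r t"
    have yp: "y t = u1 t * p t" using p0 by (simp add: u1_def)
    have "- ((\<kappa> - V e t) * p t) * u t * p t - y t * ((real n - 1) * q * p t)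
      = (- ((\<kappa> - V e t) * u t) - (real n - 1) * q * u1 t) * (p t * p t)"
      unfolding yp by (simp add: algebra_simps)
    then have e: "(- ((\<kappa> - V e t) * p t) * u t * p t - y t * ((real n - 1) * q * p t)) / (p t * p t)
      = - ((\<kappa> - V e t) * u t) - (real n - 1) * q * u1 t"
      using p0 by simp
    have "((\<lambda>t. y t / p t) has_real_derivative - ((\<kappa> - V e t) * u t) - (real n - 1) * (r1 t / r t) * u1 t) (at t)"
      by (rule DERIV_cong[OF DERIV_divide[OF dy dp p0]]) (rule e[unfolded q_def])
    moreover have "u1 = (\<lambda>t. y t / p t)" by (simp add: u1_def fun_eq_iff)
    ultimately show ?thesis by (simp only:)
  qed
  have "smooth_on_cylinder (\<lambda>(y::real^'n, t). u t * (a + b \<bullet> y))"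
    by (rule smooth_on_cylinder_separated[OF sol_smooth[OF sl y]])
  moreover have "jacobi_operator \<phi> (\<lambda>(y, t). u t * (a + b \<bullet> y)) q = \<kappa> * (\<lambda>(y, t). u t * (a + b \<bullet> y)) q"
    if "q \<in> cylinder" for q :: "(real^'n) \<times> real"
  proof -
    obtain z t where q: "q = (z, t)" by (cases q)
    have z: "norm z = 1" using that q by simp
    define M Q where "M = (real n - 1) / (r t)\<^sup>2" and "Q = real n + (real n - 1) * (lam t)\<^sup>2 + (mu t)\<^sup>2"
    have V: "V e t = e * M - Q" by (simp add: V_def M_def Q_def)
    have id: "- (- ((\<kappa> - (e * M - Q)) * x) - y + y + Q * x) * g + M * x * \<beta> = \<kappa> * (x * g)"
      if "e * g = \<beta>" for x y g \<beta>
      unfolding that[symmetric] by (simp add: algebra_simps)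
    have "e * (a + b \<bullet> z) = b \<bullet> z" using mode by auto
    from id[OF this]
    show ?thesis
      unfolding q jacobi_operator_separated[OF du du1 z] nn[symmetric] V M_def[symmetric] Q_def[symmetric] case_prod_conv .
  qed
  ultimately show ?thesis using per by (auto simp: jacobi_eigenspace_def smooth_functions_def)
qed

text \<open>The family consists of the functions \<open>U j\<close>, indexed by \<open>(j, None)\<close>, and \<open>W j * y\<^sub>i\<close>, indexed by
\<open>(j, Some i)\<close>. The two kinds are even and odd in \<open>y\<close>. So a vanishing linear combination, evaluated at
plus and minus the \<open>i\<close>-th unit vector, splits into a relation between the \<open>U j\<close> and one between the
\<open>W j\<close>.\<close>

lemma multiplicity_ge:
  assumes nn: "n = CARD('n::finite)" and sl: "\<And>e. sturm_liouville p (V e) P"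
    and U: "sturm_liouville.independent_eigenfunctions p (V 0) P \<kappa> k U"
    and W: "sturm_liouville.independent_eigenfunctions p (V 1) P \<kappa> k' W"
  shows "enat (k + n * k') \<le> jacobi_multiplicity (\<phi> :: (real^'n) \<times> real \<Rightarrow> _) P \<kappa>"
proof -
  note eU = U[unfolded sturm_liouville.independent_eigenfunctions_def[OF sl]]
    and eW = W[unfolded sturm_liouville.independent_eigenfunctions_def[OF sl]]
  define F :: "nat \<times> 'n option \<Rightarrow> (real^'n) \<times> real \<Rightarrow> real" where
    "F = (\<lambda>(j, i). case i of None \<Rightarrow> (\<lambda>(y, t). U j t * (1 + 0 \<bullet> y)) | Some i \<Rightarrow> (\<lambda>(y, t). W j t * (0 + axis i 1 \<bullet> y)))"
  define I :: "(nat \<times> 'n option) set" where "I = ({..<k} \<times> {None}) \<union> ({..<k'} \<times> range Some)"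
  have card: "card I = k + n * k'"
  proof -
    have "card I = card ({..<k} \<times> {None :: 'n option}) + card ({..<k'} \<times> range (Some :: 'n \<Rightarrow> _))"
      unfolding I_def by (rule card_Un_disjoint) auto
    then show ?thesis by (simp add: card_cartesian_product card_image nn mult.commute)
  qed
  have "enat (card I) \<le> jacobi_multiplicity (\<phi> :: (real^'n) \<times> real \<Rightarrow> _) P \<kappa>"
  proof (rule multiplicity_ge_card[where F = F])
    fix x assume "x \<in> I"
    then consider j where "j < k" "x = (j, None)" | j i where "j < k'" "x = (j, Some i)" by (auto simp: I_def)
    then show "F x \<in> jacobi_eigenspace \<phi> P \<kappa>"
    proof cases
      case 1
      then show ?thesis unfolding F_def using separated_eigenfunction[OF nn sl, of 0 \<kappa> "U j" 0 1] eU by simp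
    next
      case 2
      then show ?thesis unfolding F_def using separated_eigenfunction[OF nn sl, of 1 \<kappa> "W j" "axis i 1" 0] eW by simp
    qed
  next
    fix a assume z: "\<And>p. p \<in> cylinder \<Longrightarrow> (\<Sum>x\<in>I. a x * F x p) = 0"
    have split: "(\<Sum>x\<in>I. a x * F x (y, t)) = (\<Sum>j<k. a (j, None) * U j t)
       + (\<Sum>j<k'. \<Sum>i\<in>UNIV. a (j, Some i) * (W j t * (axis i 1 \<bullet> y)))" for y t
    proof -
      have "(\<Sum>x\<in>I. a x * F x (y, t)) = (\<Sum>x\<in>{..<k} \<times> {None}. a x * F x (y, t)) + (\<Sum>x\<in>{..<k'} \<times> range Some. a x * F x (y, t))"
        unfolding I_def by (rule sum.union_disjoint) auto
      also have "(\<Sum>x\<in>{..<k} \<times> {None}. a x * F x (y, t)) = (\<Sum>j<k. \<Sum>i\<in>{None}. a (j, i) * F (j, i) (y, t))"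
        by (simp only: sum.cartesian_product split_def prod.collapse)
      also have "\<dots> = (\<Sum>j<k. a (j, None) * U j t)" by (simp add: F_def)
      also have "(\<Sum>x\<in>{..<k'} \<times> range Some. a x * F x (y, t)) = (\<Sum>j<k'. \<Sum>i\<in>range Some. a (j, i) * F (j, i) (y, t))"
        by (simp add: sum.cartesian_product)
      also have "\<dots> = (\<Sum>j<k'. \<Sum>i\<in>UNIV. a (j, Some i) * (W j t * (axis i 1 \<bullet> y)))"
        by (intro sum.cong refl) (simp add: sum.reindex F_def)
      finally show ?thesis .
    qed
    have ax: "(\<Sum>j<k'. \<Sum>i\<in>UNIV. a (j, Some i) * (W j t * ((axis i 1 :: real^'n) \<bullet> (d *\<^sub>R axis i0 1)))) = d * (\<Sum>j<k'. a (j, Some i0) * W j t)" for t d i0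
    proof -
      have "(\<Sum>i\<in>UNIV. a (j, Some i) * (W j t * ((axis i 1 :: real^'n) \<bullet> (d *\<^sub>R axis i0 1)))) = d * (a (j, Some i0) * W j t)" for j
      proof -
        have "(\<Sum>i\<in>UNIV. a (j, Some i) * (W j t * ((axis i 1 :: real^'n) \<bullet> (d *\<^sub>R axis i0 1))))
          = (\<Sum>i\<in>UNIV. if i = i0 then d * (a (j, Some i0) * W j t) else 0)"
          by (intro sum.cong refl) (simp add: inner_axis_axis inner_real_def)
        then show ?thesis by simp
      qed
      then show ?thesis by (simp only: sum_distrib_left)
    qed
    have "(\<Sum>j<k. a (j, None) * U j t) + d * (\<Sum>j<k'. a (j, Some i) * W j t) = 0" if "\<bar>d\<bar> = 1" for t d i
      using z[of "(d *\<^sub>R axis i 1, t)"] that unfolding split ax by simp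
    note pm = this
    have both: "(\<Sum>j<k. a (j, None) * U j t) = 0" "(\<Sum>j<k'. a (j, Some i) * W j t) = 0" for t i
      using pm[of 1 t i] pm[of "-1" t i] by simp_all
    have "\<forall>j<k. a (j, None) = 0"
      using eU[THEN conjunct2, THEN spec, of "\<lambda>j. a (j, None)"] both(1) by blast
    moreover have "\<forall>j<k'. a (j, Some i) = 0" for i
      using eW[THEN conjunct2, THEN spec, of "\<lambda>j. a (j, Some i)"] both(2) by blast
    ultimately show "\<forall>x\<in>I. a x = 0" by (auto simp: I_def)
  qed (simp add: I_def)
  then show ?thesis unfolding card .
qed

text \<open>An eigenvalue may occur in both lists; its multiplicity then counts the eigenfunctions of both kinds.\<close>

lemma num_negative_eigenvalues_ge:
  assumes nn: "n = CARD('n::finite)" and sl: "\<And>e. sturm_liouville p (V e) P"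
    and K: "finite K" "K \<subseteq> {..<0}" "\<And>\<kappa>. \<kappa> \<in> K \<Longrightarrow> d \<kappa> \<ge> 1"
      "\<And>\<kappa>. \<kappa> \<in> K \<Longrightarrow> \<exists>U. sturm_liouville.independent_eigenfunctions p (V 0) P \<kappa> (d \<kappa>) U"
    and K': "finite K'" "K' \<subseteq> {..<0}" "\<And>\<kappa>. \<kappa> \<in> K' \<Longrightarrow> d' \<kappa> \<ge> 1"
      "\<And>\<kappa>. \<kappa> \<in> K' \<Longrightarrow> \<exists>U. sturm_liouville.independent_eigenfunctions p (V 1) P \<kappa> (d' \<kappa>) U"
  shows "enat ((\<Sum>\<kappa>\<in>K. d \<kappa>) + n * (\<Sum>\<kappa>\<in>K'. d' \<kappa>)) \<le> num_negative_eigenvalues (\<phi> :: (real^'n) \<times> real \<Rightarrow> _) P"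
proof -
  let ?\<phi> = "\<phi> :: (real^'n) \<times> real \<Rightarrow> _"
  define k k' where "k \<kappa> = (if \<kappa> \<in> K then d \<kappa> else 0)" and "k' \<kappa> = (if \<kappa> \<in> K' then d' \<kappa> else 0)" for \<kappa>
  have mult: "enat (k \<kappa> + n * k' \<kappa>) \<le> jacobi_multiplicity ?\<phi> P \<kappa>" for \<kappa>
  proof -
    have "\<exists>U. sturm_liouville.independent_eigenfunctions p (V 0) P \<kappa> (k \<kappa>) U"
      using K(4)[of \<kappa>] by (auto simp: k_def sturm_liouville.independent_eigenfunctions_def[OF sl])
    moreover have "\<exists>W. sturm_liouville.independent_eigenfunctions p (V 1) P \<kappa> (k' \<kappa>) W"
      using K'(4)[of \<kappa>] by (auto simp: k'_def sturm_liouville.independent_eigenfunctions_def[OF sl])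
    ultimately show ?thesis using multiplicity_ge[OF nn sl] by blast
  qed
  have ev: "jacobi_eigenvalue ?\<phi> P \<kappa>" if "\<kappa> \<in> K \<union> K'" for \<kappa>
  proof -
    have "k \<kappa> + n * k' \<kappa> \<ge> 1" using that K(3)[of \<kappa>] K'(3)[of \<kappa>] n by (auto simp: k_def k'_def)
    then have "enat 0 < enat (k \<kappa> + n * k' \<kappa>)" unfolding enat_ord_simps by linarith
    also note mult
    finally have "enat 0 < jacobi_multiplicity ?\<phi> P \<kappa>" .
    then obtain j F where F: "0 < j" "\<forall>i<j. F i \<in> jacobi_eigenspace ?\<phi> P \<kappa>" "lin_indep_on_cylinder j F"
      unfolding jacobi_multiplicity_def less_SUP_iff by auto
    have "\<exists>q\<in>cylinder. F 0 q \<noteq> 0"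
    proof (rule ccontr)
      assume "\<not> ?thesis"
      then have "\<forall>q\<in>cylinder. (\<Sum>i<j. (if i = 0 then 1 else 0) * F i q) = 0" using F(1)
        by (auto simp: if_distrib[of "\<lambda>x. x * _"] cong: if_cong)
      with F(3)[unfolded lin_indep_on_cylinder_def, THEN spec, of "\<lambda>i. if i = 0 then 1 else 0"]
      have "\<forall>i<j. (if i = 0 then 1 else 0 :: real) = 0" by blast
      then show False using F(1) by auto
    qed
    then show ?thesis using F(1,2) unfolding jacobi_eigenvalue_def by blast
  qed
  have "(\<Sum>\<kappa>\<in>K \<union> K'. k \<kappa>) = (\<Sum>\<kappa>\<in>K. d \<kappa>)" "(\<Sum>\<kappa>\<in>K \<union> K'. k' \<kappa>) = (\<Sum>\<kappa>\<in>K'. d' \<kappa>)"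
    unfolding k_def k'_def using K(1) K'(1) by (auto simp: sum.If_cases intro!: sum.cong)
  then have "enat ((\<Sum>\<kappa>\<in>K. d \<kappa>) + n * (\<Sum>\<kappa>\<in>K'. d' \<kappa>)) = enat (\<Sum>\<kappa>\<in>K \<union> K'. k \<kappa> + n * k' \<kappa>)"
    by (simp add: sum.distrib flip: sum_distrib_left)
  also have "\<dots> = (\<Sum>\<kappa>\<in>K \<union> K'. enat (k \<kappa> + n * k' \<kappa>))"
    using of_nat_sum[of "\<lambda>\<kappa>. k \<kappa> + n * k' \<kappa>" "K \<union> K'", where ?'a = enat] by (simp only: of_nat_eq_enat)
  also have "\<dots> \<le> (\<Sum>\<kappa>\<in>K \<union> K'. jacobi_multiplicity ?\<phi> P \<kappa>)" by (intro sum_mono mult)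
  also have "\<dots> \<le> num_negative_eigenvalues ?\<phi> P"
    unfolding num_negative_eigenvalues_def by (rule SUP_upper) (use K K' ev in auto)
  finally show ?thesis .
qed

end

theorem theorem3p7:
  fixes H c T :: real and r :: "real \<Rightarrow> real" and l m :: int
  assumes dim: "CARD('n::finite) \<ge> 2"
    and c_pos: "c > 0"
    and r_smooth: "smooth_on_open r UNIV"
    and r_range: "\<And>t. 0 < r t \<and> r t < 1"
    and r_nonconst: "\<not> r constant_on UNIV"
    and T_pos: "T > 0"
    and r_periodic: "\<And>t. r (t + T) = r t"
    and T_least: "\<And>S. 0 < S \<Longrightarrow> S < T \<Longrightarrow> \<not> (\<forall>t. r (t + S) = r t)"
    and r_ode: "\<And>t. (deriv r t)\<^sup>2 + (r t)\<^sup>2 * (1 + (rot_lambda CARD('n) H c r t)\<^sup>2) = 1"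
    and lm_coprime: "coprime l m"
    and m_pos: "m \<ge> 1"
    and theta_T: "rot_theta CARD('n) H c r T = 2 * pi * (of_int l / of_int m)"
  shows "ereal_of_enat (num_negative_eigenvalues
           (rot_immersion H c r :: (real^'n) \<times> real \<Rightarrow> (real^'n) \<times> real \<times> real) (of_int m * T))
         \<ge> ereal (of_int ((2 * l - 1) * int CARD('n) + (2 * m - 1)))"
proof -
  interpret rotational_profile "CARD('n)" H c T r
    using dim c_pos r_smooth r_range r_nonconst T_pos r_periodic r_ode
    by unfold_locales (auto simp: smooth_on_open_def)
  define m' where "m' = nat m"
  have m': "m' \<ge> 1" "m = int m'" using m_pos by (auto simp: m'_def)
  let ?P = "real m' * T"
  have sl: "sturm_liouville p (V e) ?P" for e by (rule sturm_liouville_multiple_period[OF m'(1)])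
  obtain K d where K: "finite K" "K \<subseteq> {..<0}" "2 * m' - 1 \<le> (\<Sum>\<kappa>\<in>K. d \<kappa>)" "\<And>\<kappa>. \<kappa> \<in> K \<Longrightarrow> d \<kappa> \<ge> 1"
    "\<And>\<kappa>. \<kappa> \<in> K \<Longrightarrow> \<exists>U. sturm_liouville.independent_eigenfunctions p (V 0) ?P \<kappa> (d \<kappa>) U"
  proof -
    obtain \<alpha> where \<alpha>: "sturm_liouville.F p (V 0) ?P 0 \<alpha> \<ge> \<alpha> + 2 * pi * real m'"
      using radial_turning[OF m'(1)] by blast
    show thesis by (rule sturm_liouville.negative_eigenvalues_from_turning[OF sl \<alpha>]) (rule that)
  qed
  obtain K' d' where K': "finite K'" "K' \<subseteq> {..<0}" "2 * l - 1 \<le> int (\<Sum>\<kappa>\<in>K'. d' \<kappa>)" "\<And>\<kappa>. \<kappa> \<in> K' \<Longrightarrow> d' \<kappa> \<ge> 1"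
    "\<And>\<kappa>. \<kappa> \<in> K' \<Longrightarrow> \<exists>U. sturm_liouville.independent_eigenfunctions p (V 1) ?P \<kappa> (d' \<kappa>) U"
  proof (cases "l \<ge> 1")
    case True
    define l' where "l' = nat l"
    have l': "l' \<ge> 1" "l = int l'" using True by (auto simp: l'_def)
    have "th T = 2 * pi * (real l' / real m')" using theta_T by (simp add: th_def l'(2) m'(2))
    from linear_turning[OF m'(1) l'(1) this]
    obtain \<alpha> where \<alpha>: "sturm_liouville.F p (V 1) ?P 0 \<alpha> \<ge> \<alpha> + 2 * pi * real l'" by blast
    show thesis
    proof (rule sturm_liouville.negative_eigenvalues_from_turning[OF sl \<alpha>])
      fix K' d'
      assume *: "finite K'" "K' \<subseteq> {..<0}" "2 * l' - 1 \<le> (\<Sum>\<kappa>\<in>K'. d' \<kappa>)" "\<And>\<kappa>. \<kappa> \<in> K' \<Longrightarrow> 1 \<le> d' \<kappa>"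
        "\<And>\<kappa>. \<kappa> \<in> K' \<Longrightarrow> \<exists>U. sturm_liouville.independent_eigenfunctions p (V 1) ?P \<kappa> (d' \<kappa>) U"
      have "int (2 * l' - 1) \<le> int (\<Sum>\<kappa>\<in>K'. d' \<kappa>)" using *(3) by (simp only: of_nat_le_iff)
      moreover have "int (2 * l' - 1) = 2 * l - 1" using l' by (simp add: of_nat_diff)
      ultimately have "2 * l - 1 \<le> int (\<Sum>\<kappa>\<in>K'. d' \<kappa>)" by simp
      from that[OF *(1,2) this *(4,5)] show thesis .
    qed
  next
    case False
    show thesis by (rule that[of "{}" "\<lambda>_. 1"]) (use False in auto)
  qed
  let ?N = "(\<Sum>\<kappa>\<in>K. d \<kappa>) + CARD('n) * (\<Sum>\<kappa>\<in>K'. d' \<kappa>)"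
  have ge: "enat ?N \<le> num_negative_eigenvalues (\<phi> :: (real^'n) \<times> real \<Rightarrow> _) ?P"
    by (rule num_negative_eigenvalues_ge[OF refl sl K(1,2,4,5) K'(1,2,4,5)])
  have "(2 * l - 1) * int CARD('n) + (2 * m - 1) \<le> int ?N"
  proof -
    have "int (2 * m' - 1) \<le> int (\<Sum>\<kappa>\<in>K. d \<kappa>)" using K(3) by (simp only: of_nat_le_iff)
    moreover have "int (2 * m' - 1) = 2 * m - 1" using m' by (simp add: of_nat_diff)
    moreover have "(2 * l - 1) * int CARD('n) \<le> int (\<Sum>\<kappa>\<in>K'. d' \<kappa>) * int CARD('n)"
      using K'(3) by (intro mult_right_mono) auto
    moreover have "int ?N = int (\<Sum>\<kappa>\<in>K. d \<kappa>) + int (\<Sum>\<kappa>\<in>K'. d' \<kappa>) * int CARD('n)"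
      by (simp only: of_nat_add of_nat_mult mult.commute)
    ultimately show ?thesis by linarith
  qed
  then have "ereal (of_int ((2 * l - 1) * int CARD('n) + (2 * m - 1))) \<le> ereal (real_of_int (int ?N))"
    by (simp only: ereal_less_eq of_int_le_iff)
  also have "\<dots> = ereal_of_enat (enat ?N)" by simp
  also have "\<dots> \<le> ereal_of_enat (num_negative_eigenvalues (\<phi> :: (real^'n) \<times> real \<Rightarrow> _) ?P)"
    using ge by (simp only: ereal_of_enat_le_iff)
  also have "(\<phi> :: (real^'n) \<times> real \<Rightarrow> _) = rot_immersion H c r" by (rule immersion_eq[symmetric]) (rule refl)
  finally show ?thesis by (simp add: m'(2))
qed

end
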